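(* Let $\mathbb{G}=(V,E)$ be a ribbon graph. Then the set $\mathcal{B}(\mathbb{G}):= \{ T(X,Y,Z) : (X,Y,Z)\in \mathcal{Q}(\mathbb{G}) \}$ is the collection of bases of a tight $3$-matroid with carrier $(U(\mathbb{G}),\Omega)$.
   Context: A ribbon graph $\mathbb G=(V,E)$ is a surface with boundary given as a union of discs, vertices $V$ and edges $E$, such that vertices and edges meet in disjoint line segments, each on the boundary of exactly one vertex and one edge, and each edge contains exactly two such segments. $b(\cdot)$ counts boundary components, $k(\cdot)$ connected components; $\mathbb G\setminus Y$ deletes the edges in $Y$; the partial Petrial $\mathbb G^{\tau(Z)}$ is obtained by, for each $e\in Z$, detaching one end of $e$ and reattaching it with a half-twist. $\mathcal P_3(E)$ is the set of ordered partitions of $E$ into three possibly empty blocks, and $\mathcal Q(\mathbb G)=\{(X,Y,Z)\in\mathcal P_3(E): b(\mathbb G^{\tau(Z)}\setminus Y)=k(\mathbb G)\}$. $U(\mathbb G)=\{\dot e,\bar e,\hat e: e\in E\}$, $\Omega=\{\omega_e: e\in E\}$ with $\omega_e=\{\dot e,\bar e,\hat e\}$, and $T(X,Y,Z)=\{\dot e:e\in X\}\cup\{\bar e:e\in Y\}\cup\{\hat e: e\in Z\}$. A multimatroid on carrier $(U,\Omega)$ ($\Omega$ a partition of finite $U$ into skew classes) is given by a non-negative integer function $r$ on subtransversals (sets meeting each skew class at most once) such that $r$ on each transversal is a matroid rank function and $r(S\cup\{x\})+r(S\cup\{y\})-2r(S)\ge1$ for any subtransversal $S$ and distinct $x,y$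 in a skew class disjoint from $S$; bases are maximal subtransversals with $r(S)=|S|$, and a multimatroid is determined by its bases. A $3$-matroid is one whose skew classes all have size 3. A multimatroid is tight if every skew class has size at least 2 and for every subtransversal $S$ missing exactly one skew class $\omega$ there is $x\in\omega$ with $r(S\cup\{x\})=r(S)$. *)

theory Defs
  imports "HOL-Analysis.Analysis"
begin

section \<open>Surfaces with boundary\<close>

definition surface_with_boundary :: "'a topology \<Rightarrow> bool" where
  "surface_with_boundary X \<longleftrightarrow>
     Hausdorff_space X \<and> second_countable X \<and>
     (\<forall>p \<in> topspace X. \<exists>U W. openin X U \<and> p \<in> U \<and>
        openin (top_of_set {z :: complex. Im z \<ge> 0}) W \<and>
        subtopology X U homeomorphic_space top_of_set W)"

definition surface_boundary :: "'a topology \<Rightarrow> 'a set" where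
  "surface_boundary X =
     {p \<in> topspace X. \<not> (\<exists>U W. openin X U \<and> p \<in> U \<and> open (W :: complex set) \<and>
        subtopology X U homeomorphic_space top_of_set W)}"

definition disc_in :: "'a topology \<Rightarrow> 'a set \<Rightarrow> bool" where
  "disc_in X D \<longleftrightarrow> D \<subseteq> topspace X \<and>
     subtopology X D homeomorphic_space top_of_set (cball (0 :: complex) 1)"

definition line_segment_in :: "'a topology \<Rightarrow> 'a set \<Rightarrow> bool" where
  "line_segment_in X s \<longleftrightarrow> s \<subseteq> topspace X \<and>
     subtopology X s homeomorphic_space top_of_set {0 .. 1 :: real}"


section \<open>Ribbon graphs\<close>

record 'a ribbon =
  surface :: "'a topology"
  vertices :: "'a set set"
  edges :: "'a set set"

text \<open>The segments are the components of the intersection of the union of the vertices with the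
  union of the edges, so they are automatically disjoint.\<close>

definition segments :: "'a ribbon \<Rightarrow> 'a set set" where
  "segments G =
     connected_components_of (subtopology (surface G) (\<Union>(vertices G) \<inter> \<Union>(edges G)))"

definition ribbon_graph :: "'a ribbon \<Rightarrow> bool" where
  "ribbon_graph G \<longleftrightarrow>
     surface_with_boundary (surface G) \<and>
     topspace (surface G) = \<Union>(vertices G) \<union> \<Union>(edges G) \<and>
     finite (vertices G) \<and> finite (edges G) \<and>
     (\<forall>D \<in> vertices G \<union> edges G. disc_in (surface G) D) \<and>
     pairwise disjnt (vertices G) \<and> pairwise disjnt (edges G) \<and>
     (\<forall>s \<in> segments G. line_segment_in (surface G) s \<and>
        (\<exists>!v. v \<in> vertices G \<and> s \<subseteq> surface_boundary (subtopology (surface G) v)) \<and>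
        (\<exists>!e. e \<in> edges G \<and> s \<subseteq> surface_boundary (subtopology (surface G) e))) \<and>
     (\<forall>e \<in> edges G. card {s \<in> segments G. s \<subseteq> e} = 2)"

definition num_boundary_components :: "'a ribbon \<Rightarrow> nat" where
  "num_boundary_components G =
     card (connected_components_of (subtopology (surface G) (surface_boundary (surface G))))"

definition num_components :: "'a ribbon \<Rightarrow> nat" where
  "num_components G = card (connected_components_of (surface G))"

definition delete_edges :: "'a ribbon \<Rightarrow> 'a set set \<Rightarrow> 'a ribbon" where
  "delete_edges G Y =
     \<lparr>surface = subtopology (surface G) (\<Union>(vertices G) \<union> \<Union>(edges G - Y)),
      vertices = vertices G, edges = edges G - Y\<rparr>"


section \<open>Partial Petrials\<close>

text \<open>A half-twist of an edge at one of its two ends \<open>s\<close>: the map that reverses the segment \<open>s\<close>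
  (with respect to some parametrisation by the unit interval) and fixes every other point.\<close>

definition half_twist :: "'a ribbon \<Rightarrow> 'a set \<Rightarrow> ('a \<Rightarrow> 'a) \<Rightarrow> bool" where
  "half_twist G e h \<longleftrightarrow>
     (\<exists>s \<gamma>. s \<in> segments G \<and> s \<subseteq> e \<and>
        homeomorphic_map (top_of_set {0 .. 1 :: real}) (subtopology (surface G) s) \<gamma> \<and>
        (\<forall>t \<in> {0 .. 1}. h (\<gamma> t) = \<gamma> (1 - t)) \<and>
        (\<forall>x. x \<notin> s \<longrightarrow> h x = x))"

text \<open>Suppose all edges are detached from the vertices and each edge \<open>e\<close> is glued back along its two
  ends by the map \<open>h e\<close>: a point \<open>x\<close> of an end of the detached disc \<open>e\<close> is identified with the
  point \<open>h e x\<close> of a vertex. If \<open>h e\<close> permutes each end of \<open>e\<close> and fixes the other points of \<open>e\<close>,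
  then, when the point of the quotient represented by \<open>x\<close> in the detached copy of \<open>e\<close> is called
  \<open>h e x\<close>, the quotient has the same points as the surface of \<open>G\<close>, and the predicate below
  describes the open sets of its quotient topology.\<close>

definition reglued_open :: "'a ribbon \<Rightarrow> ('a set \<Rightarrow> 'a \<Rightarrow> 'a) \<Rightarrow> 'a set \<Rightarrow> bool" where
  "reglued_open G h U \<longleftrightarrow>
     U \<subseteq> topspace (surface G) \<and>
     openin (subtopology (surface G) (\<Union>(vertices G))) (U \<inter> \<Union>(vertices G)) \<and>
     (\<forall>e \<in> edges G. openin (subtopology (surface G) e) {x \<in> e. h e x \<in> U})"

lemma istopology_reglued_open: "istopology (reglued_open G h)"
  unfolding istopology_def
proof (intro conjI allI impI)
  fix S T assume ST: "reglued_open G h S" "reglued_open G h T"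
  have 1: "S \<inter> T \<inter> \<Union>(vertices G) = (S \<inter> \<Union>(vertices G)) \<inter> (T \<inter> \<Union>(vertices G))"
    by blast
  have 2: "{x \<in> e. h e x \<in> S \<inter> T} = {x \<in> e. h e x \<in> S} \<inter> {x \<in> e. h e x \<in> T}" for e
    by blast
  show "reglued_open G h (S \<inter> T)"
    using ST unfolding reglued_open_def 1 2 by (blast intro: openin_Int)
next
  fix K assume K: "\<forall>S\<in>K. reglued_open G h S"
  have 1: "(\<Union>K) \<inter> \<Union>(vertices G) = (\<Union>S\<in>K. S \<inter> \<Union>(vertices G))"
    by blast
  have 2: "{x \<in> e. h e x \<in> \<Union>K} = (\<Union>S\<in>K. {x \<in> e. h e x \<in> S})" for e
    by blast
  show "reglued_open G h (\<Union>K)"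
    using K unfolding reglued_open_def 1 2 by (blast intro: openin_Union)
qed

definition reglue :: "'a ribbon \<Rightarrow> ('a set \<Rightarrow> 'a \<Rightarrow> 'a) \<Rightarrow> 'a ribbon" where
  "reglue G h =
     \<lparr>surface = topology (reglued_open G h), vertices = vertices G, edges = edges G\<rparr>"

lemma openin_reglue: "openin (surface (reglue G h)) U \<longleftrightarrow> reglued_open G h U"
  by (simp add: reglue_def istopology_reglued_open topology_inverse')

text \<open>The choice of the end at which an edge is twisted, and of its parametrisation, affects the
  result only up to homeomorphism.\<close>

definition partial_petrial :: "'a ribbon \<Rightarrow> 'a set set \<Rightarrow> 'a ribbon" where
  "partial_petrial G Z =
     reglue G (\<lambda>e. if e \<in> Z then (SOME h. half_twist G e h) else id)"


section \<open>Multimatroids\<close>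

definition subtransversal :: "'u set \<Rightarrow> 'u set set \<Rightarrow> 'u set \<Rightarrow> bool" where
  "subtransversal U \<Omega> S \<longleftrightarrow> S \<subseteq> U \<and> (\<forall>\<omega>\<in>\<Omega>. card (S \<inter> \<omega>) \<le> 1)"

definition transversal :: "'u set \<Rightarrow> 'u set set \<Rightarrow> 'u set \<Rightarrow> bool" where
  "transversal U \<Omega> T \<longleftrightarrow> T \<subseteq> U \<and> (\<forall>\<omega>\<in>\<Omega>. card (T \<inter> \<omega>) = 1)"

definition matroid_rank_function :: "'u set \<Rightarrow> ('u set \<Rightarrow> nat) \<Rightarrow> bool" where
  "matroid_rank_function T r \<longleftrightarrow>
     (\<forall>A. A \<subseteq> T \<longrightarrow> r A \<le> card A) \<and>
     (\<forall>A B. A \<subseteq> B \<and> B \<subseteq> T \<longrightarrow> r A \<le> r B) \<and>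
     (\<forall>A B. A \<subseteq> T \<and> B \<subseteq> T \<longrightarrow> r (A \<union> B) + r (A \<inter> B) \<le> r A + r B)"

text \<open>Only the values of \<open>r\<close> on subtransversals are relevant.\<close>

definition multimatroid :: "'u set \<Rightarrow> 'u set set \<Rightarrow> ('u set \<Rightarrow> nat) \<Rightarrow> bool" where
  "multimatroid U \<Omega> r \<longleftrightarrow>
     finite U \<and> partition_on U \<Omega> \<and>
     (\<forall>T. transversal U \<Omega> T \<longrightarrow> matroid_rank_function T r) \<and>
     (\<forall>S \<omega> x y. subtransversal U \<Omega> S \<and> \<omega> \<in> \<Omega> \<and> S \<inter> \<omega> = {} \<and>
        x \<in> \<omega> \<and> y \<in> \<omega> \<and> x \<noteq> y \<longrightarrow>
        int (r (S \<union> {x})) + int (r (S \<union> {y})) - 2 * int (r S) \<ge> 1)"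

definition multimatroid_bases :: "'u set \<Rightarrow> 'u set set \<Rightarrow> ('u set \<Rightarrow> nat) \<Rightarrow> 'u set set" where
  "multimatroid_bases U \<Omega> r =
     {B. subtransversal U \<Omega> B \<and> r B = card B \<and>
         (\<forall>S. subtransversal U \<Omega> S \<and> r S = card S \<and> B \<subseteq> S \<longrightarrow> S = B)}"

definition q_matroid :: "nat \<Rightarrow> 'u set \<Rightarrow> 'u set set \<Rightarrow> ('u set \<Rightarrow> nat) \<Rightarrow> bool" where
  "q_matroid q U \<Omega> r \<longleftrightarrow> multimatroid U \<Omega> r \<and> (\<forall>\<omega>\<in>\<Omega>. card \<omega> = q)"

definition tight_multimatroid :: "'u set \<Rightarrow> 'u set set \<Rightarrow> ('u set \<Rightarrow> nat) \<Rightarrow> bool" where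
  "tight_multimatroid U \<Omega> r \<longleftrightarrow>
     multimatroid U \<Omega> r \<and> (\<forall>\<omega>\<in>\<Omega>. card \<omega> \<ge> 2) \<and>
     (\<forall>S \<omega>. subtransversal U \<Omega> S \<and> \<omega> \<in> \<Omega> \<and> S \<inter> \<omega> = {} \<and>
        (\<forall>\<omega>'\<in>\<Omega> - {\<omega>}. S \<inter> \<omega>' \<noteq> {}) \<longrightarrow>
        (\<exists>x\<in>\<omega>. r (S \<union> {x}) = r S))"


section \<open>The set system of a ribbon graph\<close>

datatype 'e decorated = Dot 'e | Bar 'e | Hat 'e

definition skew_class :: "'e \<Rightarrow> 'e decorated set" where
  "skew_class e = {Dot e, Bar e, Hat e}"

definition carrier_set :: "'a ribbon \<Rightarrow> 'a set decorated set" where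
  "carrier_set G = Dot ` edges G \<union> Bar ` edges G \<union> Hat ` edges G"

definition skew_classes :: "'a ribbon \<Rightarrow> 'a set decorated set set" where
  "skew_classes G = skew_class ` edges G"

definition ordered_tripartitions :: "'e set \<Rightarrow> ('e set \<times> 'e set \<times> 'e set) set" where
  "ordered_tripartitions E =
     {(X, Y, Z). X \<union> Y \<union> Z = E \<and> X \<inter> Y = {} \<and> X \<inter> Z = {} \<and> Y \<inter> Z = {}}"

definition quasi_tree_triples :: "'a ribbon \<Rightarrow> ('a set set \<times> 'a set set \<times> 'a set set) set" where
  "quasi_tree_triples G =
     {(X, Y, Z) \<in> ordered_tripartitions (edges G).
        num_boundary_components (delete_edges (partial_petrial G Z) Y) = num_components G}"

definition triple_transversal :: "'e set \<times> 'e set \<times> 'e set \<Rightarrow> 'e decorated set" where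
  "triple_transversal = (\<lambda>(X, Y, Z). Dot ` X \<union> Bar ` Y \<union> Hat ` Z)"

definition ribbon_bases :: "'a ribbon \<Rightarrow> 'a set decorated set set" where
  "ribbon_bases G = {triple_transversal (X, Y, Z) | X Y Z. (X, Y, Z) \<in> quasi_tree_triples G}"

end

theory Submission
  imports Defs
begin

text \<open>
  Cut the boundary circles of the vertices at the ends of all segments and discard the segments; the
  remaining arcs are the nodes of a graph. Every edge has four corners, the ends of its two segments,
  and each of the three choices for an edge (keep, delete, twist) joins its corners in pairs in one of
  the three possible ways, by the sides or by the ends of the edge. A boundary component is then a
  connected class of the graph whose nodes are joined by the chosen pairings, while the components
  of the ribbon graph are the classes obtained when all four corners of each edge are joined. Let
  \<open>K S\<close> be the number of classes when the edges decided in \<open>S\<close> are paired and the others joined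
  completely. Then \<open>r S = |S| + K \<emptyset> - K S\<close> is the rank function. On a transversal it is the dual of a
  graphic matroid rank. Since a node has zero or two corners, every class contains an even number
  of corners of a given edge, so at most one of the three ways to decide a further edge raises
  \<open>K\<close>; if all other edges are decided, the nodes form paths and cycles and exactly one way does.

  The boundary of the glued surface consists of the arcs and sides that one expects: invariance of domain identifies the intrinsic boundary of a disc with its circle, a segment
  becomes interior because two half strips are glued along it, and its ends stay on the boundary
  because the boundary is closed.
\<close>

section \<open>Connected classes of a graph\<close>

text \<open>An edge decided in any of the three ways is one link, \<open>joint x\<close>, short of
  an undecided one. So on a transversal T, contract \<open>rel T\<close> and take the links
  \<open>joint x\<close> with x in T: if \<rho>(F) is \<open>K T\<close> minus the number of classes
  after adding the links F, the dual rank |A| + \<rho>(T - A) - \<rho>(T) equals |A| +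
  \<open>K {}\<close> - \<open>K A\<close>. A basis is thus a transversal with
  \<open>K T = K {}\<close>, which is the equation between boundary components and components that
  defines quasi-trees. The obstacle is that a surface is a bare topological space: nothing records
  which corners a side joins or which points are on the boundary. Both are read off after cutting a
  boundary circle open at a point inside a segment, which makes it a line on which arcs are
  intervals. Regluing keeps the points and changes only the topology, so discs, segments and arcs
  stay the same sets and \<open>h e\<close> merely renames points of \<open>e\<close>. Twisting
  either end of an edge gives the same unordered pairing of corners, so an arbitrary choice of
  half-twist can be handled.\<close>

definition eqcl :: "('n \<times> 'n) set \<Rightarrow> ('n \<times> 'n) set" where
  "eqcl R = (R \<union> R\<inverse>)\<^sup>*"

text \<open>Relations live on the whole type, where every outside point is a class of its own; only
  classes that meet \<open>N\<close> count.\<close>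

definition num_classes :: "'n set \<Rightarrow> ('n \<times> 'n) set \<Rightarrow> nat" where
  "num_classes N R = card ((\<lambda>a. eqcl R `` {a}) ` N)"

lemma eqcl_refl [simp]: "(a, a) \<in> eqcl R"
  by (simp add: eqcl_def)

lemma eqcl_base: "(a, b) \<in> R \<Longrightarrow> (a, b) \<in> eqcl R"
  by (auto simp: eqcl_def)

lemma eqcl_superset: "R \<subseteq> eqcl R"
  by (auto simp: eqcl_def)

lemma eqcl_sym: "(a, b) \<in> eqcl R \<Longrightarrow> (b, a) \<in> eqcl R"
  unfolding eqcl_def by (metis converse_Un converse_converse rtrancl_converseD rtrancl_converseI sup_commute)

lemma eqcl_trans: "(a, b) \<in> eqcl R \<Longrightarrow> (b, c) \<in> eqcl R \<Longrightarrow> (a, c) \<in> eqcl R"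
  by (auto simp: eqcl_def)

lemma eqcl_induct [consumes 1, case_names refl sym trans base]:
  assumes "(a, b) \<in> eqcl R"
    and refl: "\<And>a. P a a" and sym: "\<And>a b. P a b \<Longrightarrow> P b a"
    and trans: "\<And>a b c. P a b \<Longrightarrow> P b c \<Longrightarrow> P a c"
    and base: "\<And>a b. (a, b) \<in> R \<Longrightarrow> P a b"
  shows "P a b"
  using assms(1) unfolding eqcl_def
  by (induction rule: rtrancl_induct) (use assms(2-) in blast)+

lemma eqcl_least:
  assumes "R \<subseteq> eqcl Q" shows "eqcl R \<subseteq> eqcl Q"
proof -
  have "(a, b) \<in> eqcl Q" if "(a, b) \<in> eqcl R" for a b
    using that assms by (induction rule: eqcl_induct) (auto intro: eqcl_sym eqcl_trans)
  then show ?thesis by auto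
qed

lemma eqcl_mono: "R \<subseteq> Q \<Longrightarrow> eqcl R \<subseteq> eqcl Q"
  by (rule eqcl_least) (auto intro: eqcl_base)

lemma eqcl_eqI: "R \<subseteq> eqcl Q \<Longrightarrow> Q \<subseteq> eqcl R \<Longrightarrow> eqcl R = eqcl Q"
  by (simp add: eqcl_least subset_antisym)

lemma eqcl_Un_cong: "eqcl R = eqcl Q \<Longrightarrow> eqcl (R \<union> P) = eqcl (Q \<union> P)"
proof -
  assume "eqcl R = eqcl Q"
  then have "R \<subseteq> eqcl Q" "Q \<subseteq> eqcl R"
    by (auto intro: eqcl_base)
  then show ?thesis
    using eqcl_mono[of Q "Q \<union> P"] eqcl_mono[of R "R \<union> P"]
    by (intro eqcl_eqI) (auto intro: eqcl_base)
qed

lemma eqcl_class_eq: "eqcl R `` {a} = eqcl R `` {b} \<longleftrightarrow> (a, b) \<in> eqcl R"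
  by (auto intro: eqcl_sym eqcl_trans)

lemma eqcl_closed: "R \<subseteq> N \<times> N \<Longrightarrow> a \<in> N \<Longrightarrow> eqcl R `` {a} \<subseteq> N"
proof -
  assume R: "R \<subseteq> N \<times> N" and a: "a \<in> N"
  have "x \<in> N \<longleftrightarrow> y \<in> N" if "(x, y) \<in> eqcl R" for x y
    using that by (induction rule: eqcl_induct) (use R in auto)
  with a show ?thesis by auto
qed

text \<open>The number of values depends only on which arguments are identified. This lets classes,
  merged classes and labels be compared through their equality relation alone.\<close>

lemma card_image_kernel:
  assumes "\<And>x y. x \<in> A \<Longrightarrow> y \<in> A \<Longrightarrow> f x = f y \<longleftrightarrow> g x = g y"
  shows "card (f ` A) = card (g ` A)"
proof -
  have *: "g (inv_into A f (f x)) = g x" if "x \<in> A" for x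
    using assms[of "inv_into A f (f x)" x] that by (simp add: f_inv_into_f inv_into_into)
  have "inj_on (\<lambda>X. g (inv_into A f X)) (f ` A)"
    by (auto simp: inj_on_def * assms)
  moreover have "(\<lambda>X. g (inv_into A f X)) ` f ` A = g ` A"
    by (auto simp: image_image * intro!: image_cong)
  ultimately show ?thesis by (metis card_image)
qed

lemma num_classes_cong: "eqcl R = eqcl Q \<Longrightarrow> num_classes N R = num_classes N Q"
  by (simp add: num_classes_def)

lemma num_classes_insert_same:
  "(a, b) \<in> eqcl R \<Longrightarrow> num_classes N (insert (a, b) R) = num_classes N R"
  by (rule num_classes_cong, rule eqcl_eqI) (auto intro: eqcl_base)

text \<open>The new class map has the same kernel as the old one followed by the merging map
  \<open>f\<close>, which identifies exactly two of its values.\<close>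

lemma num_classes_insert_diff:
  assumes ab: "(a, b) \<notin> eqcl R" "a \<in> N" "b \<in> N" and fin: "finite N"
  shows "num_classes N (insert (a, b) R) + 1 = num_classes N R"
proof -
  let ?L = "\<lambda>x. eqcl R `` {x}" and ?L' = "\<lambda>x. eqcl (insert (a, b) R) `` {x}"
  define f where "f L = (if L = ?L a \<or> L = ?L b then ?L a \<union> ?L b else L)" for L
  have sub: "eqcl R \<subseteq> eqcl (insert (a, b) R)"
    by (rule eqcl_mono) auto
  have ab': "(a, b) \<in> eqcl (insert (a, b) R)"
    by (rule eqcl_base) simp
  have key: "(x, y) \<in> eqcl (insert (a, b) R) \<longleftrightarrow> f (?L x) = f (?L y)" for x y
  proof
    assume "(x, y) \<in> eqcl (insert (a, b) R)"
    then show "f (?L x) = f (?L y)"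
    proof (induction rule: eqcl_induct)
      case (refl x) show ?case ..
    next
      case (sym x y) then show ?case by (rule HOL.sym)
    next
      case (trans x y z) from trans show ?case by (rule HOL.trans)
    next
      case (base x y)
      then have "x = a \<and> y = b \<or> (x, y) \<in> eqcl R"
        by (auto intro: eqcl_base)
      then consider "x = a" "y = b" | "?L x = ?L y"
        unfolding eqcl_class_eq by blast
      then show ?case
        by cases (simp_all add: f_def)
    qed
  next
    assume eq: "f (?L x) = f (?L y)"
    have r: "z \<in> f (?L z)" for z
    proof -
      have "?L z \<subseteq> f (?L z)"
        unfolding f_def by (cases "?L z = ?L a \<or> ?L z = ?L b") (simp_all only: if_True if_False, blast)
      then show ?thesis by auto
    qed
    have "y \<in> f (?L x)" using r eq by metis
    then have "y \<in> ?L x \<or> ?L x = ?L a \<and> y \<in> ?L b \<or> ?L x = ?L b \<and> y \<in> ?L a"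
      by (simp only: f_def split: if_splits) blast+
    then have "(x, y) \<in> eqcl R \<or> (x, a) \<in> eqcl R \<and> (b, y) \<in> eqcl R
        \<or> (x, b) \<in> eqcl R \<and> (a, y) \<in> eqcl R"
      unfolding eqcl_class_eq by blast
    then show "(x, y) \<in> eqcl (insert (a, b) R)"
      using sub ab' eqcl_sym[OF ab'] eqcl_trans[where R = "insert (a, b) R"] by (meson subsetD)
  qed
  have inj: "card (?L' ` N) = card (f ` ?L ` N)"
    unfolding image_image by (rule card_image_kernel) (simp only: eqcl_class_eq key)
  have Lne: "?L a \<noteq> ?L b" using ab by (simp add: eqcl_class_eq)
  have "f ` ?L ` N = f ` (?L ` N - {?L b})"
    using ab Lne by (auto simp: f_def image_iff)
  moreover have "inj_on f (?L ` N - {?L b})"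
  proof (rule inj_onI)
    fix X Y assume X: "X \<in> ?L ` N - {?L b}" and Y: "Y \<in> ?L ` N - {?L b}" and eq: "f X = f Y"
    \<comment> \<open>A class containing both \<open>a\<close> and \<open>b\<close> would relate
      them, so the merged set is no old class and \<open>f\<close> is injective once the class of
      \<open>b\<close> is left out.\<close>
    have no: "Z \<noteq> ?L a \<union> ?L b" if Z: "Z \<in> ?L ` N" for Z
    proof
      assume Z': "Z = ?L a \<union> ?L b"
      from Z obtain z where z: "Z = ?L z" by auto
      have "a \<in> Z" "b \<in> Z" unfolding Z' by simp_all
      then have "(z, a) \<in> eqcl R" "(z, b) \<in> eqcl R" unfolding z by simp_all
      then show False using ab(1) eqcl_sym eqcl_trans by metis
    qed
    have "X \<noteq> ?L b" "Y \<noteq> ?L b" "X \<noteq> ?L a \<union> ?L b" "Y \<noteq> ?L a \<union> ?L b"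
      using X Y no by auto
    then show "X = Y"
      using eq unfolding f_def by (simp split: if_splits)
  qed
  ultimately have "card (f ` ?L ` N) = card (?L ` N - {?L b})"
    by (simp add: card_image)
  also have "\<dots> + 1 = card (?L ` N)"
    using ab fin by (metis Suc_eq_plus1 card_Suc_Diff1 finite_imageI imageI)
  finally show ?thesis
    using inj unfolding num_classes_def by simp
qed

lemma num_classes_insert:
  assumes "a \<in> N" "b \<in> N" "finite N"
  shows "num_classes N R = num_classes N (insert (a, b) R) + (if (a, b) \<in> eqcl R then 0 else 1)"
  using num_classes_insert_same[of a b R N] num_classes_insert_diff[OF _ assms, of R] by auto

text \<open>Starting from singletons, each pair merges at most two classes; so connecting n nodes
  takes at least n - 1 pairs.\<close>

lemma num_classes_ge:
  assumes "finite N" "finite R" "R \<subseteq> N \<times> N"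
  shows "card N \<le> num_classes N R + card R"
  using assms(2,3)
proof (induction R rule: finite_induct)
  case empty
  have "inj_on (\<lambda>a. eqcl {} `` {a}) N"
    by (auto simp: inj_on_def eqcl_def)
  then show ?case by (simp add: num_classes_def card_image)
next
  case (insert p R)
  obtain a b where p: "p = (a, b)" by (cases p)
  show ?case
    using insert num_classes_insert[of a N b R] assms(1) unfolding p by (auto split: if_splits)
qed

text \<open>A path that starts in a class never leaves it, so a class is connected by its own pairs.
  Pairs can therefore be counted within a single class.\<close>

lemma eqcl_restrict_class:
  assumes "C = eqcl R `` {a}" "x \<in> C"
  shows "(a, x) \<in> eqcl (R \<inter> C \<times> C)"
proof -
  have "(a, x) \<in> (R \<union> R\<inverse>)\<^sup>*" using assms by (simp add: eqcl_def)
  then show ?thesis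
  proof (induction rule: rtrancl_induct)
    case (step y z)
    have "y \<in> C" using step(1) assms(1) by (simp add: eqcl_def)
    moreover have "z \<in> C" using rtrancl_into_rtrancl[OF step(1,2)] assms(1) by (simp add: eqcl_def)
    ultimately have "(y, z) \<in> eqcl (R \<inter> C \<times> C)"
      using step(2) by (auto intro: eqcl_base eqcl_sym)
    then show ?case using step(3) eqcl_trans by metis
  qed simp
qed

text \<open>Unit increase and the inequality for two new elements imply the global axioms by adding
  elements one at a time. The local form suits \<open>rank\<close>, whose changes are controlled for
  one decision at a time.\<close>

lemma matroid_rank_functionI:
  assumes fin: "finite T" and r0: "r {} = 0"
    and inc: "\<And>A x. A \<subseteq> T \<Longrightarrow> x \<in> T - A \<Longrightarrow> r A \<le> r (insert x A) \<and> r (insert x A) \<le> r A + 1"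
    and sub: "\<And>A x y. A \<subseteq> T \<Longrightarrow> x \<in> T - A \<Longrightarrow> y \<in> T - A \<Longrightarrow> x \<noteq> y \<Longrightarrow>
               r (insert y (insert x A)) + r A \<le> r (insert x A) + r (insert y A)"
  shows "matroid_rank_function T r"
proof -
  have bound: "r A \<le> card A" if "A \<subseteq> T" for A
  proof -
    have "finite A" using that fin finite_subset by blast
    then show ?thesis using that
    proof (induction A rule: finite_induct)
      case (insert x A)
      then show ?case using inc[of A x] by simp
    qed (simp add: r0)
  qed
  have add: "finite D \<Longrightarrow> A \<union> D \<subseteq> T \<Longrightarrow> r A \<le> r (A \<union> D)" for A D
  proof (induction D rule: finite_induct)
    case (insert x D)
    then show ?case
      using inc[of "A \<union> D" x] by (cases "x \<in> A") (auto simp: insert_absorb)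
  qed simp
  have mono: "r A \<le> r B" if "A \<subseteq> B" "B \<subseteq> T" for A B
    using add[of "B - A" A] that fin by (metis Diff_partition finite_Diff finite_subset)
  \<comment> \<open>Diminishing returns: enlarging the set by \<open>D\<close> cannot increase what
    \<open>x\<close> adds.\<close>
  have dim: "finite D \<Longrightarrow> A \<union> D \<subseteq> T \<Longrightarrow> x \<in> T - (A \<union> D) \<Longrightarrow>
      r (insert x (A \<union> D)) + r A \<le> r (insert x A) + r (A \<union> D)" for A D x
  proof (induction D rule: finite_induct)
    case (insert y D)
    show ?case
    proof (cases "y \<in> A")
      case True
      then show ?thesis using insert by (simp add: insert_absorb)
    next
      case False
      have "r (insert y (insert x (A \<union> D))) + r (A \<union> D) \<le> r (insert x (A \<union> D)) + r (insert y (A \<union> D))"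
        by (rule sub) (use insert False in auto)
      then show ?thesis using insert by (simp add: insert_commute)
    qed
  qed simp
  \<comment> \<open>Summing the diminishing returns over \<open>D\<close>; later \<open>C\<close> is
    the intersection of the two sets and \<open>D\<close> their difference.\<close>
  have subm: "finite D \<Longrightarrow> D \<subseteq> T \<Longrightarrow> D \<inter> B = {} \<Longrightarrow> C \<subseteq> B \<Longrightarrow> B \<subseteq> T \<Longrightarrow>
      r (B \<union> D) + r C \<le> r (C \<union> D) + r B" for B C D
  proof (induction D rule: finite_induct)
    case (insert x D)
    have "r (insert x ((C \<union> D) \<union> B)) + r (C \<union> D) \<le> r (insert x (C \<union> D)) + r ((C \<union> D) \<union> B)"
      by (rule dim) (use insert fin finite_subset in auto)
    moreover have "(C \<union> D) \<union> B = B \<union> D" using insert by auto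
    ultimately show ?case using insert by simp
  qed simp
  have "r (A \<union> B) + r (A \<inter> B) \<le> r A + r B" if "A \<subseteq> T" "B \<subseteq> T" for A B
  proof -
    have "r (B \<union> (A - B)) + r (A \<inter> B) \<le> r ((A \<inter> B) \<union> (A - B)) + r B"
      by (rule subm) (use that finite_subset[OF that(1) fin] in auto)
    moreover have "B \<union> (A - B) = A \<union> B" "(A \<inter> B) \<union> (A - B) = A" by auto
    ultimately show ?thesis by simp
  qed
  with bound mono show ?thesis unfolding matroid_rank_function_def by auto
qed

section \<open>The multimatroid of a graph with split edges\<close>

fun base_edge :: "'e decorated \<Rightarrow> 'e" where
  "base_edge (Dot e) = e" | "base_edge (Bar e) = e" | "base_edge (Hat e) = e"

lemma base_edge_in_skew_class [simp]: "x \<in> skew_class e \<longleftrightarrow> base_edge x = e"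
  by (cases x) (auto simp: skew_class_def)

text \<open>
  The function \<open>nd e\<close> gives the nodes at the four corners of the edge \<open>e\<close>, numbered \<open>0, ..., 3\<close>.
  The sum in the last assumption counts the corners at the node \<open>n\<close>.
\<close>

locale corner_graph =
  fixes N :: "'n set" and E :: "'e set" and nd :: "'e \<Rightarrow> nat \<Rightarrow> 'n"
  assumes finite_N: "finite N" and finite_E: "finite E"
    and nd_in: "\<And>e i. e \<in> E \<Longrightarrow> i < 4 \<Longrightarrow> nd e i \<in> N"
    and hits: "\<And>n. n \<in> N \<Longrightarrow> (\<Sum>e\<in>E. \<Sum>i<4. of_bool (nd e i = n)) \<in> {0, 2::nat}"
begin

text \<open>The pairs follow the boundary curve past the edge: along its two sides if it is kept
  (0-1, 2-3), along the two exposed segments if it is deleted (0-2, 1-3), and along the sides after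
  one end has been swapped if it is twisted (0-3, 1-2).\<close>

fun matching :: "'e decorated \<Rightarrow> ('n \<times> 'n) set" where
  "matching (Dot e) = {(nd e 0, nd e 1), (nd e 2, nd e 3)}"
| "matching (Bar e) = {(nd e 0, nd e 2), (nd e 1, nd e 3)}"
| "matching (Hat e) = {(nd e 0, nd e 3), (nd e 1, nd e 2)}"

definition star :: "'e \<Rightarrow> ('n \<times> 'n) set" where
  "star e = {(nd e 0, nd e 1), (nd e 0, nd e 2), (nd e 0, nd e 3)}"

definition rel :: "'e decorated set \<Rightarrow> ('n \<times> 'n) set" where
  "rel S = (\<Union>x\<in>S. matching x) \<union> (\<Union>e\<in>E - base_edge ` S. star e)"

definition K :: "'e decorated set \<Rightarrow> nat" where
  "K S = num_classes N (rel S)"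

text \<open>Restores the unsplit edge from either of the three ways to split it.\<close>
fun joint :: "'e decorated \<Rightarrow> 'n \<times> 'n" where
  "joint (Dot e) = (nd e 0, nd e 2)"
| "joint (Bar e) = (nd e 0, nd e 1)"
| "joint (Hat e) = (nd e 0, nd e 1)"

text \<open>What the undecided state and the three decisions at \<open>e\<close> have in common;
  they differ only in adding \<open>star e\<close> or one of the matchings.\<close>

definition rest :: "'e decorated set \<Rightarrow> 'e \<Rightarrow> ('n \<times> 'n) set" where
  "rest S e = (\<Union>x\<in>S. matching x) \<union> (\<Union>e'\<in>E - base_edge ` S - {e}. star e')"

definition partial :: "'e decorated set \<Rightarrow> bool" where
  "partial S \<longleftrightarrow> base_edge ` S \<subseteq> E \<and> inj_on base_edge S"

lemma less_4_cases: "i < 4 \<longleftrightarrow> i = 0 \<or> i = 1 \<or> i = 2 \<or> i = (3::nat)"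
  by auto

lemma sum_less_4: "(\<Sum>i<4::nat. f i) = f 0 + f 1 + f 2 + (f 3 :: nat)"
  by (simp add: eval_nat_numeral)

lemma rel_split: "e \<in> E \<Longrightarrow> e \<notin> base_edge ` S \<Longrightarrow> rel S = rest S e \<union> star e"
  by (auto simp: rel_def rest_def)

lemma rel_insert: "base_edge x \<notin> base_edge ` S \<Longrightarrow> rel (insert x S) = rest S (base_edge x) \<union> matching x"
  by (auto simp: rel_def rest_def)

lemma rel_subset: "partial S \<Longrightarrow> rel S \<subseteq> N \<times> N"
proof -
  assume S: "partial S"
  have "matching x \<subseteq> N \<times> N" if "x \<in> S" for x
    using that S nd_in[of "base_edge x"] by (cases x) (force simp: partial_def)+
  moreover have "star e \<subseteq> N \<times> N" if "e \<in> E" for e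
    using that nd_in by (auto simp: star_def)
  ultimately show ?thesis unfolding rel_def by blast
qed

lemma rest_subset: "partial S \<Longrightarrow> rest S e \<subseteq> N \<times> N"
  using rel_subset[of S] by (auto simp: rest_def rel_def)

text \<open>Two complementary pairs of corners and one link between them already connect all four
  corners.\<close>

lemma eqcl_star: "eqcl (star (base_edge x)) = eqcl (insert (joint x) (matching x))"
proof -
  have t: "(a, b) \<in> eqcl R" if "(c, a) \<in> eqcl R" "(c, b) \<in> eqcl R" for a b c :: 'n and R
    using that eqcl_sym eqcl_trans by metis
  show ?thesis
  proof (rule eqcl_eqI)
    let ?Q = "insert (joint x) (matching x)" and ?e = "base_edge x"
    have "(nd ?e 0, nd ?e 1) \<in> eqcl ?Q \<and> (nd ?e 0, nd ?e 2) \<in> eqcl ?Q \<and> (nd ?e 0, nd ?e 3) \<in> eqcl ?Q"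
    proof (cases x)
      case (Dot e)
      then show ?thesis
        using eqcl_trans[of "nd e 0" "nd e 2" ?Q "nd e 3"] eqcl_base[of _ _ ?Q] by auto
    next
      case (Bar e)
      then show ?thesis
        using eqcl_trans[of "nd e 0" "nd e 1" ?Q "nd e 3"] eqcl_base[of _ _ ?Q] by auto
    next
      case (Hat e)
      then show ?thesis
        using eqcl_trans[of "nd e 0" "nd e 1" ?Q "nd e 2"] eqcl_base[of _ _ ?Q] by auto
    qed
    then show "star ?e \<subseteq> eqcl ?Q" by (simp add: star_def)
    let ?P = "star ?e"
    have p: "(nd ?e 0, nd ?e i) \<in> eqcl ?P" if "i < 4" for i
      using that eqcl_base[of _ _ ?P] by (auto simp: star_def less_4_cases)
    have "(nd ?e i, nd ?e j) \<in> eqcl ?P" if "i < 4" "j < 4" for i j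
      using t p that by blast
    then show "?Q \<subseteq> eqcl ?P" by (cases x) auto
  qed
qed

lemma matching_subset_eqcl_star: "matching x \<subseteq> eqcl (star (base_edge x))"
  unfolding eqcl_star by (auto intro: eqcl_base)

lemma partial_insert:
  "partial (insert x S) \<longleftrightarrow> partial S \<and> base_edge x \<in> E \<and> (x \<in> S \<or> base_edge x \<notin> base_edge ` S)"
  unfolding partial_def by (auto simp: inj_on_def image_iff insert_absorb)

lemma joint_in: "base_edge x \<in> E \<Longrightarrow> fst (joint x) \<in> N \<and> snd (joint x) \<in> N"
  by (cases x) (auto intro: nd_in)

text \<open>Removing the link \<open>joint x\<close> creates a new class exactly if it was a bridge,
  that is, if its ends are not connected without it.\<close>

lemma K_step:
  assumes "e \<in> E" "e \<notin> base_edge ` S" "base_edge x = e"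
  shows "K (insert x S) = K S + (if joint x \<in> eqcl (rel (insert x S)) then 0 else 1)"
proof -
  have "eqcl (rel S) = eqcl (insert (joint x) (matching x) \<union> rest S e)"
    using eqcl_Un_cong[OF eqcl_star[of x], of "rest S e"] rel_split[OF assms(1,2)] assms(3)
    by (simp add: Un_commute)
  also have "insert (joint x) (matching x) \<union> rest S e = insert (joint x) (rel (insert x S))"
    using rel_insert[of x S] assms by auto
  finally have "K S = num_classes N (insert (joint x) (rel (insert x S)))"
    unfolding K_def by (rule num_classes_cong)
  then show ?thesis
    using num_classes_insert[of "fst (joint x)" N "snd (joint x)" "rel (insert x S)"]
      joint_in[of x] finite_N assms by (simp add: K_def)
qed

text \<open>A bridge stays a bridge when further links are removed, so the gain of deciding
  \<open>x\<close> can only grow once \<open>y\<close> is decided. This supermodularity of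
  \<open>K\<close> is the submodularity of \<open>rank\<close>.\<close>

lemma K_submodular:
  assumes "x \<noteq> y" "partial (insert x (insert y A))" "x \<notin> A" "y \<notin> A"
  shows "K (insert x A) + K (insert y A) \<le> K (insert x (insert y A)) + K A"
proof -
  have x: "base_edge x \<in> E" "base_edge x \<notin> base_edge ` A" "base_edge x \<notin> base_edge ` insert y A"
    and y: "base_edge y \<in> E" "base_edge y \<notin> base_edge ` A" "base_edge y \<notin> base_edge ` insert x A"
    using assms by (auto simp: partial_def inj_on_def image_iff)
  have "rel (insert x (insert y A)) \<subseteq> eqcl (rel (insert x A))"
  proof -
    have "rel (insert x (insert y A)) = rest (insert x A) (base_edge y) \<union> matching y"
      using rel_insert[OF y(3)] by (simp add: insert_commute)
    moreover have "rel (insert x A) = rest (insert x A) (base_edge y) \<union> star (base_edge y)"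
      by (rule rel_split) (use y in auto)
    ultimately show ?thesis
      using matching_subset_eqcl_star[of y] eqcl_mono[of "star (base_edge y)" "rel (insert x A)"]
      by (auto intro: eqcl_base)
  qed
  then have "eqcl (rel (insert x (insert y A))) \<subseteq> eqcl (rel (insert x A))"
    by (rule eqcl_least)
  then show ?thesis
    using K_step[OF x(1,2) refl] K_step[OF x(1,3) refl] by auto
qed

section \<open>Parity of the corners in a class\<close>

definition cnt :: "'n set \<Rightarrow> 'e \<Rightarrow> nat" where
  "cnt C e = (\<Sum>i<4. of_bool (nd e i \<in> C))"

lemma cnt_eq: "cnt C e = of_bool (nd e 0 \<in> C) + of_bool (nd e 1 \<in> C) + of_bool (nd e 2 \<in> C) + of_bool (nd e 3 \<in> C)"
  unfolding cnt_def by (rule sum_less_4)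

text \<open>Double counting of the incidences between corners and nodes of \<open>C\<close>, so that
  the bound on the corners of one node can be applied.\<close>

lemma sum_cnt:
  assumes "C \<subseteq> N"
  shows "(\<Sum>e\<in>E. cnt C e) = (\<Sum>n\<in>C. \<Sum>e\<in>E. \<Sum>i<4. of_bool (nd e i = n))"
proof -
  have fC: "finite C" using assms finite_N finite_subset by blast
  have "(\<Sum>n\<in>C. of_bool (nd e i = n)) = (of_bool (nd e i \<in> C) :: nat)" for e i
    using fC by (simp add: of_bool_def sum.delta)
  then have 1: "cnt C e = (\<Sum>i<4. \<Sum>n\<in>C. of_bool (nd e i = n))" for e
    by (simp add: cnt_def)
  have 2: "cnt C e = (\<Sum>n\<in>C. \<Sum>i<4. of_bool (nd e i = n))" for e
    unfolding 1 by (rule sum.swap)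
  show ?thesis
    unfolding 2 by (rule sum.swap)
qed

lemma closed_pair: "(a, b) \<in> R \<Longrightarrow> a \<in> eqcl R `` {c} \<longleftrightarrow> b \<in> eqcl R `` {c}"
  by (metis Image_singleton_iff eqcl_base eqcl_sym eqcl_trans)

text \<open>
  Counted over all edges, the corners in a class are even in number, because every node has zero or
  two of them; every edge other than \<open>e\<close> contributes an even number.
\<close>

lemma even_cnt:
  assumes S: "partial S" and e: "e \<in> E" "e \<notin> base_edge ` S" and a: "a \<in> N"
  shows "even (cnt (eqcl (rest S e) `` {a}) e)"
proof -
  let ?C = "eqcl (rest S e) `` {a}"
  have C: "?C \<subseteq> N" by (rule eqcl_closed[OF rest_subset[OF S] a])
  have "even (cnt ?C e')" if e': "e' \<in> E - {e}" for e'
  proof (cases "e' \<in> base_edge ` S")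
    case True
    then obtain x where x: "x \<in> S" "e' = base_edge x" by auto
    have "b \<in> ?C \<longleftrightarrow> c \<in> ?C" if "(b, c) \<in> matching x" for b c
      by (rule closed_pair) (use x that in \<open>auto simp: rest_def\<close>)
    then show ?thesis using x(2) by (cases x) (auto simp: cnt_eq)
  next
    case False
    have "b \<in> ?C \<longleftrightarrow> c \<in> ?C" if "(b, c) \<in> star e'" for b c
      by (rule closed_pair) (use e' False that in \<open>auto simp: rest_def\<close>)
    then show ?thesis by (auto simp: cnt_eq star_def)
  qed
  then have "even (\<Sum>e'\<in>E - {e}. cnt ?C e')" by (rule dvd_sum)
  moreover have "even (\<Sum>e'\<in>E. cnt ?C e')"
    unfolding sum_cnt[OF C] by (rule dvd_sum) (use C hits in fastforce)
  moreover have "(\<Sum>e'\<in>E. cnt ?C e') = cnt ?C e + (\<Sum>e'\<in>E - {e}. cnt ?C e')"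
    using e finite_E by (simp add: sum.remove)
  ultimately show ?thesis by simp
qed

text \<open>As every class contains an even number of the four corners, these lie all in one class
  or split into two pairs, and such a splitting is one of the three matchings.\<close>

lemma corner_classes:
  assumes S: "partial S" and e: "e \<in> E" "e \<notin> base_edge ` S"
  defines "R \<equiv> rest S e"
  shows "star e \<subseteq> eqcl R \<or>
    (\<exists>x0. base_edge x0 = e \<and> matching x0 \<subseteq> eqcl R \<and> joint x0 \<notin> eqcl R)"
proof -
  define C where "C i = eqcl R `` {nd e i}" for i
  have ev: "even (cnt (C i) e)" if "i < 4" for i
    unfolding C_def R_def by (rule even_cnt) (use S e nd_in that in auto)
  have mem: "nd e j \<in> C i \<longleftrightarrow> (nd e i, nd e j) \<in> eqcl R" for i j
    by (simp add: C_def)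
  let ?r = "\<lambda>i j. (nd e i, nd e j) \<in> eqcl R"
  have s: "?r i j \<Longrightarrow> ?r j i" and t: "?r i j \<Longrightarrow> ?r j k \<Longrightarrow> ?r i k" for i j k
    using eqcl_sym eqcl_trans by metis+
  have even_iff: "even (of_bool a + of_bool b + of_bool c + of_bool d :: nat) \<longleftrightarrow> (a \<noteq> b) = (c \<noteq> d)" for a b c d
    by auto
  \<comment> \<open>Besides corner 0 itself, its class holds an odd number of the other three;
    likewise for corners 1 and 2 below.\<close>
  have e0: "(\<not> ?r 0 1) \<noteq> (?r 0 2 \<noteq> ?r 0 3) \<Longrightarrow> False"
    using ev[of 0] unfolding cnt_eq mem even_iff by auto
  have e1: "(\<not> ?r 1 0) \<noteq> (?r 1 2 \<noteq> ?r 1 3) \<Longrightarrow> False"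
    using ev[of 1] unfolding cnt_eq mem even_iff by auto
  have e2: "(\<not> ?r 2 3) \<noteq> (?r 2 0 \<noteq> ?r 2 1) \<Longrightarrow> False"
    using ev[of 2] unfolding cnt_eq mem even_iff by auto
  consider "?r 0 1" "?r 0 2" | "?r 0 1" "\<not> ?r 0 2" | "\<not> ?r 0 1" "?r 0 2" | "\<not> ?r 0 1" "\<not> ?r 0 2" "?r 0 3"
    using e0 by blast
  then show ?thesis
  proof cases
    case 1
    then have "star e \<subseteq> eqcl R" using e0 by (auto simp: star_def)
    then show ?thesis ..
  next
    case 2
    then have "?r 2 3" using e2 s t by blast
    then have "matching (Dot e) \<subseteq> eqcl R \<and> joint (Dot e) \<notin> eqcl R" using 2 by simp
    then show ?thesis by (metis base_edge.simps(1))
  next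
    case 3
    then have "?r 1 3" using e1 s t by blast
    then have "matching (Bar e) \<subseteq> eqcl R \<and> joint (Bar e) \<notin> eqcl R" using 3 by simp
    then show ?thesis by (metis base_edge.simps(2))
  next
    case 4
    then have "?r 1 2" using e1 s t by blast
    then have "matching (Hat e) \<subseteq> eqcl R \<and> joint (Hat e) \<notin> eqcl R" using 4 by simp
    then show ?thesis by (metis base_edge.simps(3))
  qed
qed

text \<open>Two of the three perfect matchings of the corners together form a 4-cycle.\<close>

lemma star_subset_of_two:
  assumes "base_edge x = e" "base_edge y = e" "x \<noteq> y"
  shows "star e \<subseteq> eqcl (matching x \<union> matching y)"
proof -
  let ?Q = "matching x \<union> matching y"
  have b: "(a, b) \<in> eqcl ?Q \<and> (b, a) \<in> eqcl ?Q" if "(a, b) \<in> ?Q" for a b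
    using that eqcl_base eqcl_sym by metis
  let ?r = "\<lambda>i j. (nd e i, nd e j) \<in> eqcl ?Q"
  have xy: "x \<in> {Dot e, Bar e, Hat e}" "y \<in> {Dot e, Bar e, Hat e}"
    using assms by (cases x; simp) (use assms in \<open>cases y; simp\<close>)
  have "?r 0 1 \<and> ?r 2 3" if "x = Dot e \<or> y = Dot e" using that b by auto
  moreover have "?r 0 2 \<and> ?r 1 3" if "x = Bar e \<or> y = Bar e" using that b by auto
  moreover have "?r 0 3 \<and> ?r 1 2 \<and> ?r 2 1" if "x = Hat e \<or> y = Hat e" using that b by auto
  ultimately have "?r 0 1 \<and> ?r 0 2 \<and> ?r 0 3"
    using xy assms(3) eqcl_trans[of "nd e 0" "nd e 2" ?Q "nd e 3"]
      eqcl_trans[of "nd e 0" "nd e 1" ?Q "nd e 2"] eqcl_trans[of "nd e 0" "nd e 2" ?Q "nd e 1"]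
    by blast
  then show ?thesis by (simp add: star_def)
qed

text \<open>If all corners are joined outside \<open>e\<close>, no decision separates anything.
  Otherwise they are joined outside along one matching \<open>x0\<close>: choosing \<open>x0\<close>
  itself leaves its two pairs apart, while any other matching closes a cycle through all four
  corners. The second conclusion singles out the case in which a separating decision exists.\<close>

lemma K_split:
  assumes S: "partial S" and e: "e \<in> E" "e \<notin> base_edge ` S"
  shows "(\<forall>x. base_edge x = e \<longrightarrow> K (insert x S) = K S) \<or>
    (\<exists>x0. base_edge x0 = e \<and> K (insert x0 S) = K S + 1 \<and>
       (\<forall>x. base_edge x = e \<and> x \<noteq> x0 \<longrightarrow> K (insert x S) = K S))"
  and "\<not> star e \<subseteq> eqcl (rest S e) \<Longrightarrow> \<exists>x0. base_edge x0 = e \<and> K (insert x0 S) = K S + 1"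
proof -
  let ?R = "rest S e"
  have ins: "rel (insert x S) = ?R \<union> matching x" if "base_edge x = e" for x
    using rel_insert[of x S] that e by simp
  have 1: "K (insert x S) = K S" if st: "star e \<subseteq> eqcl (rel (insert x S))" and x: "base_edge x = e" for x
  proof -
    have "joint x \<in> eqcl (star e)"
      unfolding x[symmetric] eqcl_star by (rule subsetD[OF eqcl_superset]) simp
    then have "joint x \<in> eqcl (rel (insert x S))" using eqcl_least[OF st] by blast
    then show ?thesis using K_step[OF e x] by simp
  qed
  have R: "eqcl ?R \<subseteq> eqcl (rel (insert x S))" if "base_edge x = e" for x
    unfolding ins[OF that] by (rule eqcl_mono) auto
  have A: "(\<forall>x. base_edge x = e \<longrightarrow> K (insert x S) = K S)" if "star e \<subseteq> eqcl ?R"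
    using 1[OF order.trans[OF that R]] by blast
  have B: "K (insert x0 S) = K S + 1 \<and> (\<forall>x. base_edge x = e \<and> x \<noteq> x0 \<longrightarrow> K (insert x S) = K S)"
    if x0: "base_edge x0 = e" "matching x0 \<subseteq> eqcl ?R" "joint x0 \<notin> eqcl ?R" for x0
  proof -
    have "eqcl (rel (insert x0 S)) \<subseteq> eqcl ?R"
      unfolding ins[OF x0(1)] by (rule eqcl_least) (use x0(2) eqcl_superset[of ?R] in blast)
    then have "joint x0 \<notin> eqcl (rel (insert x0 S))" using x0(3) by blast
    then have "K (insert x0 S) = K S + 1" using K_step[OF e x0(1)] by simp
    moreover have "K (insert x S) = K S" if x: "base_edge x = e" "x \<noteq> x0" for x
    proof (rule 1[OF _ x(1)])
      have "matching x \<union> matching x0 \<subseteq> eqcl (rel (insert x S))"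
        using x0(2) R[OF x(1)] eqcl_superset[of "rel (insert x S)"] unfolding ins[OF x(1)] by blast
      then have "eqcl (matching x \<union> matching x0) \<subseteq> eqcl (rel (insert x S))" by (rule eqcl_least)
      then show "star e \<subseteq> eqcl (rel (insert x S))"
        using star_subset_of_two[OF x(1) x0(1) x(2)] by blast
    qed
    ultimately show ?thesis by blast
  qed
  show "(\<forall>x. base_edge x = e \<longrightarrow> K (insert x S) = K S) \<or>
    (\<exists>x0. base_edge x0 = e \<and> K (insert x0 S) = K S + 1 \<and>
       (\<forall>x. base_edge x = e \<and> x \<noteq> x0 \<longrightarrow> K (insert x S) = K S))"
    using corner_classes[OF S e] A B by blast
  show "\<not> star e \<subseteq> eqcl (rest S e) \<Longrightarrow> \<exists>x0. base_edge x0 = e \<and> K (insert x0 S) = K S + 1"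
    using corner_classes[OF S e] B by blast
qed

lemma finite_partial: "partial S \<Longrightarrow> finite S"
  unfolding partial_def using finite_E by (meson finite_imageD finite_subset)

text \<open>Each pair inside \<open>C\<close> accounts for two corners in \<open>C\<close>;
  coinciding pairs count only once, hence an inequality.\<close>

lemma card_matching_class: "2 * card (matching x \<inter> C \<times> C) \<le> cnt C (base_edge x)"
proof -
  have *: "2 * card ({(a, b), (c, d)} \<inter> C \<times> C) \<le>
      of_bool (a \<in> C) + of_bool (b \<in> C) + (of_bool (c \<in> C) + of_bool (d \<in> C) :: nat)" for a b c d
    by (cases "a \<in> C"; cases "b \<in> C"; cases "c \<in> C"; cases "d \<in> C") (auto simp: card_insert_if)
  show ?thesis
  proof (cases x)
    case (Dot e)
    then show ?thesis
      unfolding Dot matching.simps base_edge.simps cnt_eq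
      using *[of "nd e 0" "nd e 1" "nd e 2" "nd e 3"] by linarith
  next
    case (Bar e)
    then show ?thesis
      unfolding Bar matching.simps base_edge.simps cnt_eq
      using *[of "nd e 0" "nd e 2" "nd e 1" "nd e 3"] by linarith
  next
    case (Hat e)
    then show ?thesis
      unfolding Hat matching.simps base_edge.simps cnt_eq
      using *[of "nd e 0" "nd e 3" "nd e 1" "nd e 2"] by linarith
  qed
qed

text \<open>
  If a class \<open>C\<close> contained all four corners of the only undecided edge, at most \<open>card C - 2\<close> pairs
  would be left to connect its nodes.
\<close>

lemma K_split_last:
  assumes S: "partial S" and e: "e \<in> E" and all: "base_edge ` S = E - {e}"
  shows "\<exists>x0. base_edge x0 = e \<and> K (insert x0 S) = K S + 1"
proof (rule K_split(2)[OF S e])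
  show "e \<notin> base_edge ` S" using all by auto
  let ?R = "rest S e"
  have R: "?R = (\<Union>x\<in>S. matching x)" using all by (auto simp: rest_def)
  show "\<not> star e \<subseteq> eqcl ?R"
  proof
    assume st: "star e \<subseteq> eqcl ?R"
    define C where "C = eqcl ?R `` {nd e 0}"
    have CN: "C \<subseteq> N" unfolding C_def by (rule eqcl_closed[OF rest_subset[OF S]]) (use e nd_in in auto)
    then have fC: "finite C" using finite_N finite_subset by blast
    have "nd e 0 \<in> C" "nd e 1 \<in> C" "nd e 2 \<in> C" "nd e 3 \<in> C"
      using st by (auto simp: C_def star_def)
    then have cnt4: "cnt C e = 4" by (simp add: cnt_eq)
    let ?m = "card (?R \<inter> C \<times> C)"
    have fm: "finite (matching x)" for x by (cases x) auto
    have "2 * ?m \<le> (\<Sum>x\<in>S. 2 * card (matching x \<inter> C \<times> C))"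
      unfolding R using card_UN_le[OF finite_partial[OF S], of "\<lambda>x. matching x \<inter> C \<times> C"]
      by (simp add: sum_distrib_left[symmetric] Int_UN_distrib2)
    also have "\<dots> \<le> (\<Sum>x\<in>S. cnt C (base_edge x))"
      by (rule sum_mono) (rule card_matching_class)
    also have "\<dots> = (\<Sum>e'\<in>E - {e}. cnt C e')"
      using S all by (subst all[symmetric], subst sum.reindex) (auto simp: partial_def)
    finally have "2 * ?m + 4 \<le> (\<Sum>e'\<in>E. cnt C e')"
      using cnt4 e finite_E by (simp add: sum.remove)
    \<comment> \<open>Each node of \<open>C\<close> has at most two corners, and four corners are
      taken by \<open>e\<close>.\<close>
    also have "\<dots> \<le> (\<Sum>n\<in>C. 2)"
      unfolding sum_cnt[OF CN] by (rule sum_mono) (use hits CN in fastforce)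
    finally have m: "?m + 2 \<le> card C" by simp
    have "finite ?R" unfolding R using finite_partial[OF S] fm by auto
    \<comment> \<open>Connecting \<open>C\<close> takes at least \<open>card C - 1\<close> pairs,
      one more than are left.\<close>
    then have "card C \<le> num_classes C (?R \<inter> C \<times> C) + ?m"
      by (intro num_classes_ge) (use fC in auto)
    moreover have "num_classes C (?R \<inter> C \<times> C) \<le> 1"
    proof -
      have "eqcl (?R \<inter> C \<times> C) `` {a} = eqcl (?R \<inter> C \<times> C) `` {nd e 0}" if "a \<in> C" for a
        unfolding eqcl_class_eq using eqcl_restrict_class[OF C_def that] by (rule eqcl_sym)
      then have "(\<lambda>a. eqcl (?R \<inter> C \<times> C) `` {a}) ` C \<subseteq> {eqcl (?R \<inter> C \<times> C) `` {nd e 0}}"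
        by auto
      from card_mono[OF _ this] show ?thesis unfolding num_classes_def by simp
    qed
    ultimately show False using m by simp
  qed
qed

text \<open>The subtraction never truncates on partial sets, since one decision raises
  \<open>K\<close> by at most one (\<open>K_le\<close>); \<open>rank_eq\<close> is the form without
  subtraction.\<close>

definition rank :: "'e decorated set \<Rightarrow> nat" where
  "rank S = card S + K {} - K S"

lemma partial_empty [simp]: "partial {}"
  by (simp add: partial_def)

lemma partial_subset: "partial S \<Longrightarrow> A \<subseteq> S \<Longrightarrow> partial A"
  unfolding partial_def by (meson image_mono inj_on_subset order.trans)

lemma K_mono_insert: "partial (insert x S) \<Longrightarrow> x \<notin> S \<Longrightarrow> K S \<le> K (insert x S) \<and> K (insert x S) \<le> K S + 1"
  using K_step[of "base_edge x" S x] by (auto simp: partial_insert)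

lemma K_le: "partial S \<Longrightarrow> K S \<le> K {} + card S"
proof -
  assume S: "partial S"
  from finite_partial[OF S] S show ?thesis
  proof (induction S rule: finite_induct)
    case (insert x S)
    then show ?case using K_mono_insert[of x S] by (auto simp: partial_insert)
  qed simp
qed

lemma rank_eq: "partial S \<Longrightarrow> rank S + K S = card S + K {}"
  using K_le[of S] by (simp add: rank_def)

lemma rank_insert: "partial (insert x S) \<Longrightarrow> x \<notin> S \<Longrightarrow> rank (insert x S) + K (insert x S) = rank S + K S + 1"
  using rank_eq[of S] rank_eq[of "insert x S"] finite_partial[of S] by (auto simp: partial_insert)

section \<open>Multimatroid axioms, tightness and bases\<close>

definition ground :: "'e decorated set" where
  "ground = Dot ` E \<union> Bar ` E \<union> Hat ` E"

lemma ground_iff: "x \<in> ground \<longleftrightarrow> base_edge x \<in> E"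
  by (cases x) (auto simp: ground_def)

lemma finite_ground: "finite ground"
  using finite_E by (simp add: ground_def)

lemma card_Int_skew_class_le:
  "finite S \<Longrightarrow> card (S \<inter> skew_class e) \<le> 1 \<longleftrightarrow> (\<forall>x\<in>S. \<forall>y\<in>S. base_edge x = e \<and> base_edge y = e \<longrightarrow> x = y)"
  by (auto simp: card_le_Suc0_iff_eq)

lemma subtransversal_iff: "subtransversal ground (skew_class ` E) S \<longleftrightarrow> partial S"
proof
  assume S: "subtransversal ground (skew_class ` E) S"
  then have g: "S \<subseteq> ground" by (simp add: subtransversal_def)
  then have "finite S" using finite_ground finite_subset by blast
  then show "partial S"
    using S g card_Int_skew_class_le[of S] unfolding subtransversal_def partial_def inj_on_def
    by (auto simp: ground_iff)
next
  assume S: "partial S"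
  then have "S \<subseteq> ground" by (auto simp: partial_def ground_iff)
  then show "subtransversal ground (skew_class ` E) S"
    using S card_Int_skew_class_le[OF finite_partial[OF S]]
    unfolding subtransversal_def partial_def inj_on_def by auto
qed

lemma transversal_iff: "transversal ground (skew_class ` E) T \<longleftrightarrow> partial T \<and> base_edge ` T = E"
proof -
  have "transversal ground (skew_class ` E) T \<longleftrightarrow>
      subtransversal ground (skew_class ` E) T \<and> (\<forall>e\<in>E. T \<inter> skew_class e \<noteq> {})"
  proof (cases "T \<subseteq> ground")
    case True
    then have "finite (T \<inter> skew_class e)" for e using finite_ground finite_subset by blast
    then have "card (T \<inter> skew_class e) = 1 \<longleftrightarrow> card (T \<inter> skew_class e) \<le> 1 \<and> T \<inter> skew_class e \<noteq> {}" for e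
      by (metis One_nat_def card_gt_0_iff le_antisym less_one linorder_not_less nat_le_linear zero_neq_one)
    then show ?thesis unfolding transversal_def subtransversal_def by auto
  qed (auto simp: transversal_def subtransversal_def)
  also have "\<dots> \<longleftrightarrow> partial T \<and> base_edge ` T = E"
    unfolding subtransversal_iff by (auto simp: partial_def image_iff set_eq_iff) (metis)+
  finally show ?thesis .
qed

lemma partial_disjoint_class: "S \<inter> skew_class e = {} \<longleftrightarrow> e \<notin> base_edge ` S"
  by auto

text \<open>On a transversal, the unit steps of \<open>K\<close> and its supermodularity give a
  matroid. For two elements of a skew class, the left-hand side of the second axiom is 2 minus the
  two increases of \<open>K\<close>, of which at most one is 1 and the other 0.\<close>

lemma multimatroid_rank: "multimatroid ground (skew_class ` E) rank"
  unfolding multimatroid_def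
proof (intro conjI allI impI)
  show "finite ground" by (rule finite_ground)
  show "partition_on ground (skew_class ` E)"
  proof (rule partition_onI)
    show "\<Union>(skew_class ` E) = ground" by (auto simp: ground_iff)
    show "disjnt p q" if "p \<in> skew_class ` E" "q \<in> skew_class ` E" "p \<noteq> q" for p q
      using that by (auto simp: disjnt_iff)
  qed (auto simp: skew_class_def)
  show "matroid_rank_function T rank" if T: "transversal ground (skew_class ` E) T" for T
  proof (rule matroid_rank_functionI)
    have pT: "partial T" using T transversal_iff by blast
    then show "finite T" by (rule finite_partial)
    show "rank {} = 0" by (simp add: rank_def)
    show "rank A \<le> rank (insert x A) \<and> rank (insert x A) \<le> rank A + 1" if A: "A \<subseteq> T" "x \<in> T - A" for A x
    proof -
      have "partial (insert x A)" by (rule partial_subset[OF pT]) (use A in auto)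
      then show ?thesis using K_mono_insert[of x A] rank_insert[of x A] A by auto
    qed
    show "rank (insert y (insert x A)) + rank A \<le> rank (insert x A) + rank (insert y A)"
      if A: "A \<subseteq> T" "x \<in> T - A" "y \<in> T - A" "x \<noteq> y" for A x y
    proof -
      have p: "partial (insert y (insert x A))" by (rule partial_subset[OF pT]) (use A in auto)
      moreover have "partial (insert x A)" "partial (insert y A)"
        by (rule partial_subset[OF p], blast)+
      ultimately show ?thesis
        using K_submodular[of y x A] rank_insert[of x A] rank_insert[of y A] rank_insert[of y "insert x A"] A
        by auto
    qed
  qed
next
  fix S \<omega> x y
  assume *: "subtransversal ground (skew_class ` E) S \<and> \<omega> \<in> skew_class ` E \<and> S \<inter> \<omega> = {} \<and>
       x \<in> \<omega> \<and> y \<in> \<omega> \<and> x \<noteq> y"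
  then obtain e where e1: "e \<in> E" and \<omega>: "\<omega> = skew_class e" by blast
  have S: "partial S" and xy: "base_edge x = e" "base_edge y = e" "x \<noteq> y"
    using * unfolding subtransversal_iff \<omega> by auto
  have "e \<notin> base_edge ` S" using * unfolding \<omega> partial_disjoint_class by blast
  note e = e1 this
  have "z \<notin> S" if "base_edge z = e" for z
    using e(2) imageI[of z S base_edge] unfolding that by argo
  then have "x \<notin> S" "y \<notin> S" using xy by simp_all
  moreover have "partial (insert x S)" "partial (insert y S)"
    unfolding partial_insert xy using S e by blast+
  ultimately have p: "partial (insert x S)" "partial (insert y S)" "x \<notin> S" "y \<notin> S"
    by blast+
  have "K (insert x S) = K S \<or> K (insert y S) = K S"
    using K_split(1)[OF S e] xy by metis
  then have "K (insert x S) + K (insert y S) \<le> 2 * K S + 1"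
    using K_mono_insert[OF p(1,3)] K_mono_insert[OF p(2,4)] by auto
  with p show "int (rank (S \<union> {x})) + int (rank (S \<union> {y})) - 2 * int (rank S) \<ge> 1"
    using rank_insert[of x S] rank_insert[of y S] by simp
qed

lemma card_skew_class: "card (skew_class e) = 3"
  by (simp add: skew_class_def)

text \<open>A decision that raises \<open>K\<close> by one cancels the growth of the cardinality,
  and with a single edge undecided such a decision exists.\<close>

lemma tight_rank: "tight_multimatroid ground (skew_class ` E) rank"
  unfolding tight_multimatroid_def
proof (intro conjI allI impI)
  fix S \<omega>
  assume *: "subtransversal ground (skew_class ` E) S \<and> \<omega> \<in> skew_class ` E \<and> S \<inter> \<omega> = {} \<and>
        (\<forall>\<omega>'\<in>skew_class ` E - {\<omega>}. S \<inter> \<omega>' \<noteq> {})"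
  then obtain e where e1: "e \<in> E" and \<omega>: "\<omega> = skew_class e" by blast
  have S: "partial S" using * unfolding subtransversal_iff by blast
  have "e \<notin> base_edge ` S" using * unfolding \<omega> partial_disjoint_class by blast
  note e = e1 this
  have "e' \<in> base_edge ` S" if "e' \<in> E" "e' \<noteq> e" for e'
  proof -
    have "skew_class e' \<noteq> \<omega>" using that unfolding \<omega> by (auto simp: skew_class_def)
    then have "S \<inter> skew_class e' \<noteq> {}" using * that by auto
    then show ?thesis by auto
  qed
  then have "base_edge ` S = E - {e}" using S e by (auto simp: partial_def)
  then obtain x where x: "base_edge x = e" "K (insert x S) = K S + 1"
    using K_split_last[OF S e(1)] by blast
  then have "rank (insert x S) = rank S"
    using rank_insert[of x S] S e by (auto simp: partial_insert)
  then show "\<exists>x\<in>\<omega>. rank (S \<union> {x}) = rank S" using x(1) \<omega> by auto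
qed (auto simp: multimatroid_rank card_skew_class)

lemma independent_iff: "partial S \<Longrightarrow> rank S = card S \<longleftrightarrow> K S = K {}"
  using rank_eq[of S] by auto

text \<open>Independence means that no decision has raised \<open>K\<close>. At an undecided edge at
  least two of the three decisions leave \<open>K\<close> unchanged, so an independent set that
  misses a class extends, and the bases are transversals.\<close>

lemma bases_rank:
  "multimatroid_bases ground (skew_class ` E) rank = {T. partial T \<and> base_edge ` T = E \<and> K T = K {}}"
proof (intro set_eqI iffI)
  fix B assume B: "B \<in> multimatroid_bases ground (skew_class ` E) rank"
  then have pB: "partial B" and KB: "K B = K {}"
    and max: "\<And>S. partial S \<Longrightarrow> rank S = card S \<Longrightarrow> B \<subseteq> S \<Longrightarrow> S = B"
    unfolding multimatroid_bases_def subtransversal_iff using independent_iff by auto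
  have "e \<in> base_edge ` B" if e: "e \<in> E" for e
  proof (rule ccontr)
    assume e': "e \<notin> base_edge ` B"
    from K_split(1)[OF pB e e'] obtain x where x: "base_edge x = e" "K (insert x B) = K B"
      by (metis base_edge.simps decorated.distinct(1))
    have p: "partial (insert x B)" using pB e e' x by (auto simp: partial_insert)
    have "insert x B = B"
      by (rule max[OF p]) (use independent_iff[OF p] x KB in auto)
    then show False using x e' by auto
  qed
  then show "B \<in> {T. partial T \<and> base_edge ` T = E \<and> K T = K {}}"
    using pB KB by (auto simp: partial_def)
next
  fix T assume "T \<in> {T. partial T \<and> base_edge ` T = E \<and> K T = K {}}"
  then have T: "partial T" "base_edge ` T = E" "K T = K {}" by auto
  have "S = T" if S: "partial S" "T \<subseteq> S" for S
  proof -
    have "s \<in> T" if "s \<in> S" for s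
    proof -
      have "base_edge s \<in> base_edge ` T" using that S T by (auto simp: partial_def)
      then obtain t where "t \<in> T" "base_edge t = base_edge s" by auto
      then show ?thesis using S that by (metis inj_onD partial_def subsetD)
    qed
    then show ?thesis using S by blast
  qed
  then show "T \<in> multimatroid_bases ground (skew_class ` E) rank"
    unfolding multimatroid_bases_def subtransversal_iff using T independent_iff by auto
qed

end

section \<open>Surface boundaries and discs\<close>

lemma label_class_clopen:
  assumes "finite F" and cl: "\<And>A. A \<in> F \<Longrightarrow> closedin X A" and cov: "\<Union>F = topspace X"
    and lab: "\<And>A B. A \<in> F \<Longrightarrow> B \<in> F \<Longrightarrow> A \<inter> B \<noteq> {} \<Longrightarrow> lab A = lab B"
  shows "closedin X (\<Union>{A \<in> F. lab A = l})" "openin X (\<Union>{A \<in> F. lab A = l})"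
proof -
  have c: "closedin X (\<Union>{A \<in> F. P A})" for P
    by (rule closedin_Union) (use assms in auto)
  show "closedin X (\<Union>{A \<in> F. lab A = l})" by (rule c)
  have "topspace X - \<Union>{A \<in> F. lab A \<noteq> l} = \<Union>{A \<in> F. lab A = l}"
    using cov lab by blast
  then show "openin X (\<Union>{A \<in> F. lab A = l})"
    using openin_diff[OF openin_topspace c[of "\<lambda>A. lab A \<noteq> l"]] by (rule subst)
qed

text \<open>The pieces of one label form a clopen set, so no component leaves it; by
  \<open>joined\<close> it lies within one component. Hence the components are the label
  classes.\<close>

lemma card_connected_components_of_labels:
  assumes fin: "finite F" and cl: "\<And>A. A \<in> F \<Longrightarrow> closedin X A" and cov: "\<Union>F = topspace X"
    and lab: "\<And>A B. A \<in> F \<Longrightarrow> B \<in> F \<Longrightarrow> A \<inter> B \<noteq> {} \<Longrightarrow> lab A = lab B"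
    and ne: "\<And>A. A \<in> F \<Longrightarrow> A \<noteq> {}"
    and joined: "\<And>A B. A \<in> F \<Longrightarrow> B \<in> F \<Longrightarrow> lab A = lab B \<Longrightarrow> \<exists>T. connectedin X T \<and> A \<union> B \<subseteq> T"
  shows "card (connected_components_of X) = card (lab ` F)"
proof -
  define W where "W l = \<Union>{A \<in> F. lab A = l}" for l
  have clopen: "closedin X (W l)" "openin X (W l)" for l
    unfolding W_def
    by ((rule label_class_clopen(1); use fin cl cov lab in simp), (rule label_class_clopen(2); use fin cl cov lab in simp))
  have comp: "connected_component_of_set X a = W (lab A)" if A: "A \<in> F" "a \<in> A" for A a
  proof
    have a: "a \<in> topspace X" using A cov by auto
    have aW: "a \<in> W (lab A)" using A by (auto simp: W_def)
    have "connectedin X (connected_component_of_set X a)" by (rule connectedin_connected_component_of)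
    from connectedin_clopen_cases[OF this clopen, of "lab A"]
    show "connected_component_of_set X a \<subseteq> W (lab A)"
      using aW a by (auto simp: disjnt_iff connected_component_of_refl)
    show "W (lab A) \<subseteq> connected_component_of_set X a"
    proof
      fix y assume "y \<in> W (lab A)"
      then obtain B where B: "B \<in> F" "lab B = lab A" "y \<in> B" by (auto simp: W_def)
      then obtain T where "connectedin X T" "A \<union> B \<subseteq> T" using joined[of A B] A by auto
      then show "y \<in> connected_component_of_set X a"
        using A B by (auto simp: connected_component_of_def)
    qed
  qed
  have "connected_components_of X = (\<lambda>A. W (lab A)) ` F"
  proof
    show "connected_components_of X \<subseteq> (\<lambda>A. W (lab A)) ` F"
      unfolding connected_components_of_def using comp cov by fastforce
    show "(\<lambda>A. W (lab A)) ` F \<subseteq> connected_components_of X"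
    proof
      fix C assume "C \<in> (\<lambda>A. W (lab A)) ` F"
      then obtain A where A: "A \<in> F" "C = W (lab A)" by auto
      then obtain a where "a \<in> A" using ne by auto
      then have "a \<in> topspace X" "C = connected_component_of_set X a" using comp cov A by auto
      then show "C \<in> connected_components_of X" by (auto simp: connected_components_of_def)
    qed
  qed
  also have "card \<dots> = card (lab ` F)"
  proof (rule card_image_kernel)
    fix A B assume AB: "A \<in> F" "B \<in> F"
    show "W (lab A) = W (lab B) \<longleftrightarrow> lab A = lab B"
    proof
      assume eq: "W (lab A) = W (lab B)"
      obtain a where a: "a \<in> A" using ne AB by auto
      then have "a \<in> W (lab B)" using eq AB by (auto simp: W_def)
      then obtain B' where "B' \<in> F" "lab B' = lab B" "a \<in> B'" by (auto simp: W_def)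
      then show "lab A = lab B" using lab[of A B'] AB a by auto
    qed simp
  qed
  finally show ?thesis .
qed

text \<open>A connected space has room for only one clopen label class. This is a way to go around
  the boundary circle of a vertex without ordering its arcs.\<close>

lemma connected_label_constant:
  assumes conn: "connected_space X" and fin: "finite F" and cl: "\<And>A. A \<in> F \<Longrightarrow> closedin X A"
    and cov: "\<Union>F = topspace X"
    and lab: "\<And>A B. A \<in> F \<Longrightarrow> B \<in> F \<Longrightarrow> A \<inter> B \<noteq> {} \<Longrightarrow> lab A = lab B"
    and ne: "\<And>A. A \<in> F \<Longrightarrow> A \<noteq> {}" and AB: "A \<in> F" "B \<in> F"
  shows "lab A = lab B"
proof -
  let ?W = "\<Union>{A' \<in> F. lab A' = lab A}"
  have "closedin X ?W" by (rule label_class_clopen(1)) (use fin cl cov lab in \<open>simp_all\<close>)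
  moreover have "openin X ?W" by (rule label_class_clopen(2)) (use fin cl cov lab in \<open>simp_all\<close>)
  moreover have "\<forall>T. openin X T \<and> closedin X T \<longrightarrow> T = {} \<or> T = topspace X"
    using conn unfolding connected_space_clopen_in .
  ultimately have "?W = {} \<or> ?W = topspace X" by (elim allE[of _ ?W]) simp
  moreover have "?W \<noteq> {}" using AB ne by auto
  ultimately have "B \<subseteq> ?W" using AB cov by auto
  moreover obtain b where "b \<in> B" using ne AB by auto
  ultimately obtain A' where "A' \<in> F" "lab A' = lab A" "b \<in> A'" by auto
  then show ?thesis using lab[of A' B] AB \<open>b \<in> B\<close> by auto
qed

section \<open>Flat points and the intrinsic boundary\<close>

definition flat_point :: "'a topology \<Rightarrow> 'a \<Rightarrow> bool" where
  "flat_point X p \<longleftrightarrow> (\<exists>U W. openin X U \<and> p \<in> U \<and> open (W :: complex set) \<and>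
     subtopology X U homeomorphic_space top_of_set W)"

lemma surface_boundary_flat: "surface_boundary X = {p \<in> topspace X. \<not> flat_point X p}"
  unfolding surface_boundary_def flat_point_def ..

lemma flat_point_homeomorphic_map:
  assumes f: "homeomorphic_map X Y f" and p: "flat_point X p"
  shows "flat_point Y (f p)"
proof -
  from p obtain U W where U: "openin X U" "p \<in> U" "open (W :: complex set)"
    "subtopology X U homeomorphic_space top_of_set W" by (auto simp: flat_point_def)
  have UX: "U \<subseteq> topspace X" using U openin_subset by blast
  have "openin Y (f ` U)" using homeomorphic_map_openness_eq[OF f] U by blast
  moreover have "homeomorphic_map (subtopology X U) (subtopology Y (f ` U)) f"
    by (rule homeomorphic_map_subtopologies[OF f])
      (use UX homeomorphic_imp_surjective_map[OF f] in auto)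
  then have "subtopology Y (f ` U) homeomorphic_space top_of_set W"
    using U homeomorphic_map_imp_homeomorphic_space homeomorphic_space_sym homeomorphic_space_trans by blast
  ultimately show ?thesis using U by (auto simp: flat_point_def)
qed

lemma flat_point_homeomorphic_map_iff:
  assumes f: "homeomorphic_map X Y f" and p: "p \<in> topspace X"
  shows "flat_point Y (f p) \<longleftrightarrow> flat_point X p"
proof
  obtain g where g: "homeomorphic_maps X Y f g" using f homeomorphic_map_maps by blast
  then have "homeomorphic_map Y X g" "g (f p) = p"
    using p by (auto simp: homeomorphic_maps_map)
  then show "flat_point Y (f p) \<Longrightarrow> flat_point X p" using flat_point_homeomorphic_map by metis
qed (rule flat_point_homeomorphic_map[OF f])

lemma surface_boundary_homeomorphic_map:
  assumes f: "homeomorphic_map X Y f"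
  shows "surface_boundary Y = f ` surface_boundary X"
  unfolding surface_boundary_flat homeomorphic_imp_surjective_map[OF f, symmetric]
  using flat_point_homeomorphic_map_iff[OF f] by auto

text \<open>A planar chart at \<open>p\<close> can be shrunk to the part over \<open>U\<close>,
  whose image is again open in the plane; so the boundary is a local notion.\<close>

lemma flat_point_open_subtopology:
  assumes U: "openin X U" and p: "p \<in> U"
  shows "flat_point (subtopology X U) p \<longleftrightarrow> flat_point X p"
proof
  assume "flat_point (subtopology X U) p"
  then obtain V W where V: "openin (subtopology X U) V" "p \<in> V" "open (W :: complex set)"
    "subtopology (subtopology X U) V homeomorphic_space top_of_set W" by (auto simp: flat_point_def)
  then have "openin X V" "V \<subseteq> U" using U openin_open_subtopology by blast+
  moreover have "subtopology (subtopology X U) V = subtopology X V"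
    using \<open>V \<subseteq> U\<close> by (simp add: subtopology_subtopology inf.absorb2)
  ultimately show "flat_point X p" using V by (auto simp: flat_point_def)
next
  assume "flat_point X p"
  then obtain V W f where V: "openin X V" "p \<in> V" "open (W :: complex set)"
    "homeomorphic_map (subtopology X V) (top_of_set W) f"
    by (auto simp: flat_point_def homeomorphic_space)
  have VX: "topspace (subtopology X V) = V" using V openin_subset by auto
  have VU: "openin (subtopology X V) (V \<inter> U)" using U by (auto simp: openin_subtopology)
  then have "openin (top_of_set W) (f ` (V \<inter> U))"
    using homeomorphic_map_openness_eq[OF V(4)] by blast
  then have 1: "open (f ` (V \<inter> U))" "f ` (V \<inter> U) \<subseteq> W" using V(3) by (auto simp: openin_open)
  have "homeomorphic_map (subtopology (subtopology X V) (V \<inter> U)) (subtopology (top_of_set W) (f ` (V \<inter> U))) f"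
    by (rule homeomorphic_map_subtopologies[OF V(4)]) (use VX 1 in auto)
  then have "homeomorphic_map (subtopology X (V \<inter> U)) (top_of_set (f ` (V \<inter> U))) f"
    using 1 by (simp add: subtopology_subtopology inf.absorb2)
  then have "subtopology (subtopology X U) (V \<inter> U) homeomorphic_space top_of_set (f ` (V \<inter> U))"
    using homeomorphic_map_imp_homeomorphic_space by (fastforce simp: subtopology_subtopology inf.absorb2 Int_commute)
  moreover have "openin (subtopology X U) (V \<inter> U)" using V by (auto simp: openin_subtopology)
  ultimately show "flat_point (subtopology X U) p"
    using 1 V(2) p unfolding flat_point_def by blast
qed

lemma surface_boundary_open_subtopology:
  "openin X U \<Longrightarrow> surface_boundary (subtopology X U) = U \<inter> surface_boundary X"
  unfolding surface_boundary_flat using flat_point_open_subtopology[of X U] openin_subset by fastforce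

lemma closedin_surface_boundary: "closedin X (surface_boundary X)"
proof -
  have "openin X {p \<in> topspace X. flat_point X p}"
  proof (subst openin_subopen, intro ballI)
    fix p assume "p \<in> {p \<in> topspace X. flat_point X p}"
    then obtain U W where U: "openin X U" "p \<in> U" "open (W :: complex set)"
      "subtopology X U homeomorphic_space top_of_set W" by (auto simp: flat_point_def)
    then have "U \<subseteq> {p \<in> topspace X. flat_point X p}"
      using openin_subset by (fastforce simp: flat_point_def)
    then show "\<exists>T. openin X T \<and> p \<in> T \<and> T \<subseteq> {p \<in> topspace X. flat_point X p}" using U by blast
  qed
  moreover have "topspace X - surface_boundary X = {p \<in> topspace X. flat_point X p}"
    by (auto simp: surface_boundary_flat)
  ultimately show ?thesis by (simp add: closedin_def surface_boundary_flat)
qed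

text \<open>Inner points have the open ball as a chart. A planar chart at a point of the circle
  would, by invariance of domain, give a set that is open in the plane, contains that point and lies
  in the closed ball.\<close>

lemma surface_boundary_cball: "surface_boundary (top_of_set (cball (0 :: complex) 1)) = sphere 0 1"
proof -
  have "flat_point (top_of_set (cball (0 :: complex) 1)) p" if "norm p < 1" for p
    unfolding flat_point_def
  proof (intro exI conjI)
    show "openin (top_of_set (cball (0 :: complex) 1)) (ball 0 1)"
      by (simp add: open_subset)
    show "subtopology (top_of_set (cball (0 :: complex) 1)) (ball 0 1) homeomorphic_space top_of_set (ball (0 :: complex) 1)"
      by (metis Int_absorb1 ball_subset_cball homeomorphic_space_refl subtopology_subtopology)
  qed (use that in auto)
  moreover have "\<not> flat_point (top_of_set (cball (0 :: complex) 1)) p" if p: "norm p = 1" for p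
  proof
    assume "flat_point (top_of_set (cball (0 :: complex) 1)) p"
    then obtain U W where U: "openin (top_of_set (cball (0 :: complex) 1)) U" "p \<in> U" "open (W :: complex set)"
      "subtopology (top_of_set (cball (0 :: complex) 1)) U homeomorphic_space top_of_set W"
      by (auto simp: flat_point_def)
    have Usub: "U \<subseteq> cball 0 1" using U(1) openin_imp_subset by blast
    then have "subtopology (top_of_set (cball (0 :: complex) 1)) U = top_of_set U"
      by (simp add: subtopology_subtopology inf.absorb2)
    then obtain h where h: "homeomorphic_map (top_of_set W) (top_of_set U) h"
      using U(4) homeomorphic_space homeomorphic_space_sym by metis
    then have "continuous_on W h" "inj_on h W" "h ` W = U"
      using homeomorphic_imp_continuous_map homeomorphic_imp_injective_map homeomorphic_imp_surjective_map
      by (fastforce)+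
    then have "open U" using invariance_of_domain U(3) by metis
    then have "p \<in> interior (cball 0 1)" using Usub U(2) interior_maximal by blast
    then show False using p by simp
  qed
  ultimately show ?thesis
    unfolding surface_boundary_flat by (fastforce simp: less_le)
qed

lemma disc_boundary:
  assumes f: "homeomorphic_map (subtopology X D) (top_of_set (cball (0 :: complex) 1)) f"
    and D: "D \<subseteq> topspace X"
  shows "surface_boundary (subtopology X D) = {x \<in> D. norm (f x) = 1}"
proof -
  let ?B = "surface_boundary (subtopology X D)"
  have BD: "?B \<subseteq> D" by (auto simp: surface_boundary_def)
  have "f ` ?B = sphere 0 1"
    using surface_boundary_homeomorphic_map[OF f] surface_boundary_cball by simp
  moreover have "inj_on f D"
    using homeomorphic_imp_injective_map[OF f] D by (simp add: inf.absorb2)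
  ultimately have "x \<in> ?B \<longleftrightarrow> norm (f x) = 1" if "x \<in> D" for x
    using that BD by (metis inj_on_image_mem_iff mem_sphere_0)
  then show ?thesis using BD by auto
qed

text \<open>The map is the Cayley transform that sends \<open>w\<close> to infinity.\<close>

lemma half_plane_chart:
  fixes w :: complex
  assumes w: "norm w = 1"
  shows "homeomorphic_map (top_of_set (cball 0 1 - {w})) (top_of_set {z. 0 \<le> Im z}) (\<lambda>z. \<i> * (w + z) / (w - z))"
    and "\<And>z. z \<noteq> w \<Longrightarrow> Im (\<i> * (w + z) / (w - z)) = 0 \<longleftrightarrow> norm z = 1"
proof -
  let ?f = "\<lambda>z. \<i> * (w + z) / (w - z)" and ?g = "\<lambda>z. w * (z - \<i>) / (z + \<i>)"
  have w2: "(Re w)\<^sup>2 + (Im w)\<^sup>2 = 1" using w by (metis cmod_power2 one_power2)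
  \<comment> \<open>This is the Poisson kernel up to a constant; its sign is that of
    \<open>1 - (norm z)\<^sup>2\<close>, which settles both the range of the map and which points go
    to the real axis.\<close>
  have im: "Im (?f z) = (1 - (norm z)\<^sup>2) / (norm (w - z))\<^sup>2" for z
  proof -
    have "Im (?f z) = Re ((w + z) / (w - z))"
      by (metis Im_i_times times_divide_eq_right)
    also have "\<dots> = (1 - (norm z)\<^sup>2) / (norm (w - z))\<^sup>2"
      unfolding Re_divide cmod_power2 using w2 by (simp add: power2_eq_square algebra_simps)
    finally show ?thesis .
  qed
  show "Im (?f z) = 0 \<longleftrightarrow> norm z = 1" if "z \<noteq> w" for z
  proof -
    have "(1 - (norm z)\<^sup>2) / (norm (w - z))\<^sup>2 = 0 \<longleftrightarrow> (norm z)\<^sup>2 = 1"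
      using that by auto
    then show ?thesis unfolding im by (simp add: abs_square_eq_1)
  qed
  have "homeomorphic_maps (top_of_set (cball 0 1 - {w})) (top_of_set {z. 0 \<le> Im z}) ?f ?g"
    unfolding homeomorphic_maps_def
  proof (intro conjI ballI)
    show "continuous_map (top_of_set (cball 0 1 - {w})) (top_of_set {z. 0 \<le> Im z}) ?f"
      unfolding continuous_map_in_subtopology
    proof
      show "continuous_map (top_of_set (cball 0 1 - {w})) euclidean ?f"
        by (auto intro!: continuous_intros)
      have "0 \<le> Im (?f z)" if "norm z \<le> 1" for z
        unfolding im using that by (simp add: power_le_one)
      then show "?f \<in> topspace (top_of_set (cball 0 1 - {w})) \<rightarrow> {z. 0 \<le> Im z}"
        by auto
    qed
    have nz: "z + \<i> \<noteq> 0" if "0 \<le> Im z" for z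
      using that by (auto simp: complex_eq_iff)
    show "continuous_map (top_of_set {z. 0 \<le> Im z}) (top_of_set (cball 0 1 - {w})) ?g"
      unfolding continuous_map_in_subtopology
    proof
      show "continuous_map (top_of_set {z. 0 \<le> Im z}) euclidean ?g"
        using nz by (auto intro!: continuous_intros)
      have "norm (?g z) \<le> 1 \<and> ?g z \<noteq> w" if z: "0 \<le> Im z" for z
      proof
        have "(norm (z - \<i>))\<^sup>2 \<le> (norm (z + \<i>))\<^sup>2"
          unfolding cmod_power2 using z by (simp add: power2_eq_square algebra_simps)
        then have "norm (z - \<i>) \<le> norm (z + \<i>)"
          by (simp add: power2_le_iff_abs_le)
        then show "norm (?g z) \<le> 1" using w nz[OF z]
          by (simp add: norm_mult norm_divide divide_le_eq_1)
        show "?g z \<noteq> w"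
        proof
          assume "?g z = w"
          then have "w * (z - \<i>) = w * (z + \<i>)" using nz[OF z] by (simp add: field_simps)
          moreover have "w \<noteq> 0" using w by auto
          ultimately show False by (simp add: complex_eq_iff)
        qed
      qed
      then show "?g \<in> topspace (top_of_set {z. 0 \<le> Im z}) \<rightarrow> cball 0 1 - {w}"
        by auto
    qed
    fix z assume "z \<in> topspace (top_of_set (cball 0 1 - {w}))"
    then have z: "w - z \<noteq> 0" and w0: "w \<noteq> 0" using w by auto
    have a: "?f z - \<i> = 2 * \<i> * z / (w - z)" "?f z + \<i> = 2 * \<i> * w / (w - z)"
      using z by (simp_all add: field_simps)
    show "?g (?f z) = z"
      unfolding a using z w0 by simp
  next
    fix z assume "z \<in> topspace (top_of_set {z. 0 \<le> Im z})"
    then have nz: "z + \<i> \<noteq> 0" by (auto simp: complex_eq_iff)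
    have w0: "w \<noteq> 0" using w by auto
    have "w + ?g z = (w * (z + \<i>) + w * (z - \<i>)) / (z + \<i>)" "w - ?g z = (w * (z + \<i>) - w * (z - \<i>)) / (z + \<i>)"
      unfolding add_divide_distrib diff_divide_distrib nonzero_mult_div_cancel_right[OF nz] by simp_all
    moreover have "w * (z + \<i>) + w * (z - \<i>) = 2 * w * z" "w * (z + \<i>) - w * (z - \<i>) = 2 * w * \<i>"
      by (simp_all add: algebra_simps)
    ultimately have a: "w + ?g z = 2 * w * z / (z + \<i>)" "w - ?g z = 2 * w * \<i> / (z + \<i>)"
      by simp_all
    show "?f (?g z) = z"
      unfolding a using nz w0 by simp
  qed
  then show "homeomorphic_map (top_of_set (cball 0 1 - {w})) (top_of_set {z. 0 \<le> Im z}) ?f"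
    using homeomorphic_map_maps by blast
qed

text \<open>Sending one boundary point to infinity turns the rest of the circle into the real axis,
  where arcs become intervals and can be compared by their order.\<close>

lemma disc_chart:
  assumes D: "disc_in X D" and c: "c \<in> surface_boundary (subtopology X D)"
  obtains k where "homeomorphic_map (subtopology X (D - {c})) (top_of_set {z. 0 \<le> Im z}) k"
    and "\<And>x. x \<in> D - {c} \<Longrightarrow> x \<in> surface_boundary (subtopology X D) \<longleftrightarrow> Im (k x) = 0"
proof -
  have DX: "D \<subseteq> topspace X" using D by (simp add: disc_in_def)
  obtain f where f: "homeomorphic_map (subtopology X D) (top_of_set (cball (0 :: complex) 1)) f"
    using D by (auto simp: disc_in_def homeomorphic_space)
  note bd = disc_boundary[OF f DX]
  have inj: "inj_on f D" and im: "f ` D = cball 0 1"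
    using homeomorphic_imp_injective_map[OF f] homeomorphic_imp_surjective_map[OF f] DX
    by (simp_all add: inf.absorb2)
  have c1: "c \<in> D" "norm (f c) = 1" using c bd by auto
  have "homeomorphic_map (subtopology (subtopology X D) (D - {c})) (subtopology (top_of_set (cball 0 1)) (cball 0 1 - {f c})) f"
    by (rule homeomorphic_map_subtopologies[OF f])
      (use DX inj im c1 in \<open>auto simp: inf.absorb2 inj_on_def\<close>)
  then have 1: "homeomorphic_map (subtopology X (D - {c})) (top_of_set (cball 0 1 - {f c})) f"
    by (simp add: subtopology_subtopology inf.absorb2 Int_Diff)
  let ?h = "\<lambda>z. \<i> * (f c + z) / (f c - z)"
  show thesis
  proof
    show "homeomorphic_map (subtopology X (D - {c})) (top_of_set {z. 0 \<le> Im z}) (?h \<circ> f)"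
      by (rule homeomorphic_map_compose[OF 1 half_plane_chart(1)[OF c1(2)]])
    fix x assume x: "x \<in> D - {c}"
    then have "f x \<noteq> f c" using inj c1 by (auto simp: inj_on_def)
    then show "x \<in> surface_boundary (subtopology X D) \<longleftrightarrow> Im ((?h \<circ> f) x) = 0"
      using half_plane_chart(2)[OF c1(2), of "f x"] bd x by auto
  qed
qed

text \<open>The end points of an arc, characterised as its non-cut points.\<close>

definition ends :: "'a topology \<Rightarrow> 'a set \<Rightarrow> 'a set" where
  "ends X s = {p \<in> s. connectedin X (s - {p})}"

lemma ends_subset: "ends X s \<subseteq> s"
  by (auto simp: ends_def)

lemma ends_homeomorphic_map:
  assumes f: "homeomorphic_map (subtopology X s) (subtopology Y t) f"
    and s: "s \<subseteq> topspace X" and t: "t \<subseteq> topspace Y"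
  shows "ends Y t = f ` ends X s"
proof -
  have top: "topspace (subtopology X s) = s" "topspace (subtopology Y t) = t" using s t by auto
  have im: "f ` s = t" and inj: "inj_on f s"
    using homeomorphic_imp_surjective_map[OF f] homeomorphic_imp_injective_map[OF f] unfolding top by auto
  have "connectedin Y (t - {f p}) \<longleftrightarrow> connectedin X (s - {p})" if p: "p \<in> s" for p
  proof -
    have "f ` (s - {p}) = t - {f p}" using im inj p by (auto simp: inj_on_def)
    then show ?thesis
      using homeomorphic_map_connectedness[OF f, of "s - {p}"] top
      by (auto simp: connectedin_subtopology)
  qed
  then show ?thesis unfolding ends_def im[symmetric] by auto
qed

lemma ends_interval:
  assumes "a < (b :: real)"
  shows "ends euclideanreal {a..b} = {a, b}"
proof -
  have "{a..b} - {a} = {a<..b}" "{a..b} - {b} = {a..<b}" by auto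
  then have "connected ({a..b} - {a})" "connected ({a..b} - {b})" by simp_all
  moreover have "\<not> connected ({a..b} - {x})" if "a < x" "x < b" for x
  proof
    assume "connected ({a..b} - {x})"
    then have "is_interval ({a..b} - {x})" by (simp add: is_interval_connected_1)
    then have "x \<in> {a..b} - {x}" by (rule mem_is_interval_1_I[of _ a b]) (use that assms in auto)
    then show False by simp
  qed
  ultimately show ?thesis using assms by (fastforce simp: ends_def less_le)
qed

lemma line_segment_param:
  assumes s: "line_segment_in X s"
  obtains \<gamma> where "homeomorphic_map (top_of_set {0..1 :: real}) (subtopology X s) \<gamma>"
    "\<gamma> ` {0..1} = s" "inj_on \<gamma> {0..1}" "ends X s = {\<gamma> 0, \<gamma> 1}"
proof -
  have "top_of_set {0..1 :: real} homeomorphic_space subtopology X s"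
    using s homeomorphic_space_sym unfolding line_segment_in_def by blast
  then obtain \<gamma> where g: "homeomorphic_map (top_of_set {0..1 :: real}) (subtopology X s) \<gamma>"
    by (auto simp: homeomorphic_space)
  have sX: "s \<subseteq> topspace X" using s by (simp add: line_segment_in_def)
  have "\<gamma> ` {0..1} = s" "inj_on \<gamma> {0..1}"
    using homeomorphic_imp_surjective_map[OF g] homeomorphic_imp_injective_map[OF g] sX
    by (simp_all add: inf.absorb2)
  moreover have "ends X s = {\<gamma> 0, \<gamma> 1}"
    using ends_homeomorphic_map[OF g] sX by (simp add: ends_interval)
  ultimately show thesis using g that by blast
qed

lemma line_segment_compactin_connectedin:
  assumes "line_segment_in X s"
  shows "compactin X s" "connectedin X s"
proof -
  obtain \<gamma> where g: "homeomorphic_map (top_of_set {0..1 :: real}) (subtopology X s) \<gamma>" "\<gamma> ` {0..1} = s"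
    using line_segment_param[OF assms] by metis
  have "compactin (subtopology X s) s"
    using homeomorphic_map_compactness[OF g(1), of "{0..1}"] g(2) by (simp add: compactin_subtopology)
  then show "compactin X s" by (simp add: compactin_subtopology)
  have "connectedin (subtopology X s) s"
    using homeomorphic_map_connectedness[OF g(1), of "{0..1}"] g(2) by (simp add: connectedin_subtopology)
  then show "connectedin X s" by (simp add: connectedin_subtopology)
qed

lemma line_segment_interior_nonempty: "line_segment_in X s \<Longrightarrow> s - ends X s \<noteq> {}"
proof -
  assume "line_segment_in X s"
  then obtain \<gamma> where g: "\<gamma> ` {0..1 :: real} = s" "inj_on \<gamma> {0..1}" "ends X s = {\<gamma> 0, \<gamma> 1}"
    by (rule line_segment_param)
  have "\<gamma> (1/2) \<noteq> \<gamma> 0" "\<gamma> (1/2) \<noteq> \<gamma> 1" using inj_onD[OF g(2), of "1/2"] by fastforce+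
  moreover have "\<gamma> (1/2) \<in> s" using g(1) by force
  ultimately show ?thesis using g(3) by auto
qed

lemma line_segment_card_ends: "line_segment_in X s \<Longrightarrow> card (ends X s) = 2"
proof -
  assume "line_segment_in X s"
  then obtain \<gamma> where g: "inj_on \<gamma> {0..1 :: real}" "ends X s = {\<gamma> 0, \<gamma> 1}"
    by (rule line_segment_param)
  have "\<gamma> 0 \<noteq> \<gamma> 1" using inj_onD[OF g(1), of 0 1] by auto
  then show ?thesis using g(2) by simp
qed

text \<open>A component could be prolonged at any end that is neither an outer end nor an end of a
  removed interval, so its ends are marked points; a marked point strictly inside it would have
  removed points next to it. This is the model on the line for the arcs between the segments of a
  circle that is cut open within one of them.\<close>

lemma gap_component:
  fixes a0 b0 :: real
  assumes fin: "finite P" and ab0: "a0 < b0"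
    and P: "\<And>a b. (a, b) \<in> P \<Longrightarrow> a0 < a \<and> a < b \<and> b < b0"
    and disj: "\<And>a b a' b'. (a, b) \<in> P \<Longrightarrow> (a', b') \<in> P \<Longrightarrow> (a, b) \<noteq> (a', b') \<Longrightarrow> {a..b} \<inter> {a'..b'} = {}"
  defines "B \<equiv> {a0..b0} - (\<Union>(a, b)\<in>P. {a<..<b})"
  assumes K: "K \<in> connected_components_of (top_of_set B)"
  obtains l u where "l < u" "K = {l..u}" "K \<inter> ({a0, b0} \<union> fst ` P \<union> snd ` P) = {l, u}"
proof -
  have right: "\<exists>y>x. {x..y} \<subseteq> B" if x: "x \<in> B" "x \<noteq> b0" "x \<notin> fst ` P" for x
  proof -
    \<comment> \<open>The next left end of a removed interval beyond \<open>x\<close>, or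
      \<open>b0\<close>; nothing is removed between \<open>x\<close> and this point.\<close>
    define y where "y = Min (insert b0 {a \<in> fst ` P. x < a})"
    have f: "finite (insert b0 {a \<in> fst ` P. x < a})" using fin by simp
    have "x \<le> b0" using x by (auto simp: B_def)
    then have "x < y" unfolding y_def using f x by (subst Min_gr_iff) auto
    moreover have "{x..y} \<subseteq> B"
    proof
      fix z assume z: "z \<in> {x..y}"
      have "y \<le> b0" unfolding y_def using f by (intro Min_le) auto
      moreover have "z \<notin> {a<..<b}" if ab: "(a, b) \<in> P" for a b
      proof (cases "x < a")
        case True
        then have "y \<le> a" unfolding y_def using f ab by (intro Min_le) force+
        then show ?thesis using z by auto
      next
        case False
        have "x \<noteq> a" using x(3) ab by force
        moreover have "x \<notin> {a<..<b}" using x(1) ab unfolding B_def by blast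
        ultimately show ?thesis using False z by auto
      qed
      ultimately show "z \<in> B" using z x(1) unfolding B_def by auto
    qed
    ultimately show ?thesis by blast
  qed
  have left: "\<exists>y<x. {y..x} \<subseteq> B" if x: "x \<in> B" "x \<noteq> a0" "x \<notin> snd ` P" for x
  proof -
    define y where "y = Max (insert a0 {b \<in> snd ` P. b < x})"
    have f: "finite (insert a0 {b \<in> snd ` P. b < x})" using fin by simp
    have "a0 \<le> x" using x by (auto simp: B_def)
    then have "y < x" unfolding y_def using f x by (subst Max_less_iff) auto
    moreover have "{y..x} \<subseteq> B"
    proof
      fix z assume z: "z \<in> {y..x}"
      have "a0 \<le> y" unfolding y_def using f by (intro Max_ge) auto
      moreover have "z \<notin> {a<..<b}" if ab: "(a, b) \<in> P" for a b
      proof (cases "b < x")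
        case True
        then have "b \<le> y" unfolding y_def using f ab by (intro Max_ge) force+
        then show ?thesis using z by auto
      next
        case False
        have "x \<noteq> b" using x(3) ab by force
        moreover have "x \<notin> {a<..<b}" using x(1) ab unfolding B_def by blast
        ultimately show ?thesis using False z by auto
      qed
      ultimately show "z \<in> B" using z x(1) unfolding B_def by auto
    qed
    ultimately show ?thesis by blast
  qed
  have conn: "connected K" "K \<subseteq> B"
    using connectedin_connected_components_of[OF K] by (simp_all add: connectedin_subtopology)
  have ne: "K \<noteq> {}" using nonempty_connected_components_of[OF K] .
  have max: "T \<subseteq> K" if "connected T" "T \<subseteq> B" "T \<inter> K \<noteq> {}" for T
    by (rule connected_components_of_maximal[OF K])
      (use that in \<open>auto simp: connectedin_subtopology disjnt_def\<close>)
  have "closed B"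
    unfolding B_def by (intro closed_Diff open_UN ballI) auto
  then have "compact B" unfolding B_def by (metis Diff_subset bounded_closed_interval bounded_subset compact_eq_bounded_closed)
  moreover have "closedin (top_of_set B) K" by (rule closedin_connected_components_of[OF K])
  ultimately have "compact K" by (metis closedin_compact)
  then obtain l u where lu: "K = {l..u}" using conn connected_compact_interval_1 by blast
  then have "l \<le> u" using ne by auto
  then have luB: "l \<in> B" "u \<in> B" using conn lu by auto
  have l: "l \<in> insert a0 (snd ` P)"
  proof (rule ccontr)
    assume "l \<notin> insert a0 (snd ` P)"
    then obtain y where y: "y < l" "{y..l} \<subseteq> B" using left[of l] luB by blast
    then have "{y..l} \<subseteq> K" by (intro max) (use lu \<open>l \<le> u\<close> in auto)
    then show False using lu y by auto
  qed
  have u: "u \<in> insert b0 (fst ` P)"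
  proof (rule ccontr)
    assume "u \<notin> insert b0 (fst ` P)"
    then obtain y where y: "u < y" "{u..y} \<subseteq> B" using right[of u] luB by blast
    then have "{u..y} \<subseteq> K" by (intro max) (use lu \<open>l \<le> u\<close> in auto)
    then show False using lu y by auto
  qed
  \<comment> \<open>A one-point component would be a point where two removed intervals, or a removed
    interval and an outer end, touch; \<open>disj\<close> and \<open>P\<close> keep them
    apart.\<close>
  have "l \<noteq> u"
  proof
    assume "l = u"
    have sf: "b \<noteq> a'" if "(a, b) \<in> P" "(a', b') \<in> P" for a b a' b'
      using P[OF that(1)] P[OF that(2)] disj[OF that] by (cases "(a, b) = (a', b')") (auto simp: disjoint_iff)
    have "l = a0 \<or> (\<exists>a b. (a, b) \<in> P \<and> l = b)" using l by force
    moreover have "l = b0 \<or> (\<exists>a b. (a, b) \<in> P \<and> l = a)" using u \<open>l = u\<close> by force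
    ultimately show False using ab0 sf P by (metis less_irrefl)
  qed
  then have "l < u" using \<open>l \<le> u\<close> by simp
  have only: "x = l \<or> x = u" if x: "x \<in> K" "x \<in> {a0, b0} \<union> fst ` P \<union> snd ` P" for x
  proof (rule ccontr)
    assume "\<not> (x = l \<or> x = u)"
    then have x': "l < x" "x < u" using x lu by auto
    have "a0 \<le> l" "u \<le> b0" using conn lu \<open>l \<le> u\<close> by (auto simp: B_def)
    then have "x \<in> fst ` P \<union> snd ` P" using x(2) x' by auto
    then consider a b where "(a, b) \<in> P" "x = a" | a b where "(a, b) \<in> P" "x = b" by force
    then show False
    proof cases
      case 1
      \<comment> \<open>Just to the right of a left end lie removed points; the minimum with
        \<open>u\<close> keeps the midpoint inside \<open>K\<close>.\<close>
      let ?y = "(x + min b u) / 2"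
      have "x < min b u" using P[OF 1(1)] 1 x' by simp
      then have "?y \<in> {a<..<b}" "?y \<in> K" using 1 x' lu by (auto simp: min_def)
      then show False using conn 1 unfolding B_def by blast
    next
      case 2
      let ?y = "(x + max a l) / 2"
      have "max a l < x" using P[OF 2(1)] 2 x' by simp
      then have "?y \<in> {a<..<b}" "?y \<in> K" using 2 x' lu by (auto simp: max_def)
      then show False using conn 2 unfolding B_def by blast
    qed
  qed
  have "l \<in> K" "u \<in> K" unfolding lu using \<open>l \<le> u\<close> by simp_all
  moreover have "l \<in> {a0, b0} \<union> fst ` P \<union> snd ` P" "u \<in> {a0, b0} \<union> fst ` P \<union> snd ` P"
    using l u by blast+
  ultimately have "K \<inter> ({a0, b0} \<union> fst ` P \<union> snd ` P) = {l, u}" using only by blast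
  with \<open>l < u\<close> lu show thesis by (rule that)
qed

text \<open>A closed connected set of reals that is not compact is an unbounded interval, and any of
  its points other than an end would cut it.\<close>

lemma ray_of_noncut_point:
  fixes J :: "real set"
  assumes J: "closed J" "connected J" "\<not> compact J" and e: "e \<in> J" "connected (J - {e})"
  shows "J = {e..} \<or> J = {..e}"
proof -
  have int: "z \<in> J" if "x \<in> J" "y \<in> J" "x \<le> z" "z \<le> y" for x y z
    using J(2) that by (meson is_interval_connected_1 mem_is_interval_1_I)
  have nb: "\<not> bounded J" using J by (simp add: compact_eq_bounded_closed)
  have "\<not> (\<exists>x\<in>J. \<exists>y\<in>J. x < e \<and> e < y)"
  proof clarify
    fix x y assume "x \<in> J" "y \<in> J" "x < e" "e < y"
    moreover have "is_interval (J - {e})" using e(2) by (simp add: is_interval_connected_1)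
    ultimately have "e \<in> J - {e}"
      using mem_is_interval_1_I[of "J - {e}" x y e] by simp
    then show False by simp
  qed
  then have "J \<subseteq> {e..} \<or> J \<subseteq> {..e}" by (meson atLeast_iff atMost_iff not_le subsetI)
  then consider "J \<subseteq> {e..}" | "J \<subseteq> {..e}" by blast
  then show ?thesis
  proof cases
    case 1
    have "{e..} \<subseteq> J"
    proof
      fix z assume z: "z \<in> {e..}"
      have "\<exists>y\<in>J. z < y"
      proof (rule ccontr)
        assume "\<not> (\<exists>y\<in>J. z < y)"
        then have "J \<subseteq> {e..z}" using 1 by (auto simp: not_less)
        then show False using nb by (metis bounded_closed_interval bounded_subset)
      qed
      then obtain y where "y \<in> J" "z < y" by blast
      then show "z \<in> J" using int[of e y z] e(1) z by simp
    qed
    then show ?thesis using 1 by auto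
  next
    case 2
    have "{..e} \<subseteq> J"
    proof
      fix z assume z: "z \<in> {..e}"
      have "\<exists>y\<in>J. y < z"
      proof (rule ccontr)
        assume "\<not> (\<exists>y\<in>J. y < z)"
        then have "J \<subseteq> {z..e}" using 2 by (auto simp: not_less)
        then show False using nb by (metis bounded_closed_interval bounded_subset)
      qed
      then obtain y where "y \<in> J" "y < z" by blast
      then show "z \<in> J" using int[of y e z] e(1) z by simp
    qed
    then show ?thesis using 2 by auto
  qed
qed

text \<open>A half-open arc whose image is closed in the line must run off to infinity, and its
  closed end is a noncut point. This is applied to the two halves of a segment cut at an inner
  point.\<close>

lemma ray_of_homeomorphic_map:
  fixes h :: "real \<Rightarrow> real"
  assumes h: "homeomorphic_map (top_of_set A) (top_of_set (h ` A)) h" and cl: "closed (h ` A)"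
    and A: "connected A" "\<not> compact A" "e \<in> A" "connected (A - {e})"
  shows "h ` A = {h e..} \<or> h ` A = {..h e}"
proof (rule ray_of_noncut_point[OF cl])
  have cont: "continuous_on A h" and inj: "inj_on h A"
    using homeomorphic_imp_continuous_map[OF h] homeomorphic_imp_injective_map[OF h]
    by (auto simp: continuous_map_in_subtopology)
  show "connected (h ` A)" using cont A(1) by (rule connected_continuous_image)
  show "\<not> compact (h ` A)"
    using homeomorphic_map_compactness[OF h, of A] A(2) by (simp add: compactin_subtopology)
  show "h e \<in> h ` A" using A by simp
  have "h ` (A - {e}) = h ` A - {h e}" using inj A(3) by (auto simp: inj_on_def)
  moreover have "connected (h ` (A - {e}))"
    using A(4) continuous_on_subset[OF cont] by (intro connected_continuous_image) auto
  ultimately show "connected (h ` A - {h e})" by simp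
qed

section \<open>Circles cut open and the arcs between segments\<close>

lemma homeomorphic_map_restrict:
  assumes f: "homeomorphic_map (subtopology X S) (subtopology Y T) f" and A: "A \<subseteq> S" "S \<subseteq> topspace X" "T \<subseteq> topspace Y"
  shows "homeomorphic_map (subtopology X A) (subtopology Y (f ` A)) f"
proof -
  have "f ` S = T" using homeomorphic_imp_surjective_map[OF f] A by (simp add: inf.absorb2)
  then have "homeomorphic_map (subtopology (subtopology X S) A) (subtopology (subtopology Y T) (f ` A)) f"
    by (intro homeomorphic_map_subtopologies[OF f]) (use A in \<open>auto simp: inf.absorb2\<close>)
  moreover have "S \<inter> A = A" "T \<inter> f ` A = f ` A" using A \<open>f ` S = T\<close> by auto
  ultimately show ?thesis by (simp add: subtopology_subtopology)
qed

text \<open>The ends of the segments stay in, so that the remaining arcs are closed and meet the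
  segments exactly at the corners.\<close>

definition free_part :: "'a topology \<Rightarrow> 'a set \<Rightarrow> 'a set set \<Rightarrow> 'a set" where
  "free_part X C \<Sigma> = C - (\<Union>s\<in>\<Sigma>. s - ends X s)"

lemma disc_boundary_chart:
  assumes D: "disc_in X D" and c: "c \<in> surface_boundary (subtopology X D)"
  obtains \<rho> where "homeomorphic_map (subtopology X (surface_boundary (subtopology X D) - {c})) euclideanreal \<rho>"
proof -
  let ?C = "surface_boundary (subtopology X D)"
  have DX: "D \<subseteq> topspace X" using D by (simp add: disc_in_def)
  have CD: "?C \<subseteq> D" by (auto simp: surface_boundary_def)
  obtain k where k: "homeomorphic_map (subtopology X (D - {c})) (top_of_set {z. 0 \<le> Im z}) k"
    and bd: "\<And>x. x \<in> D - {c} \<Longrightarrow> x \<in> ?C \<longleftrightarrow> Im (k x) = 0"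
    using disc_chart[OF D c] by blast
  have im: "k ` (D - {c}) = {z. 0 \<le> Im z}"
  proof -
    have "topspace X \<inter> (D - {c}) = D - {c}" using DX by auto
    then show ?thesis using homeomorphic_imp_surjective_map[OF k] by simp
  qed
  have "k ` (?C - {c}) = {z. Im z = 0}"
  proof (intro set_eqI iffI)
    fix z assume "z \<in> {z. Im z = 0}"
    then have "z \<in> k ` (D - {c})" "Im z = 0" unfolding im by auto
    then show "z \<in> k ` (?C - {c})" using bd by auto
  next
    fix z assume "z \<in> k ` (?C - {c})"
    then show "z \<in> {z. Im z = 0}" using bd CD by auto
  qed
  moreover have "homeomorphic_map (subtopology X (?C - {c})) (top_of_set (k ` (?C - {c}))) k"
    by (rule homeomorphic_map_restrict[OF k]) (use CD DX in auto)
  ultimately have 1: "homeomorphic_map (subtopology X (?C - {c})) (top_of_set {z. Im z = 0}) k" by simp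
  have "homeomorphic_maps (top_of_set {z. Im z = 0}) euclideanreal Re complex_of_real"
    unfolding homeomorphic_maps_def
    by (auto simp: continuous_map_in_subtopology complex_eq_iff intro!: continuous_intros)
  then have "homeomorphic_map (top_of_set {z. Im z = 0}) euclideanreal Re"
    using homeomorphic_map_maps by blast
  from homeomorphic_map_compose[OF 1 this] show thesis by (rule that)
qed

lemma disc_compactin: "disc_in X D \<Longrightarrow> compactin X D"
  and disc_connectedin: "disc_in X D \<Longrightarrow> connectedin X D"
  and disc_boundary_compactin: "disc_in X D \<Longrightarrow> compactin X (surface_boundary (subtopology X D))"
  and disc_boundary_connectedin: "disc_in X D \<Longrightarrow> connectedin X (surface_boundary (subtopology X D))"
  and disc_boundary_nonempty: "disc_in X D \<Longrightarrow> surface_boundary (subtopology X D) \<noteq> {}"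
proof -
  assume D: "disc_in X D"
  let ?C = "surface_boundary (subtopology X D)"
  have DX: "D \<subseteq> topspace X" using D by (simp add: disc_in_def)
  have CD: "?C \<subseteq> D" by (auto simp: surface_boundary_def)
  obtain f where f: "homeomorphic_map (subtopology X D) (top_of_set (cball (0 :: complex) 1)) f"
    using D by (auto simp: disc_in_def homeomorphic_space)
  have top: "topspace (subtopology X D) = D" using DX by auto
  have im: "f ` D = cball 0 1" using homeomorphic_imp_surjective_map[OF f] top by simp
  have CX: "?C \<subseteq> topspace X" using CD DX by blast
  have imC: "f ` ?C = sphere 0 1"
    using surface_boundary_homeomorphic_map[OF f] surface_boundary_cball by simp
  have sph: "sphere (0 :: complex) 1 \<subseteq> cball 0 1" by auto
  have cs: "connected (sphere (0 :: complex) 1)" by (rule connected_sphere) simp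
  have "compactin (subtopology X D) D"
    using homeomorphic_map_compactness[OF f, of D] im top DX by (simp add: compactin_subtopology)
  then show "compactin X D" by (simp add: compactin_subtopology)
  have "connectedin (subtopology X D) D"
    using homeomorphic_map_connectedness[OF f, of D] im top DX by (simp add: connectedin_subtopology)
  then show "connectedin X D" by (simp add: connectedin_subtopology)
  have "compactin (subtopology X D) ?C"
    using homeomorphic_map_compactness[OF f, of ?C] imC top CD CX sph by (simp add: compactin_subtopology)
  then show "compactin X ?C" by (simp add: compactin_subtopology)
  have "connectedin (subtopology X D) ?C"
    using homeomorphic_map_connectedness[OF f, of ?C] imC top CD CX sph cs by (simp add: connectedin_subtopology)
  then show "connectedin X ?C" by (simp add: connectedin_subtopology)
  have "(1 :: complex) \<in> sphere 0 1" by simp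
  then show "?C \<noteq> {}" unfolding imC[symmetric] by blast
qed

text \<open>With the inner point \<open>c\<close> sent to infinity, each half of the segment becomes
  a closed ray starting at an end of it. The halves are disjoint, so the rays point in opposite
  directions and the rest of the circle is the gap between them.\<close>

lemma arc_minus_point_image:
  fixes \<rho> :: "'a \<Rightarrow> real"
  assumes H: "Hausdorff_space (subtopology X C)" and CX: "C \<subseteq> topspace X"
    and \<rho>: "homeomorphic_map (subtopology X (C - {c})) euclideanreal \<rho>"
    and s: "line_segment_in X s" "s \<subseteq> C" and c: "c \<in> s - ends X s"
  obtains a b where "a < b" "\<rho> ` (s - {c}) = {..a} \<union> {b..}" "\<rho> ` ends X s = {a, b}"
proof -
  obtain \<gamma> where g: "homeomorphic_map (top_of_set {0..1 :: real}) (subtopology X s) \<gamma>"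
    "\<gamma> ` {0..1} = s" "inj_on \<gamma> {0..1}" "ends X s = {\<gamma> 0, \<gamma> 1}"
    using line_segment_param[OF s(1)] .
  obtain t where t: "t \<in> {0..1}" "c = \<gamma> t" using c g(2) by auto
  then have t01: "0 < t" "t < 1" using c g(4) by (auto simp: less_le)
  have ct: "topspace (subtopology X (C - {c})) = C - {c}" using CX by auto
  have inj: "inj_on \<rho> (C - {c})" using homeomorphic_imp_injective_map[OF \<rho>] ct by simp
  have \<gamma>C: "\<gamma> u \<in> C" if "u \<in> {0..1}" for u using that g(2) s(2) by auto
  define h where "h = \<rho> \<circ> \<gamma>"
  have hom: "homeomorphic_map (top_of_set A) (top_of_set (h ` A)) h" if A: "A \<subseteq> {0..1} - {t}" for A
  proof -
    have 1: "homeomorphic_map (top_of_set A) (subtopology X (\<gamma> ` A)) \<gamma>"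
      by (rule homeomorphic_map_restrict[OF g(1)]) (use A s in \<open>auto simp: line_segment_in_def\<close>)
    have gA: "\<gamma> ` A \<subseteq> C - {c}" using A \<gamma>C t g(3) by (auto simp: inj_on_def)
    have "homeomorphic_map (subtopology X (\<gamma> ` A)) (subtopology euclideanreal (\<rho> ` \<gamma> ` A)) \<rho>"
      by (rule homeomorphic_map_restrict[where S = "C - {c}" and T = UNIV]) (use \<rho> gA CX in auto)
    from homeomorphic_map_compose[OF 1 this] show ?thesis by (simp add: h_def image_comp)
  qed
  \<comment> \<open>The part of the arc over \<open>A\<close> is compact and hence closed in
    \<open>C\<close>; taking away \<open>c\<close> leaves it closed in \<open>C - {c}\<close>, even
    where compactness is lost.\<close>
  have closed: "closed (h ` (A - {t}))" if A: "closed A" "A \<subseteq> {0..1}" for A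
  proof -
    have "compact A" using A by (metis bounded_closed_interval bounded_subset compact_eq_bounded_closed)
    then have "compactin (subtopology X s) (\<gamma> ` A)"
      using homeomorphic_map_compactness[OF g(1), of A] A by (simp add: compactin_subtopology)
    then have "compactin (subtopology X C) (\<gamma> ` A)" using s(2) by (auto simp: compactin_subtopology)
    then have "closedin (subtopology X C) (\<gamma> ` A)" using H compactin_imp_closedin by blast
    then have "closedin (subtopology (subtopology X C) (C - {c})) ((C - {c}) \<inter> \<gamma> ` A)"
      by (rule closedin_subtopology_Int_closed)
    then have "closedin (subtopology X (C - {c})) ((C - {c}) \<inter> \<gamma> ` A)"
      by (simp add: subtopology_subtopology Int_Diff inf.absorb2)
    moreover have "(C - {c}) \<inter> \<gamma> ` A = \<gamma> ` (A - {t})"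
      using A(2) \<gamma>C t g(3) by (auto simp: inj_on_def)
    ultimately have "closedin euclideanreal (\<rho> ` \<gamma> ` (A - {t}))"
      using homeomorphic_map_closedness_eq[OF \<rho>] by metis
    then show ?thesis by (simp add: h_def image_comp)
  qed
  have eq1: "{0..t} - {t} = {0..<t}" and eq2: "{t..1} - {t} = {t<..1}" by auto
  have nc1: "\<not> compact {0..<t}"
  proof
    assume "compact {0..<t}"
    then have "closed {0..<t}" by (rule compact_imp_closed)
    then have "closure {0..<t} = {0..<t}" by simp
    then show False using t01 by (auto simp: closure_atLeastLessThan)
  qed
  have nc2: "\<not> compact {t<..1}"
  proof
    assume "compact {t<..1}"
    then have "closed {t<..1}" by (rule compact_imp_closed)
    then have "closure {t<..1} = {t<..1}" by simp
    then show False using t01 by (auto simp: closure_greaterThanAtMost)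
  qed
  have e1: "{0..<t} - {0} = {0<..<t}" and e2: "{t<..1} - {1} = {t<..<1}" by auto
  have r1: "h ` {0..<t} = {h 0..} \<or> h ` {0..<t} = {..h 0}"
    by (rule ray_of_homeomorphic_map[OF hom _ _ nc1])
      (use closed[of "{0..t}"] t01 in \<open>auto simp: eq1 e1\<close>)
  have r2: "h ` {t<..1} = {h 1..} \<or> h ` {t<..1} = {..h 1}"
    by (rule ray_of_homeomorphic_map[OF hom _ _ nc2])
      (use closed[of "{t..1}"] t01 in \<open>auto simp: eq2 e2\<close>)
  have hinj: "inj_on h ({0..1} - {t})"
    unfolding h_def
  proof (rule comp_inj_on)
    show "inj_on \<gamma> ({0..1} - {t})" using g(3) by (rule inj_on_subset) auto
    show "inj_on \<rho> (\<gamma> ` ({0..1} - {t}))"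
      using inj by (rule inj_on_subset) (use \<gamma>C t g(3) in \<open>auto simp: inj_on_def\<close>)
  qed
  have disj: "h ` {0..<t} \<inter> h ` {t<..1} = {}"
  proof -
    have "{0..<t} \<subseteq> {0..1} - {t}" "{t<..1} \<subseteq> {0..1} - {t}" "{0..<t} \<inter> {t<..1} = {}"
      using t01 by auto
    then show ?thesis using inj_on_image_Int[OF hinj, of "{0..<t}" "{t<..1}"] by simp
  qed
  have "s - {c} = \<gamma> ` ({0..1} - {t})" 
    unfolding g(2)[symmetric] t(2) using inj_on_image_set_diff[OF g(3), of "{0..1}" "{t}"] t(1) by auto
  moreover have "{0..1} - {t} = {0..<t} \<union> {t<..1}" using t01 by auto
  ultimately have im: "\<rho> ` (s - {c}) = h ` {0..<t} \<union> h ` {t<..1}" by (simp add: h_def image_comp image_Un)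
  have en: "\<rho> ` ends X s = {h 0, h 1}" unfolding g(4) by (simp add: h_def)
  show thesis
  proof (cases "h ` {0..<t} = {h 0..}")
    case True
    have "h ` {t<..1} \<noteq> {h 1..}"
    proof
      assume "h ` {t<..1} = {h 1..}"
      then have "max (h 0) (h 1) \<in> h ` {0..<t} \<inter> h ` {t<..1}" unfolding True by simp
      then show False using disj by simp
    qed
    then have 2: "h ` {t<..1} = {..h 1}" using r2 by simp
    have "h 1 < h 0"
    proof (rule ccontr)
      assume "\<not> h 1 < h 0"
      then have "h 0 \<in> h ` {0..<t} \<inter> h ` {t<..1}" unfolding True 2 by simp
      then show False using disj by simp
    qed
    then show thesis using that[of "h 1" "h 0"] im en True 2 by (simp add: Un_commute insert_commute)
  next
    case False
    then have 1: "h ` {0..<t} = {..h 0}" using r1 by simp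
    have "h ` {t<..1} \<noteq> {..h 1}"
    proof
      assume "h ` {t<..1} = {..h 1}"
      then have "min (h 0) (h 1) \<in> h ` {0..<t} \<inter> h ` {t<..1}" unfolding 1 by simp
      then show False using disj by simp
    qed
    then have 2: "h ` {t<..1} = {h 1..}" using r2 by simp
    have "h 0 < h 1"
    proof (rule ccontr)
      assume "\<not> h 0 < h 1"
      then have "h 0 \<in> h ` {0..<t} \<inter> h ` {t<..1}" unfolding 1 2 by simp
      then show False using disj by simp
    qed
    then show thesis using that[of "h 0" "h 1"] im en 1 2 by simp
  qed
qed

lemma arc_image:
  fixes \<rho> :: "'a \<Rightarrow> real"
  assumes CX: "C \<subseteq> topspace X" and \<rho>: "homeomorphic_map (subtopology X (C - {c})) euclideanreal \<rho>"
    and s: "line_segment_in X s" "s \<subseteq> C - {c}"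
  obtains a b where "a < b" "\<rho> ` s = {a..b}" "\<rho> ` ends X s = {a, b}"
proof -
  have r: "homeomorphic_map (subtopology X s) (top_of_set (\<rho> ` s)) \<rho>"
    by (rule homeomorphic_map_restrict[where S = "C - {c}" and T = UNIV]) (use \<rho> s CX in auto)
  have top: "topspace (subtopology X s) = s" using s CX by auto
  have "compactin (subtopology X s) s" "connectedin (subtopology X s) s"
    using line_segment_compactin_connectedin[OF s(1)] by (simp_all add: compactin_subtopology connectedin_subtopology)
  then have "compactin (top_of_set (\<rho> ` s)) (\<rho> ` s)" "connectedin (top_of_set (\<rho> ` s)) (\<rho> ` s)"
    using homeomorphic_map_compactness[OF r, of s] homeomorphic_map_connectedness[OF r, of s] top by auto
  then have "compact (\<rho> ` s)" "connected (\<rho> ` s)"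
    by (simp_all add: compactin_subtopology connectedin_subtopology)
  then have "\<exists>a b. \<rho> ` s = {a..b}" using connected_compact_interval_1[of "\<rho> ` s"] by simp
  then obtain a b where ab: "\<rho> ` s = {a..b}" by (elim exE)
  have inj: "inj_on \<rho> s" using homeomorphic_imp_injective_map[OF r] top by simp
  have "card (ends X s) = 2" using line_segment_card_ends[OF s(1)] .
  then have "card (\<rho> ` ends X s) = 2" using card_image[OF inj_on_subset[OF inj ends_subset]] by simp
  moreover have "\<rho> ` ends X s \<subseteq> {a..b}" unfolding ab[symmetric] by (rule image_mono[OF ends_subset])
  ultimately have "a < b"
  proof -
    have "\<not> card (\<rho> ` ends X s) \<le> card {a}" using \<open>card (\<rho> ` ends X s) = 2\<close> by simp
    then have "\<not> {a..b} \<subseteq> {a}" using \<open>\<rho> ` ends X s \<subseteq> {a..b}\<close> card_mono[of "{a}"] by blast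
    then show "a < b" by (rule contrapos_np) auto
  qed
  moreover have "\<rho> ` ends X s = {a, b}"
    using ends_homeomorphic_map[OF r] s CX ends_interval[OF \<open>a < b\<close>] unfolding ab by auto
  ultimately show thesis using that ab by blast
qed

text \<open>Cutting the circle open at an inner point of \<open>s0\<close> loses nothing of the free
  part and turns it into the interval between the two rays of \<open>s0\<close>, with a gap for
  every other segment. A further segment puts a gap between the images of the two ends of
  \<open>s0\<close>, which is why no arc then contains both.\<close>

lemma free_part_component:
  assumes H: "Hausdorff_space X" and CX: "C \<subseteq> topspace X"
    and chart: "\<And>c. c \<in> C \<Longrightarrow> \<exists>\<rho>. homeomorphic_map (subtopology X (C - {c})) euclideanreal \<rho>"
    and fin: "finite \<Sigma>" and arc: "\<And>s. s \<in> \<Sigma> \<Longrightarrow> line_segment_in X s \<and> s \<subseteq> C"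
    and disj: "\<And>s t. s \<in> \<Sigma> \<Longrightarrow> t \<in> \<Sigma> \<Longrightarrow> s \<noteq> t \<Longrightarrow> s \<inter> t = {}"
    and s0: "s0 \<in> \<Sigma>" and K: "K \<in> connected_components_of (subtopology X (free_part X C \<Sigma>))"
  shows "compactin X K" "card (K \<inter> (\<Union>s\<in>\<Sigma>. ends X s)) = 2" "\<Sigma> \<noteq> {s0} \<Longrightarrow> \<not> ends X s0 \<subseteq> K"
proof -
  obtain c where c: "c \<in> s0 - ends X s0" using line_segment_interior_nonempty arc s0 by blast
  then have "c \<in> C" using arc s0 by auto
  then obtain \<rho> where \<rho>: "homeomorphic_map (subtopology X (C - {c})) euclideanreal \<rho>" using chart by blast
  have topC: "topspace (subtopology X (C - {c})) = C - {c}" using CX by auto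
  have inj: "inj_on \<rho> (C - {c})" and sur: "\<rho> ` (C - {c}) = UNIV"
    using homeomorphic_imp_injective_map[OF \<rho>] homeomorphic_imp_surjective_map[OF \<rho>] topC by simp_all
  obtain a0 b0 where ab0: "a0 < b0" "\<rho> ` (s0 - {c}) = {..a0} \<union> {b0..}" "\<rho> ` ends X s0 = {a0, b0}"
    using arc_minus_point_image[OF Hausdorff_space_subtopology[OF H] CX \<rho> _ _ c] arc s0 by metis
  have c_notin: "c \<notin> s" if "s \<in> \<Sigma> - {s0}" for s using disj[of s s0] that s0 c by auto
  have "\<exists>a b. a < b \<and> \<rho> ` s = {a..b} \<and> \<rho> ` ends X s = {a, b}" if s: "s \<in> \<Sigma> - {s0}" for s
  proof -
    have "s \<subseteq> C - {c}" "line_segment_in X s" using arc s c_notin[OF s] by auto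
    then show ?thesis using arc_image[OF CX \<rho>] by metis
  qed
  then obtain lo hi where lh: "\<And>s. s \<in> \<Sigma> - {s0} \<Longrightarrow> lo s < hi s \<and> \<rho> ` s = {lo s..hi s} \<and> \<rho> ` ends X s = {lo s, hi s}"
    by metis
  define P where "P = (\<lambda>s. (lo s, hi s)) ` (\<Sigma> - {s0})"
  define B where "B = {a0..b0} - (\<Union>(a, b)\<in>P. {a<..<b})"
  let ?F = "free_part X C \<Sigma>"
  have mem: "\<rho> x \<in> \<rho> ` A \<longleftrightarrow> x \<in> A" if "x \<in> C - {c}" "A \<subseteq> C - {c}" for x A
    using inj that by (meson inj_on_image_mem_iff)
  have sub: "s \<subseteq> C - {c}" "ends X s \<subseteq> C - {c}" if "s \<in> \<Sigma> - {s0}" for s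
    using arc that c_notin[OF that] ends_subset[of X s] by auto
  have sub0: "s0 - {c} \<subseteq> C - {c}" "ends X s0 \<subseteq> C - {c}" using arc s0 c ends_subset[of X s0] by auto
  have in0: "x \<in> s0 - ends X s0 \<longleftrightarrow> \<rho> x < a0 \<or> b0 < \<rho> x" if "x \<in> C - {c}" for x
  proof -
    have "x \<in> s0 \<longleftrightarrow> \<rho> x \<le> a0 \<or> b0 \<le> \<rho> x" using mem[OF that sub0(1)] ab0(2) that by auto
    moreover have "x \<in> ends X s0 \<longleftrightarrow> \<rho> x = a0 \<or> \<rho> x = b0" using mem[OF that sub0(2)] ab0(3) by auto
    ultimately show ?thesis using ab0(1) by auto
  qed
  have in1: "x \<in> s - ends X s \<longleftrightarrow> \<rho> x \<in> {lo s<..<hi s}" if "x \<in> C - {c}" "s \<in> \<Sigma> - {s0}" for x s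
  proof -
    have "x \<in> s \<longleftrightarrow> \<rho> x \<in> {lo s..hi s}" using mem[OF that(1) sub(1)[OF that(2)]] lh[OF that(2)] by auto
    moreover have "x \<in> ends X s \<longleftrightarrow> \<rho> x = lo s \<or> \<rho> x = hi s"
      using mem[OF that(1) sub(2)[OF that(2)]] lh[OF that(2)] by auto
    ultimately show ?thesis by auto
  qed
  have cF: "c \<notin> ?F" using c s0 by (auto simp: free_part_def)
  have FC: "?F \<subseteq> C - {c}" using cF by (auto simp: free_part_def)
  have inF: "x \<in> ?F \<longleftrightarrow> \<rho> x \<in> B" if x: "x \<in> C - {c}" for x
  proof -
    have "x \<in> ?F \<longleftrightarrow> x \<notin> s0 - ends X s0 \<and> (\<forall>s\<in>\<Sigma> - {s0}. x \<notin> s - ends X s)"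
      using x s0 by (auto simp: free_part_def)
    also have "\<dots> \<longleftrightarrow> \<rho> x \<in> {a0..b0} \<and> (\<forall>s\<in>\<Sigma> - {s0}. \<rho> x \<notin> {lo s<..<hi s})"
      using in0[OF x] in1[OF x] by auto
    also have "\<dots> \<longleftrightarrow> \<rho> x \<in> B" by (simp add: B_def P_def)
    finally show ?thesis .
  qed
  have imF: "\<rho> ` ?F = B"
  proof
    show "\<rho> ` ?F \<subseteq> B" using inF FC by auto
    show "B \<subseteq> \<rho> ` ?F"
    proof
      fix y assume y: "y \<in> B"
      obtain x where "x \<in> C - {c}" "y = \<rho> x" using sur by (metis UNIV_I imageE)
      then show "y \<in> \<rho> ` ?F" using inF y by auto
    qed
  qed
  have homF: "homeomorphic_map (subtopology X ?F) (top_of_set B) \<rho>"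
    unfolding imF[symmetric] by (rule homeomorphic_map_restrict[where S = "C - {c}" and T = UNIV]) (use \<rho> FC CX in auto)
  have topF: "topspace (subtopology X ?F) = ?F" using FC CX by auto
  have KF: "K \<subseteq> ?F" using connected_components_of_subset[OF K] topF by simp
  have KB: "\<rho> ` K \<in> connected_components_of (top_of_set B)"
    using homeomorphic_map_connected_components_of[OF homF] K by simp
  have finP: "finite P" unfolding P_def using fin by simp
  have Pab: "a0 < a \<and> a < b \<and> b < b0" if ab: "(a, b) \<in> P" for a b
  proof -
    obtain s where s: "s \<in> \<Sigma> - {s0}" "a = lo s" "b = hi s" using ab by (auto simp: P_def)
    have "\<rho> ` s \<inter> \<rho> ` (s0 - {c}) = {}"
      using inj_on_image_Int[OF inj sub(1)[OF s(1)] sub0(1)] disj[of s s0] s s0 by (auto simp: disjoint_iff)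
    then have "{a..b} \<inter> ({..a0} \<union> {b0..}) = {}" using lh[OF s(1)] s ab0(2) by auto
    moreover have "a < b" using lh[OF s(1)] s by simp
    moreover have "a \<in> {a..b}" "b \<in> {a..b}" using calculation by auto
    ultimately have "a \<notin> {..a0} \<union> {b0..}" "b \<notin> {..a0} \<union> {b0..}" by blast+
    then show ?thesis using \<open>a < b\<close> by auto
  qed
  have Pdisj: "{a..b} \<inter> {a'..b'} = {}" if ab: "(a, b) \<in> P" "(a', b') \<in> P" "(a, b) \<noteq> (a', b')" for a b a' b'
  proof -
    obtain s where s: "s \<in> \<Sigma> - {s0}" "a = lo s" "b = hi s" using ab by (auto simp: P_def)
    obtain t where t: "t \<in> \<Sigma> - {s0}" "a' = lo t" "b' = hi t" using ab by (auto simp: P_def)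
    have "s \<noteq> t" using s t ab by auto
    then have "s \<inter> t = {}" using disj s t by auto
    then have "\<rho> ` s \<inter> \<rho> ` t = {}"
      using inj_on_image_Int[OF inj sub(1)[OF s(1)] sub(1)[OF t(1)]] by auto
    then show ?thesis using lh[OF s(1)] lh[OF t(1)] s t by auto
  qed
  obtain l u where lu: "l < u" "\<rho> ` K = {l..u}" "\<rho> ` K \<inter> ({a0, b0} \<union> fst ` P \<union> snd ` P) = {l, u}"
    using gap_component[OF finP ab0(1) Pab Pdisj KB[unfolded B_def]] by blast
  have "compactin (top_of_set B) (\<rho> ` K)"
    using connected_components_of_subset[OF KB] lu(2) by (simp add: compactin_subtopology)
  then have "compactin (subtopology X ?F) K"
    using homeomorphic_map_compactness[OF homF, of K] KF unfolding topF by blast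
  then show "compactin X K" by (simp add: compactin_subtopology)
  have endsub: "(\<Union>s\<in>\<Sigma>. ends X s) \<subseteq> C - {c}" using sub(2) sub0(2) by blast
  have "\<rho> ` (\<Union>s\<in>\<Sigma>. ends X s) = \<rho> ` ends X s0 \<union> (\<Union>s\<in>\<Sigma> - {s0}. \<rho> ` ends X s)"
    using s0 by blast
  also have "\<dots> = {a0, b0} \<union> (\<Union>s\<in>\<Sigma> - {s0}. {lo s, hi s})" using lh ab0(3) by simp
  also have "\<dots> = {a0, b0} \<union> fst ` P \<union> snd ` P" unfolding P_def by (auto simp: image_image)
  finally have "\<rho> ` (K \<inter> (\<Union>s\<in>\<Sigma>. ends X s)) = {l, u}"
    using lu(3) inj_on_image_Int[OF inj _ endsub, of K] KF FC by auto
  moreover have "inj_on \<rho> (K \<inter> (\<Union>s\<in>\<Sigma>. ends X s))" by (rule inj_on_subset[OF inj]) (use KF FC in auto)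
  ultimately have "card (K \<inter> (\<Union>s\<in>\<Sigma>. ends X s)) = card {l, u}" by (metis card_image)
  then show "card (K \<inter> (\<Union>s\<in>\<Sigma>. ends X s)) = 2" using lu(1) by simp
  show "\<not> ends X s0 \<subseteq> K" if ne: "\<Sigma> \<noteq> {s0}"
  proof
    obtain s where "s \<in> \<Sigma> - {s0}" using ne s0 by blast
    then obtain a b where ab: "(a, b) \<in> P" unfolding P_def by blast
    assume "ends X s0 \<subseteq> K"
    then have "\<rho> ` ends X s0 \<subseteq> \<rho> ` K" by (rule image_mono)
    then have "a0 \<in> {l..u}" "b0 \<in> {l..u}" unfolding ab0(3) lu(2) by simp_all
    \<comment> \<open>The midpoint of a gap lies between the two outer ends but outside the free
      part.\<close>
    then have "(a + b) / 2 \<in> \<rho> ` K" using Pab[OF ab] lu(2) by auto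
    then have "(a + b) / 2 \<in> B" using connected_components_of_subset[OF KB] by auto
    then show False using ab Pab[OF ab] by (auto simp: B_def)
  qed
qed

section \<open>Discs glued along arcs\<close>

lemma continuous_map_paste:
  assumes "closedin X S" "closedin X T" "S \<union> T = topspace X"
    and f: "continuous_map (subtopology X S) Y f" and g: "continuous_map (subtopology X T) Y g"
    and eq: "\<And>x. x \<in> S \<Longrightarrow> x \<in> T \<Longrightarrow> f x = g x"
  shows "continuous_map X Y (\<lambda>x. if x \<in> S then f x else g x)"
proof (rule pasting_lemma_closed)
  show "finite {True, False}" by simp
  show "closedin X (if i then S else T)" for i using assms by simp
  show "continuous_map (subtopology X (if i then S else T)) Y (if i then f else g)" for i using f g by simp
  show "(if i then f else g) x = (if j then f else g) x"
    if "x \<in> topspace X \<inter> (if i then S else T) \<inter> (if j then S else T)" for i j x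
    using that eq by (cases i; cases j) auto
  show "\<exists>j. j \<in> {True, False} \<and> x \<in> (if j then S else T) \<and>
      (if x \<in> S then f x else g x) = (if j then f else g) x" if "x \<in> topspace X" for x
    using that assms(3) by (cases "x \<in> S") auto
qed

lemma disc_Hausdorff:
  assumes "disc_in X D" shows "Hausdorff_space (subtopology X D)"
proof -
  have "Hausdorff_space (top_of_set (cball (0 :: complex) 1))"
    by (rule Hausdorff_space_subtopology) (rule Hausdorff_space_euclidean)
  then show ?thesis using assms homeomorphic_Hausdorff_space unfolding disc_in_def by blast
qed

lemma homeomorphic_map_continuous_on:
  assumes "homeomorphic_map (top_of_set A) (top_of_set B) f"
  shows "continuous_on A f" "inj_on f A" "f ` A = B"
proof -
  show "continuous_on A f"
    using homeomorphic_imp_continuous_map[OF assms] by (simp add: continuous_map_in_subtopology)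
  show "inj_on f A" "f ` A = B"
    using homeomorphic_imp_injective_map[OF assms] homeomorphic_imp_surjective_map[OF assms] by simp_all
qed

text \<open>
  Normalising the charts of both discs by the same parametrisation \<open>\<gamma>\<close> of a common segment makes them
  agree on it, so that they can be glued whatever the gluing map is.
\<close>

lemma strip_chart:
  assumes D: "disc_in X D" and sD: "s \<subseteq> surface_boundary (subtopology X D)"
    and g: "homeomorphic_map (top_of_set {0..1 :: real}) (subtopology X s) \<gamma>"
    and sX: "s \<subseteq> topspace X"
  obtains U \<Psi> where "openin (subtopology X D) U"
    "homeomorphic_map (subtopology X U) (top_of_set {z. 0 < Re z \<and> Re z < 1 \<and> 0 \<le> Im z}) \<Psi>"
    "U \<inter> surface_boundary (subtopology X D) = \<gamma> ` {0<..<1}"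
    "\<forall>u\<in>{0<..<1}. \<Psi> (\<gamma> u) = of_real u"
proof -
  let ?C = "surface_boundary (subtopology X D)" and ?I = "{0<..<1 :: real}"
  have DX: "D \<subseteq> topspace X" using D by (simp add: disc_in_def)
  have CD: "?C \<subseteq> D" by (auto simp: surface_boundary_def)
  have gs: "\<gamma> ` {0..1} = s" and ginj: "inj_on \<gamma> {0..1}"
    using homeomorphic_imp_surjective_map[OF g] homeomorphic_imp_injective_map[OF g] sX
    by (simp_all add: inf.absorb2)
  \<comment> \<open>An end of the segment goes to infinity; the open segment stays in the chart and
    becomes an open subset of the real axis.\<close>
  let ?c = "\<gamma> 0"
  have c: "?c \<in> ?C" using gs sD by force
  obtain k where k: "homeomorphic_map (subtopology X (D - {?c})) (top_of_set {z. 0 \<le> Im z}) k"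
    and bd: "\<And>x. x \<in> D - {?c} \<Longrightarrow> x \<in> ?C \<longleftrightarrow> Im (k x) = 0"
    using disc_chart[OF D c] by blast
  have topk: "topspace (subtopology X (D - {?c})) = D - {?c}" using DX by auto
  have kinj: "inj_on k (D - {?c})" and kim: "k ` (D - {?c}) = {z. 0 \<le> Im z}"
    using homeomorphic_imp_injective_map[OF k] homeomorphic_imp_surjective_map[OF k] topk by simp_all
  define h where "h u = Re (k (\<gamma> u))" for u
  have \<gamma>D: "\<gamma> u \<in> ?C" "\<gamma> u \<in> D - {?c}" if "u \<in> ?I" for u
  proof -
    show 1: "\<gamma> u \<in> ?C" using that gs sD by force
    have "\<gamma> u \<noteq> ?c" using inj_onD[OF ginj, of u 0] that by auto
    then show "\<gamma> u \<in> D - {?c}" using 1 CD by auto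
  qed
  have kh: "k (\<gamma> u) = of_real (h u)" if "u \<in> ?I" for u
    using bd[OF \<gamma>D(2)[OF that]] \<gamma>D(1)[OF that] by (simp add: h_def complex_eq_iff)
  have "homeomorphic_map (top_of_set ?I) (subtopology X (\<gamma> ` ?I)) \<gamma>"
    by (rule homeomorphic_map_restrict[OF g]) (use sX in auto)
  moreover have "homeomorphic_map (subtopology X (\<gamma> ` ?I)) (top_of_set (k ` \<gamma> ` ?I)) k"
    by (rule homeomorphic_map_restrict[OF k]) (use \<gamma>D DX in auto)
  ultimately have kg: "homeomorphic_map (top_of_set ?I) (top_of_set (k ` \<gamma> ` ?I)) (k \<circ> \<gamma>)"
    by (rule homeomorphic_map_compose)
  have hcont: "continuous_on ?I h"
    using homeomorphic_map_continuous_on(1)[OF kg] unfolding h_def comp_def by (rule continuous_on_Re)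
  have hinj: "inj_on h ?I"
  proof (rule inj_onI)
    fix u v assume uv: "u \<in> ?I" "v \<in> ?I" "h u = h v"
    then have "(k \<circ> \<gamma>) u = (k \<circ> \<gamma>) v" using kh by simp
    then show "u = v" using inj_onD[OF homeomorphic_map_continuous_on(2)[OF kg]] uv by blast
  qed
  \<comment> \<open>Invariance of domain on the line: \<open>h\<close> is a homeomorphism of the
    open interval onto an open set, so the strip over that set is relatively open and can be
    reparametrised.\<close>
  obtain g' where "homeomorphism ?I (h ` ?I) h g'"
    by (rule invariance_of_domain_homeomorphism[OF _ hcont _ hinj]) auto
  then have g': "continuous_on (h ` ?I) g'" "\<And>u. u \<in> ?I \<Longrightarrow> g' (h u) = u" "g' ` h ` ?I = ?I"
    by (auto simp: homeomorphism_def)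
  have openJ: "open (h ` ?I)" by (rule invariance_of_domain[OF hcont _ hinj]) simp
  define U where "U = {x \<in> D - {?c}. Re (k x) \<in> h ` ?I}"
  let ?H = "{z. Re z \<in> h ` ?I \<and> 0 \<le> Im z}" and ?S = "{z. 0 < Re z \<and> Re z < 1 \<and> 0 \<le> Im z}"
  have "continuous_map (subtopology X (D - {?c})) euclideanreal (Re \<circ> k)"
    by (rule continuous_map_compose[OF homeomorphic_imp_continuous_map[OF k]])
      (auto intro!: continuous_intros)
  then have "openin (subtopology X (D - {?c})) {x \<in> topspace (subtopology X (D - {?c})). (Re \<circ> k) x \<in> h ` ?I}"
    by (rule openin_continuous_map_preimage) (use openJ in simp)
  then have "openin (subtopology X (D - {?c})) {x \<in> D - {?c}. (Re \<circ> k) x \<in> h ` ?I}"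
    unfolding topk .
  then have U1: "openin (subtopology X (D - {?c})) U" by (simp add: U_def)
  have "openin (subtopology X D) (D - {?c})"
  proof -
    have "closedin (subtopology X D) {?c}"
      by (rule closedin_Hausdorff_singleton[OF disc_Hausdorff[OF D]]) (use c CD DX in auto)
    then show ?thesis using DX by (metis openin_diff openin_topspace topspace_subtopology_subset)
  qed
  then obtain O1 where O1: "openin X O1" "D - {?c} = O1 \<inter> D" by (auto simp: openin_subtopology)
  obtain O2 where O2: "openin X O2" "U = O2 \<inter> (D - {?c})" using U1 by (auto simp: openin_subtopology)
  have Uopen: "openin (subtopology X D) U"
    unfolding openin_subtopology
    by (rule exI[of _ "O1 \<inter> O2"]) (use O1 O2 in \<open>auto intro: openin_Int\<close>)
  have "k ` U = ?H" unfolding U_def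
  proof (intro set_eqI iffI)
    fix z assume z: "z \<in> ?H"
    then have "z \<in> k ` (D - {?c})" unfolding kim by simp
    then show "z \<in> k ` {x \<in> D - {?c}. Re (k x) \<in> h ` ?I}" using z by auto
  qed (use kim in auto)
  moreover have "homeomorphic_map (subtopology X U) (top_of_set (k ` U)) k"
    by (rule homeomorphic_map_restrict[OF k]) (use DX in \<open>auto simp: U_def\<close>)
  ultimately have hom1: "homeomorphic_map (subtopology X U) (top_of_set ?H) k" by simp
  \<comment> \<open>Only the real coordinate is changed, by the inverse of \<open>h\<close>, so that
    \<open>\<gamma> u\<close> goes to \<open>u\<close> itself.\<close>
  let ?f = "\<lambda>z. complex_of_real (g' (Re z)) + \<i> * of_real (Im z)"
  let ?f' = "\<lambda>z. complex_of_real (h (Re z)) + \<i> * of_real (Im z)"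
  have "homeomorphic_maps (top_of_set ?H) (top_of_set ?S) ?f ?f'"
    unfolding homeomorphic_maps_def
  proof (intro conjI ballI)
    have "continuous_on ?H (\<lambda>z. g' (Re z))"
      by (rule continuous_on_compose2[OF g'(1)]) (auto intro!: continuous_intros)
    then have "continuous_on ?H ?f" by (intro continuous_intros) auto
    moreover have "?f ` ?H \<subseteq> ?S" using g' by auto
    ultimately show "continuous_map (top_of_set ?H) (top_of_set ?S) ?f"
      by (auto simp: continuous_map_in_subtopology)
    have "continuous_on ?S (\<lambda>z. h (Re z))"
      by (rule continuous_on_compose2[OF hcont]) (auto intro!: continuous_intros)
    then have "continuous_on ?S ?f'" by (intro continuous_intros) auto
    moreover have "?f' ` ?S \<subseteq> ?H" by auto
    ultimately show "continuous_map (top_of_set ?S) (top_of_set ?H) ?f'"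
      by (auto simp: continuous_map_in_subtopology)
    show "?f' (?f z) = z" if z: "z \<in> topspace (top_of_set ?H)" for z
    proof -
      obtain u where "u \<in> ?I" "Re z = h u" using z by auto
      then show ?thesis using g'(2) by (simp add: complex_eq_iff)
    qed
    show "?f (?f' z) = z" if "z \<in> topspace (top_of_set ?S)" for z
      using that g'(2)[of "Re z"] by (simp add: complex_eq_iff)
  qed
  then have hom2: "homeomorphic_map (top_of_set ?H) (top_of_set ?S) ?f"
    using homeomorphic_map_maps by blast
  show thesis
  proof
    show "openin (subtopology X D) U" by (rule Uopen)
    show "homeomorphic_map (subtopology X U) (top_of_set ?S) (?f \<circ> k)"
      by (rule homeomorphic_map_compose[OF hom1 hom2])
    show "\<forall>u\<in>?I. (?f \<circ> k) (\<gamma> u) = of_real u"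
      using kh g'(2) by simp
    show "U \<inter> ?C = \<gamma> ` ?I"
    proof
      show "\<gamma> ` ?I \<subseteq> U \<inter> ?C" using \<gamma>D kh unfolding U_def by auto
      show "U \<inter> ?C \<subseteq> \<gamma> ` ?I"
      proof
        fix x assume x: "x \<in> U \<inter> ?C"
        then have xD: "x \<in> D - {?c}" by (simp add: U_def)
        obtain u where u: "u \<in> ?I" "Re (k x) = h u" using x by (auto simp: U_def)
        have "Im (k x) = 0" using bd[OF xD] x by simp
        then have "k x = k (\<gamma> u)" using u kh by (simp add: complex_eq_iff)
        then have "x = \<gamma> u" using inj_onD[OF kinj] xD \<gamma>D(2)[OF u(1)] by blast
        then show "x \<in> \<gamma> ` ?I" using u by blast
      qed
    qed
  qed
qed

text \<open>The half strips of \<open>v\<close> and \<open>e\<close> over the open segment, one of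
  them reflected, form a full open strip; they fit along the real interval since both charts send
  \<open>\<gamma> u\<close> to \<open>u\<close>. The neighbourhood \<open>N\<close> keeps all other
  discs away from \<open>p\<close>.\<close>

lemma glued_segment_flat:
  assumes v: "disc_in X v" "closedin X v" and e: "disc_in X e" "closedin X e"
    and ve: "v \<inter> e \<subseteq> surface_boundary (subtopology X v) \<inter> surface_boundary (subtopology X e)"
    and s: "line_segment_in X s" "s \<subseteq> surface_boundary (subtopology X v)" "s \<subseteq> surface_boundary (subtopology X e)"
    and p: "p \<in> s - ends X s" and N: "openin X N" "p \<in> N" "N \<subseteq> v \<union> e"
  shows "flat_point X p"
proof -
  have sX: "s \<subseteq> topspace X" using s(1) by (simp add: line_segment_in_def)
  obtain \<gamma> where g: "homeomorphic_map (top_of_set {0..1 :: real}) (subtopology X s) \<gamma>"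
    "\<gamma> ` {0..1} = s" "inj_on \<gamma> {0..1}" "ends X s = {\<gamma> 0, \<gamma> 1}"
    using line_segment_param[OF s(1)] .
  let ?S = "{z. 0 < Re z \<and> Re z < 1 \<and> 0 \<le> Im z}"
  let ?S' = "{z. 0 < Re z \<and> Re z < 1 \<and> Im z \<le> 0}"
  let ?T = "{z. 0 < Re z \<and> Re z < 1}"
  let ?\<sigma> = "\<gamma> ` {0<..<1}"
  obtain Uv \<Psi>v where Uv: "openin (subtopology X v) Uv" "homeomorphic_map (subtopology X Uv) (top_of_set ?S) \<Psi>v"
    "Uv \<inter> surface_boundary (subtopology X v) = ?\<sigma>" "\<forall>u\<in>{0<..<1}. \<Psi>v (\<gamma> u) = of_real u"
    using strip_chart[OF v(1) s(2) g(1) sX] .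
  obtain Ue \<Psi>e where Ue: "openin (subtopology X e) Ue" "homeomorphic_map (subtopology X Ue) (top_of_set ?S) \<Psi>e"
    "Ue \<inter> surface_boundary (subtopology X e) = ?\<sigma>" "\<forall>u\<in>{0<..<1}. \<Psi>e (\<gamma> u) = of_real u"
    using strip_chart[OF e(1) s(3) g(1) sX] .
  have Uv4: "\<And>u. u \<in> {0<..<1} \<Longrightarrow> \<Psi>v (\<gamma> u) = of_real u"
    and Ue4: "\<And>u. u \<in> {0<..<1} \<Longrightarrow> \<Psi>e (\<gamma> u) = of_real u"
    using Uv(4) Ue(4) by blast+
  have Uvv: "Uv \<subseteq> v" and Uee: "Ue \<subseteq> e" using Uv(1) Ue(1) openin_imp_subset by blast+
  have vX: "v \<subseteq> topspace X" and eX: "e \<subseteq> topspace X" using v e by (auto simp: disc_in_def)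
  have se: "?\<sigma> \<subseteq> Uv" "?\<sigma> \<subseteq> Ue" "?\<sigma> \<subseteq> v" "?\<sigma> \<subseteq> e" using Uv(3) Ue(3) Uvv Uee by blast+
  have Uev: "Ue \<inter> v = ?\<sigma>" and Uve: "Uv \<inter> e = ?\<sigma>" using Uv(3) Ue(3) ve Uvv Uee se by blast+
  define U where "U = Uv \<union> Ue"
  have Uv_eq: "U \<inter> v = Uv" and Ue_eq: "U \<inter> e = Ue" unfolding U_def using Uev Uve Uvv Uee se by blast+
  have UX: "topspace (subtopology X U) = U" using U_def Uvv Uee vX eX by auto
  have p\<sigma>: "p \<in> ?\<sigma>"
  proof -
    obtain t where t: "t \<in> {0..1}" "p = \<gamma> t" using p g(2) by auto
    then have "t \<in> {0<..<1}" using p g(4) by (auto simp: less_le)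
    then show ?thesis using t by blast
  qed
  obtain \<Phi>v where Pv: "homeomorphic_maps (subtopology X Uv) (top_of_set ?S) \<Psi>v \<Phi>v"
    using Uv(2) homeomorphic_map_maps by blast
  obtain \<Phi>e where Pe: "homeomorphic_maps (subtopology X Ue) (top_of_set ?S) \<Psi>e \<Phi>e"
    using Ue(2) homeomorphic_map_maps by blast
  have tv: "topspace (subtopology X Uv) = Uv" "topspace (subtopology X Ue) = Ue" using Uvv Uee vX eX by auto
  have v1: "continuous_map (subtopology X Uv) (top_of_set ?S) \<Psi>v" "continuous_map (top_of_set ?S) (subtopology X Uv) \<Phi>v"
    "\<And>x. x \<in> Uv \<Longrightarrow> \<Phi>v (\<Psi>v x) = x" "\<And>z. z \<in> ?S \<Longrightarrow> \<Psi>v (\<Phi>v z) = z"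
    using Pv unfolding homeomorphic_maps_def tv by auto
  have e1: "continuous_map (subtopology X Ue) (top_of_set ?S) \<Psi>e" "continuous_map (top_of_set ?S) (subtopology X Ue) \<Phi>e"
    "\<And>x. x \<in> Ue \<Longrightarrow> \<Phi>e (\<Psi>e x) = x" "\<And>z. z \<in> ?S \<Longrightarrow> \<Psi>e (\<Phi>e z) = z"
    using Pe unfolding homeomorphic_maps_def tv by auto
  have v2: "\<And>x. x \<in> Uv \<Longrightarrow> \<Psi>v x \<in> ?S" "\<And>z. z \<in> ?S \<Longrightarrow> \<Phi>v z \<in> Uv"
    using continuous_map_image_subset_topspace[OF v1(1)] continuous_map_image_subset_topspace[OF v1(2)] tv by auto
  have e2: "\<And>x. x \<in> Ue \<Longrightarrow> \<Psi>e x \<in> ?S" "\<And>z. z \<in> ?S \<Longrightarrow> \<Phi>e z \<in> Ue"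
    using continuous_map_image_subset_topspace[OF e1(1)] continuous_map_image_subset_topspace[OF e1(2)] tv by auto
  have param_inv: "\<Phi>v (of_real u) = \<gamma> u" "\<Phi>e (of_real u) = \<gamma> u" if "u \<in> {0<..<1}" for u
  proof -
    have "\<gamma> u \<in> Uv" "\<gamma> u \<in> Ue" using se imageI[OF that, of \<gamma>] by blast+
    then show "\<Phi>v (of_real u) = \<gamma> u" "\<Phi>e (of_real u) = \<gamma> u"
      using v1(3)[of "\<gamma> u"] e1(3)[of "\<gamma> u"] Uv4[OF that] Ue4[OF that] by simp_all
  qed
  \<comment> \<open>Conjugation puts the half strip of \<open>e\<close> below the real axis.\<close>
  define \<Psi> where "\<Psi> x = (if x \<in> Uv then \<Psi>v x else cnj (\<Psi>e x))" for x
  define \<Phi> where "\<Phi> z = (if z \<in> {z. 0 \<le> Im z} then \<Phi>v z else \<Phi>e (cnj z))" for z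
  have clU: "closedin (subtopology X U) Uv" "closedin (subtopology X U) Ue"
    using closedin_subtopology_Int_closed[OF v(2), of U] closedin_subtopology_Int_closed[OF e(2), of U]
    unfolding Uv_eq Ue_eq .
  have subU: "subtopology (subtopology X U) Uv = subtopology X Uv" "subtopology (subtopology X U) Ue = subtopology X Ue"
    by (simp_all add: subtopology_subtopology U_def inf.absorb2)
  have cont1: "continuous_map (subtopology X U) euclidean \<Psi>"
    unfolding \<Psi>_def
  proof (rule continuous_map_paste[OF clU])
    show "Uv \<union> Ue = topspace (subtopology X U)" using UX by (simp add: U_def)
    show "continuous_map (subtopology (subtopology X U) Uv) euclidean \<Psi>v"
      unfolding subU using v1(1) by (simp add: continuous_map_in_subtopology)
    have "continuous_map (subtopology X Ue) euclidean \<Psi>e"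
      using e1(1) by (simp add: continuous_map_in_subtopology)
    from continuous_map_compose[OF this, of euclidean cnj]
    show "continuous_map (subtopology (subtopology X U) Ue) euclidean (\<lambda>x. cnj (\<Psi>e x))"
      unfolding subU comp_def by (simp add: continuous_on_cnj)
    fix x assume "x \<in> Uv" "x \<in> Ue"
    then have "x \<in> ?\<sigma>" using Uev Uvv by blast
    then show "\<Psi>v x = cnj (\<Psi>e x)" using Uv4 Ue4 by auto
  qed
  have cont2: "continuous_map (top_of_set ?T) X \<Phi>"
    unfolding \<Phi>_def
  proof -
    have "continuous_map (top_of_set ?T) X (\<lambda>z. if z \<in> ?S then \<Phi>v z else \<Phi>e (cnj z))"
    proof (rule continuous_map_paste)
      have "?S = ?T \<inter> {z. 0 \<le> Im z}" "?S' = ?T \<inter> {z. Im z \<le> 0}" by auto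
      then show "closedin (top_of_set ?T) ?S" "closedin (top_of_set ?T) ?S'"
        using closed_halfspace_Im_ge[of 0] closed_halfspace_Im_le[of 0] by (simp_all add: closedin_closed_Int)
      show "?S \<union> ?S' = topspace (top_of_set ?T)" by auto
      have "?T \<inter> ?S = ?S" "?T \<inter> ?S' = ?S'" by auto
      then have sub: "subtopology (top_of_set ?T) ?S = top_of_set ?S" "subtopology (top_of_set ?T) ?S' = top_of_set ?S'"
        by (simp_all add: subtopology_subtopology)
      show "continuous_map (subtopology (top_of_set ?T) ?S) X \<Phi>v"
        unfolding sub using v1(2) by (simp add: continuous_map_in_subtopology)
      have c: "continuous_map (top_of_set ?S) X \<Phi>e" using e1(2) by (simp add: continuous_map_in_subtopology)
      have "continuous_map (top_of_set ?S') (top_of_set ?S) cnj"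
        by (auto simp: continuous_map_in_subtopology continuous_on_cnj)
      from continuous_map_compose[OF this c]
      show "continuous_map (subtopology (top_of_set ?T) ?S') X (\<lambda>z. \<Phi>e (cnj z))"
        unfolding sub comp_def .
      fix z assume "z \<in> ?S" "z \<in> ?S'"
      then have "Re z \<in> {0<..<1}" "z = of_real (Re z)" by (auto simp: complex_eq_iff)
      then show "\<Phi>v z = \<Phi>e (cnj z)" using param_inv by (metis complex_cnj_complex_of_real)
    qed
    then show "continuous_map (top_of_set ?T) X (\<lambda>z. if z \<in> {z. 0 \<le> Im z} then \<Phi>v z else \<Phi>e (cnj z))"
      by (rule continuous_map_eq) auto
  qed
  have "homeomorphic_maps (subtopology X U) (top_of_set ?T) \<Psi> \<Phi>"
    unfolding homeomorphic_maps_def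
  proof (intro conjI ballI)
    show "continuous_map (subtopology X U) (top_of_set ?T) \<Psi>"
      unfolding continuous_map_in_subtopology
      using cont1 v2(1) e2(1) UX by (auto simp: U_def \<Psi>_def)
    show "continuous_map (top_of_set ?T) (subtopology X U) \<Phi>"
      unfolding continuous_map_in_subtopology
      using cont2 v2(2) e2(2) by (auto simp: U_def \<Phi>_def)
    show "\<Phi> (\<Psi> x) = x" if "x \<in> topspace (subtopology X U)" for x
    proof (cases "x \<in> Uv")
      case True
      then show ?thesis using v2(1)[OF True] v1(3)[OF True] by (simp add: \<Psi>_def \<Phi>_def)
    next
      case False
      then have xe: "x \<in> Ue" using that UX by (simp add: U_def)
      have "Im (\<Psi>e x) \<noteq> 0"
      proof
        assume "Im (\<Psi>e x) = 0"
        then have "Re (\<Psi>e x) \<in> {0<..<1}" "\<Psi>e x = of_real (Re (\<Psi>e x))"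
          using e2(1)[OF xe] by (auto simp: complex_eq_iff)
        then have "x = \<gamma> (Re (\<Psi>e x))" using param_inv(2) e1(3)[OF xe] by metis
        then have "x \<in> ?\<sigma>" using \<open>Re (\<Psi>e x) \<in> {0<..<1}\<close> by blast
        then show False using se False by blast
      qed
      then show ?thesis using False e2(1)[OF xe] e1(3)[OF xe] by (simp add: \<Psi>_def \<Phi>_def)
    qed
    show "\<Psi> (\<Phi> z) = z" if "z \<in> topspace (top_of_set ?T)" for z
    proof (cases "0 \<le> Im z")
      case True
      then show ?thesis using that v1(4)[of z] v2(2)[of z] by (simp add: \<Psi>_def \<Phi>_def)
    next
      case False
      have zS: "cnj z \<in> ?S" using that False by simp
      have "\<Phi>e (cnj z) \<notin> Uv"
      proof
        assume "\<Phi>e (cnj z) \<in> Uv"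
        then have "\<Phi>e (cnj z) \<in> ?\<sigma>" using e2(2)[OF zS] Uev Uvv by blast
        then obtain u where u: "u \<in> {0<..<1}" "\<Phi>e (cnj z) = \<gamma> u" by blast
        then have "cnj z = of_real u" using e1(4)[OF zS] Ue4 by metis
        then show False using False by (metis Im_complex_of_real complex_cnj_cnj complex_cnj_complex_of_real order_refl)
      qed
      then show ?thesis using False e1(4)[OF zS] by (simp add: \<Psi>_def \<Phi>_def)
    qed
  qed
  then have hom: "homeomorphic_map (subtopology X U) (top_of_set ?T) \<Psi>" using homeomorphic_map_maps by blast
  have openT: "open ?T"
  proof -
    have "?T = {z. 0 < Re z} \<inter> {z. Re z < 1}" by auto
    then show ?thesis by (metis open_Int open_halfspace_Re_gt open_halfspace_Re_lt)
  qed
  obtain Ov where Ov: "openin X Ov" "Uv = Ov \<inter> v" using Uv(1) by (auto simp: openin_subtopology)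
  obtain Oe where Oe: "openin X Oe" "Ue = Oe \<inter> e" using Ue(1) by (auto simp: openin_subtopology)
  \<comment> \<open>\<open>U\<close> is a union of sets that are open only relative to one disc
    each. \<open>W\<close> is a neighbourhood of \<open>p\<close> within it that is open in
    \<open>X\<close>: points in both open sets, or in one of them and off the other disc.\<close>
  define W where "W = N \<inter> ((Ov \<inter> Oe) \<union> (Ov - e) \<union> (Oe - v))"
  have Wopen: "openin X W" unfolding W_def
    using N(1) Ov(1) Oe(1) v(2) e(2) by (intro openin_Int openin_Un openin_diff)
  have WU: "W \<subseteq> U" unfolding W_def U_def Ov(2) Oe(2) using N(3) by blast
  have pW: "p \<in> W" unfolding W_def using N(2) p\<sigma> se Ov(2) Oe(2) by blast
  have fl: "flat_point (top_of_set ?T) (\<Psi> p)"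
    unfolding flat_point_def
  proof (intro exI conjI)
    show "openin (top_of_set ?T) ?T" by simp
    show "\<Psi> p \<in> ?T" using pW WU homeomorphic_imp_surjective_map[OF hom] UX by auto
    show "open ?T" by (rule openT)
    show "subtopology (top_of_set ?T) ?T homeomorphic_space top_of_set ?T"
      by (simp add: subtopology_subtopology homeomorphic_space_refl)
  qed
  have "p \<in> topspace (subtopology X U)" using pW WU UX by auto
  then have fU: "flat_point (subtopology X U) p" using flat_point_homeomorphic_map_iff[OF hom] fl by blast
  have "openin (subtopology X U) W" using Wopen WU by (metis inf.absorb1 openin_subtopology)
  then have "flat_point (subtopology (subtopology X U) W) p"
    by (rule iffD2[OF flat_point_open_subtopology[OF _ pW] fU])
  moreover have "subtopology (subtopology X U) W = subtopology X W"
    using WU by (simp add: subtopology_subtopology inf.absorb2)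
  ultimately show ?thesis using flat_point_open_subtopology[OF Wopen pW] by simp
qed

text \<open>With an inner point of \<open>s\<close> at infinity, \<open>s\<close> is everything
  outside an open interval and its ends are the ends of that interval; so points of the circle off
  \<open>s\<close> come arbitrarily close to them.\<close>

lemma end_not_interior:
  assumes D: "disc_in X D" and s: "line_segment_in X s" "s \<subseteq> surface_boundary (subtopology X D)"
    and p: "p \<in> ends X s" and U: "openin X U" "p \<in> U"
  obtains x where "x \<in> U" "x \<in> surface_boundary (subtopology X D)" "x \<notin> s"
proof -
  let ?C = "surface_boundary (subtopology X D)"
  have CD: "?C \<subseteq> D" by (auto simp: surface_boundary_def)
  have DX: "D \<subseteq> topspace X" using D by (simp add: disc_in_def)
  have "Hausdorff_space (subtopology (subtopology X D) ?C)"
    by (rule Hausdorff_space_subtopology[OF disc_Hausdorff[OF D]])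
  then have H: "Hausdorff_space (subtopology X ?C)"
    using CD by (simp add: subtopology_subtopology inf.absorb2)
  have CX: "?C \<subseteq> topspace X" using CD DX by blast
  obtain c where c: "c \<in> s - ends X s" using line_segment_interior_nonempty[OF s(1)] by blast
  obtain \<rho> where \<rho>: "homeomorphic_map (subtopology X (?C - {c})) euclideanreal \<rho>"
    using disc_boundary_chart[OF D, of c] c s(2) by blast
  obtain a b where ab: "a < b" "\<rho> ` (s - {c}) = {..a} \<union> {b..}" "\<rho> ` ends X s = {a, b}"
    using arc_minus_point_image[OF H CX \<rho> s c] .
  have pc: "p \<noteq> c" "p \<in> ?C" using p c s(2) ends_subset[of X s] by auto
  have "openin (subtopology X (?C - {c})) (U \<inter> (?C - {c}))" using U(1) by (auto simp: openin_subtopology)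
  then have "open (\<rho> ` (U \<inter> (?C - {c})))"
    using homeomorphic_map_openness_eq[OF \<rho>] by auto
  moreover have "\<rho> p \<in> \<rho> ` (U \<inter> (?C - {c}))" using U(2) pc by blast
  ultimately obtain d where d: "d > 0" "\<And>y. dist y (\<rho> p) < d \<Longrightarrow> y \<in> \<rho> ` (U \<inter> (?C - {c}))"
    unfolding open_dist by metis
  have "\<rho> p = a \<or> \<rho> p = b" using ab(3) p by blast
  \<comment> \<open>A point of the gap at distance at most \<open>d / 2\<close> from the end; the
    bound \<open>(a + b) / 2\<close> keeps it from running past the other end.\<close>
  moreover define y where "y = (if \<rho> p = a then min (a + d / 2) ((a + b) / 2) else max (b - d / 2) ((a + b) / 2))"
  ultimately have y: "a < y" "y < b" "dist y (\<rho> p) < d" using ab(1) d(1) by (auto simp: dist_real_def min_def max_def)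
  have "y \<in> \<rho> ` (U \<inter> (?C - {c}))" by (rule d(2)[OF y(3)])
  then obtain x where x: "x \<in> U" "x \<in> ?C" "x \<noteq> c" "y = \<rho> x" by auto
  have "x \<notin> s"
  proof
    assume "x \<in> s"
    then have "y \<in> \<rho> ` (s - {c})" using x by blast
    then show False unfolding ab(2) using y by simp
  qed
  with x show thesis using that by blast
qed

text \<open>What remains true after regluing and deleting edges, so that the boundary is computed
  once for all these surfaces. Closedness of the discs and segments is stated directly, in a form
  that can be checked for a glued topology.\<close>

locale disc_system =
  fixes X :: "'a topology" and V E \<Sigma> :: "'a set set"
  assumes finite_V: "finite V" and finite_E: "finite E" and finite_\<Sigma>: "finite \<Sigma>"
    and cover: "topspace X = \<Union>V \<union> \<Union>E"
    and disc: "D \<in> V \<union> E \<Longrightarrow> disc_in X D"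
    and closed: "D \<in> V \<union> E \<Longrightarrow> closedin X D"
    and disjoint_V: "v \<in> V \<Longrightarrow> v' \<in> V \<Longrightarrow> v \<noteq> v' \<Longrightarrow> v \<inter> v' = {}"
    and disjoint_E: "e \<in> E \<Longrightarrow> e' \<in> E \<Longrightarrow> e \<noteq> e' \<Longrightarrow> e \<inter> e' = {}"
    and disjoint_\<Sigma>: "s \<in> \<Sigma> \<Longrightarrow> s' \<in> \<Sigma> \<Longrightarrow> s \<noteq> s' \<Longrightarrow> s \<inter> s' = {}"
    and closed_\<Sigma>: "s \<in> \<Sigma> \<Longrightarrow> closedin X s"
    and segment: "s \<in> \<Sigma> \<Longrightarrow> line_segment_in X s"
    and segment_V: "s \<in> \<Sigma> \<Longrightarrow> \<exists>v\<in>V. s \<subseteq> surface_boundary (subtopology X v)"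
    and segment_E: "s \<in> \<Sigma> \<Longrightarrow> \<exists>e\<in>E. s \<subseteq> surface_boundary (subtopology X e)"
    and meet: "\<Union>V \<inter> \<Union>E = \<Union>\<Sigma>"
begin

abbreviation bd :: "'a set \<Rightarrow> 'a set" where
  "bd D \<equiv> surface_boundary (subtopology X D)"

section \<open>The boundary of a system of discs\<close>

lemma bd_subset: "bd D \<subseteq> D"
  by (auto simp: surface_boundary_flat)

lemma meet_segment:
  assumes "v \<in> V" "e \<in> E" "x \<in> v" "x \<in> e"
  obtains s where "s \<in> \<Sigma>" "x \<in> s" "s \<subseteq> bd v" "s \<subseteq> bd e"
proof -
  have "x \<in> \<Union>V \<inter> \<Union>E" using assms by blast
  then obtain s where s: "s \<in> \<Sigma>" "x \<in> s" unfolding meet by blast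
  obtain v' where v': "v' \<in> V" "s \<subseteq> bd v'" using segment_V[OF s(1)] by blast
  obtain e' where e': "e' \<in> E" "s \<subseteq> bd e'" using segment_E[OF s(1)] by blast
  have "x \<in> v'" "x \<in> e'" using s v' e' bd_subset by blast+
  then have "v' = v" "e' = e" using disjoint_V[of v' v] disjoint_E[of e' e] assms v' e' by blast+
  then show thesis using that s v' e' by blast
qed

lemma meet_bd: "v \<in> V \<Longrightarrow> e \<in> E \<Longrightarrow> v \<inter> e \<subseteq> bd v \<inter> bd e"
proof
  fix x assume ve: "v \<in> V" "e \<in> E" and "x \<in> v \<inter> e"
  then have "x \<in> v" "x \<in> e" by auto
  from meet_segment[OF ve this] obtain s where "s \<in> \<Sigma>" "x \<in> s" "s \<subseteq> bd v" "s \<subseteq> bd e" .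
  then show "x \<in> bd v \<inter> bd e" by auto
qed

lemma bd_local:
  assumes U: "openin X U" "U \<subseteq> D" "p \<in> U"
  shows "p \<in> surface_boundary X \<longleftrightarrow> p \<in> bd D"
proof -
  have "openin (subtopology X D) U" using U(1,2) by (metis inf.absorb1 openin_subtopology)
  then have "surface_boundary (subtopology (subtopology X D) U) = U \<inter> bd D"
    by (rule surface_boundary_open_subtopology)
  moreover have "subtopology (subtopology X D) U = subtopology X U"
    using U(2) by (simp add: subtopology_subtopology inf.absorb2)
  ultimately show ?thesis using surface_boundary_open_subtopology[OF U(1)] U(3) by auto
qed

lemma boundary_off_E:
  assumes v: "v \<in> V" "p \<in> v" "p \<notin> \<Union>E"
  shows "p \<in> surface_boundary X \<longleftrightarrow> p \<in> bd v"
proof (rule bd_local)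
  have "closedin X (\<Union>(V - {v}) \<union> \<Union>E)"
    using finite_V finite_E closed by (intro closedin_Un closedin_Union) auto
  then show "openin X (topspace X - (\<Union>(V - {v}) \<union> \<Union>E))" by blast
  show "topspace X - (\<Union>(V - {v}) \<union> \<Union>E) \<subseteq> v" unfolding cover by blast
  show "p \<in> topspace X - (\<Union>(V - {v}) \<union> \<Union>E)" using v cover disjoint_V by blast
qed

lemma boundary_off_V:
  assumes e: "e \<in> E" "p \<in> e" "p \<notin> \<Union>V"
  shows "p \<in> surface_boundary X \<longleftrightarrow> p \<in> bd e"
proof (rule bd_local)
  have "closedin X (\<Union>(E - {e}) \<union> \<Union>V)"
    using finite_V finite_E closed by (intro closedin_Un closedin_Union) auto
  then show "openin X (topspace X - (\<Union>(E - {e}) \<union> \<Union>V))" by blast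
  show "topspace X - (\<Union>(E - {e}) \<union> \<Union>V) \<subseteq> e" unfolding cover by blast
  show "p \<in> topspace X - (\<Union>(E - {e}) \<union> \<Union>V)" using e cover disjoint_E by blast
qed

text \<open>An inner point is flat because exactly two discs meet there, glued along
  \<open>s\<close>. An end is a limit of points of the vertex circle off \<open>s\<close>, which
  near it lie in no segment and hence on the boundary; and the boundary is closed.\<close>

lemma boundary_on_segment:
  assumes s: "s \<in> \<Sigma>" "p \<in> s"
  shows "p \<in> surface_boundary X \<longleftrightarrow> p \<in> ends X s"
proof -
  obtain v where v: "v \<in> V" "s \<subseteq> bd v" using segment_V[OF s(1)] by blast
  obtain e where e: "e \<in> E" "s \<subseteq> bd e" using segment_E[OF s(1)] by blast
  have pve: "p \<in> v" "p \<in> e" using v e s bd_subset by blast+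
  have pX: "p \<in> topspace X" using pve v cover by blast
  show ?thesis
  proof
    assume bp: "p \<in> surface_boundary X"
    show "p \<in> ends X s"
    proof (rule ccontr)
      assume "p \<notin> ends X s"
      then have p: "p \<in> s - ends X s" using s by blast
      let ?N = "topspace X - (\<Union>(V - {v}) \<union> \<Union>(E - {e}))"
      have "closedin X (\<Union>(V - {v}) \<union> \<Union>(E - {e}))"
        using finite_V finite_E closed by (intro closedin_Un closedin_Union) auto
      then have N: "openin X ?N" by blast
      have N2: "p \<in> ?N" using pve v e pX disjoint_V disjoint_E by blast
      have N3: "?N \<subseteq> v \<union> e" unfolding cover by blast
      have "flat_point X p"
        by (rule glued_segment_flat[OF _ _ _ _ meet_bd[OF v(1) e(1)] segment[OF s(1)] v(2) e(2) p N N2 N3])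
          (use v e disc closed in auto)
      then show False using bp by (simp add: surface_boundary_flat)
    qed
  next
    assume p: "p \<in> ends X s"
    show "p \<in> surface_boundary X"
    proof (rule ccontr)
      assume np: "p \<notin> surface_boundary X"
      \<comment> \<open>If \<open>p\<close> were not on the boundary, this neighbourhood of it would
        avoid the closed boundary and all other segments.\<close>
      let ?U = "topspace X - (surface_boundary X \<union> \<Union>(\<Sigma> - {s}))"
      have "closedin X (surface_boundary X \<union> \<Union>(\<Sigma> - {s}))"
        using finite_\<Sigma> closed_\<Sigma> by (intro closedin_Un closedin_Union closedin_surface_boundary) auto
      then have U: "openin X ?U" by blast
      have pU: "p \<in> ?U" using np pX s disjoint_\<Sigma> by blast
      obtain x where x: "x \<in> ?U" "x \<in> bd v" "x \<notin> s"
        using end_not_interior[OF disc segment[OF s(1)] v(2) p U pU] v(1) by blast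
      then have "x \<notin> \<Union>\<Sigma>" by blast
      then have "x \<notin> \<Union>E" using x(2) v(1) bd_subset[of v] meet by blast
      then have "x \<in> surface_boundary X" using boundary_off_E[OF v(1)] x(2) bd_subset by blast
      then show False using x(1) by blast
    qed
  qed
qed

theorem surface_boundary_eq:
  "surface_boundary X = (\<Union>D\<in>V \<union> E. bd D) - (\<Union>s\<in>\<Sigma>. s - ends X s)"
proof (intro set_eqI iffI)
  fix p assume p: "p \<in> surface_boundary X"
  then have pX: "p \<in> topspace X" by (simp add: surface_boundary_flat)
  have "p \<notin> s - ends X s" if "s \<in> \<Sigma>" for s using boundary_on_segment[OF that] p by blast
  moreover have "\<exists>D\<in>V \<union> E. p \<in> bd D"
  proof (cases "p \<in> \<Union>V")
    case True
    then obtain v where v: "v \<in> V" "p \<in> v" by blast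
    show ?thesis
    proof (cases "p \<in> \<Union>E")
      case True
      then show ?thesis using meet_bd v by blast
    next
      case False
      then show ?thesis using boundary_off_E[OF v] p v by blast
    qed
  next
    case False
    then obtain e where "e \<in> E" "p \<in> e" using pX cover by blast
    then show ?thesis using boundary_off_V False p by blast
  qed
  ultimately show "p \<in> (\<Union>D\<in>V \<union> E. bd D) - (\<Union>s\<in>\<Sigma>. s - ends X s)" by blast
next
  fix p assume p: "p \<in> (\<Union>D\<in>V \<union> E. bd D) - (\<Union>s\<in>\<Sigma>. s - ends X s)"
  then obtain D where D: "D \<in> V \<union> E" "p \<in> bd D" by blast
  have pD: "p \<in> D" using D bd_subset by blast
  show "p \<in> surface_boundary X"
  proof (cases "p \<in> \<Union>\<Sigma>")
    case True
    then obtain s where "s \<in> \<Sigma>" "p \<in> s" by blast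
    then show ?thesis using boundary_on_segment p by blast
  next
    case False
    then have "D \<in> V \<Longrightarrow> p \<notin> \<Union>E" "D \<in> E \<Longrightarrow> p \<notin> \<Union>V" using meet pD by blast+
    then show ?thesis using boundary_off_E[of D p] boundary_off_V[of D p] D pD by blast
  qed
qed

end

section \<open>Ribbon graphs and regluing\<close>

text \<open>Each closed connected piece is tied to a node whose point set it meets. Pieces that meet
  have related nodes, and the point sets of related nodes lie in one component, so components
  correspond to classes. Applied both to the whole surface and to its boundary.\<close>

lemma card_connected_components_of_graph:
  fixes A :: "'i \<Rightarrow> 'a set" and f :: "'i \<Rightarrow> 'n" and pts :: "'n \<Rightarrow> 'a set"
  assumes fin: "finite I" and cl: "\<And>i. i \<in> I \<Longrightarrow> closedin X (A i)"
    and conn: "\<And>i. i \<in> I \<Longrightarrow> connectedin X (A i)" and cov: "(\<Union>i\<in>I. A i) = topspace X"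
    and RN: "R \<subseteq> N \<times> N" and fN: "\<And>i. i \<in> I \<Longrightarrow> f i \<in> N"
    and meet: "\<And>i j. i \<in> I \<Longrightarrow> j \<in> I \<Longrightarrow> A i \<inter> A j \<noteq> {} \<Longrightarrow> (f i, f j) \<in> eqcl R"
    and pts: "\<And>n. n \<in> N \<Longrightarrow> pts n \<noteq> {} \<and> connectedin X (pts n)"
    and near: "\<And>i. i \<in> I \<Longrightarrow> A i \<inter> pts (f i) \<noteq> {}"
    and edge: "\<And>n n'. (n, n') \<in> R \<Longrightarrow> \<exists>a\<in>pts n. \<exists>b\<in>pts n'. connected_component_of X a b"
    and all: "\<And>n. n \<in> N \<Longrightarrow> \<exists>i\<in>I. (f i, n) \<in> eqcl R"
  shows "card (connected_components_of X) = num_classes N R"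
proof -
  have join: "(n \<in> N \<longleftrightarrow> n' \<in> N) \<and> (n \<in> N \<longrightarrow> (\<forall>a\<in>pts n. \<forall>b\<in>pts n'. connected_component_of X a b))"
    if "(n, n') \<in> eqcl R" for n n'
    using that
  proof (induction rule: eqcl_induct)
    case (refl n)
    then show ?case using pts by (auto simp: connected_component_of_def)
  next
    case (sym n n')
    then show ?case using connected_component_of_sym by metis
  next
    case (trans n n' n'')
    have "connected_component_of X a b" if h: "n \<in> N" "a \<in> pts n" "b \<in> pts n''" for a b
    proof -
      have n': "n' \<in> N" using trans(1) h(1) by simp
      obtain c where c: "c \<in> pts n'" using pts[OF n'] by auto
      have "connected_component_of X a c" using trans(1) h c by simp
      moreover have "connected_component_of X c b" using trans(2) n' h c by simp
      ultimately show ?thesis by (rule connected_component_of_trans)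
    qed
    then show ?case using trans by simp
  next
    case (base n n')
    have nN: "n \<in> N" "n' \<in> N" using base RN by auto
    obtain a b where ab: "a \<in> pts n" "b \<in> pts n'" "connected_component_of X a b" using edge[OF base] by blast
    have "connected_component_of X c d" if h: "c \<in> pts n" "d \<in> pts n'" for c d
    proof -
      have "connected_component_of X c a"
        unfolding connected_component_of_def by (rule exI[of _ "pts n"]) (use pts nN h ab in simp)
      moreover have "connected_component_of X b d"
        unfolding connected_component_of_def by (rule exI[of _ "pts n'"]) (use pts nN h ab in simp)
      ultimately show ?thesis using ab(3) connected_component_of_trans[of X] by blast
    qed
    then show ?case using nN by simp
  qed
  define lab where "lab i = eqcl R `` {f i}" for i
  have comp: "connected_component_of X a b" if i: "i \<in> I" "j \<in> I" "lab i = lab j" and ab: "a \<in> A i" "b \<in> A j" for i j a b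
  proof -
    have "(f i, f j) \<in> eqcl R" using i(3) unfolding lab_def eqcl_class_eq .
    obtain c d where cd: "c \<in> A i" "c \<in> pts (f i)" "d \<in> A j" "d \<in> pts (f j)"
      using near[OF i(1)] near[OF i(2)] by auto
    have "connected_component_of X c d" using join[OF \<open>(f i, f j) \<in> eqcl R\<close>] fN[OF i(1)] cd by simp
    moreover have "connected_component_of X a c"
      unfolding connected_component_of_def by (rule exI[of _ "A i"]) (use conn i ab cd in simp)
    moreover have "connected_component_of X d b"
      unfolding connected_component_of_def by (rule exI[of _ "A j"]) (use conn i ab cd in simp)
    ultimately show ?thesis using connected_component_of_trans[of X] by blast
  qed
  have ne: "A i \<noteq> {}" if "i \<in> I" for i using near[OF that] by blast
  \<comment> \<open>Distinct indices may give the same set, so the label of a set is read off at a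
    chosen index; equal nonempty sets meet, so every choice gives the same label.\<close>
  define L where "L B = lab (SOME i. i \<in> I \<and> A i = B)" for B
  have LA: "L (A i) = lab i" if i: "i \<in> I" for i
  proof -
    let ?k = "SOME k. k \<in> I \<and> A k = A i"
    have k: "?k \<in> I \<and> A ?k = A i" by (rule someI[of _ i]) (use i in simp)
    then have "A ?k \<inter> A i \<noteq> {}" using ne[OF i] by simp
    then have "(f ?k, f i) \<in> eqcl R" using meet k i by blast
    then show ?thesis unfolding L_def lab_def eqcl_class_eq .
  qed
  have "card (connected_components_of X) = card (L ` A ` I)"
  proof (rule card_connected_components_of_labels)
    show "finite (A ` I)" using fin by simp
    show "\<And>B. B \<in> A ` I \<Longrightarrow> closedin X B" using cl by blast
    show "\<Union> (A ` I) = topspace X" by (rule cov)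
    show "\<And>B. B \<in> A ` I \<Longrightarrow> B \<noteq> {}" using ne by blast
    show "L B = L B'" if B: "B \<in> A ` I" "B' \<in> A ` I" "B \<inter> B' \<noteq> {}" for B B'
    proof -
      obtain i j where ij: "i \<in> I" "j \<in> I" "B = A i" "B' = A j" using B by blast
      have "(f i, f j) \<in> eqcl R" using meet ij B(3) by blast
      then show ?thesis unfolding ij(3,4) LA[OF ij(1)] LA[OF ij(2)] lab_def eqcl_class_eq .
    qed
    show "\<exists>T. connectedin X T \<and> B \<union> B' \<subseteq> T" if B: "B \<in> A ` I" "B' \<in> A ` I" "L B = L B'" for B B'
    proof -
      obtain i j where ij: "i \<in> I" "j \<in> I" "B = A i" "B' = A j" using B by blast
      have "lab i = lab j" using B(3) unfolding ij(3,4) LA[OF ij(1)] LA[OF ij(2)] .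
      obtain a where a: "a \<in> A i" using ne[OF ij(1)] by blast
      have "A i \<union> A j \<subseteq> connected_component_of_set X a"
        using comp[OF ij(1) ij(1) refl a] comp[OF ij(1,2) \<open>lab i = lab j\<close> a] by blast
      then show ?thesis
        unfolding ij(3,4) by (intro exI[of _ "connected_component_of_set X a"] conjI connectedin_connected_component_of)
    qed
  qed
  also have "L ` A ` I = lab ` I" using LA by (auto simp: image_image)
  also have "lab ` I = (\<lambda>n. eqcl R `` {n}) ` N"
  proof
    show "lab ` I \<subseteq> (\<lambda>n. eqcl R `` {n}) ` N" using fN unfolding lab_def by blast
    show "(\<lambda>n. eqcl R `` {n}) ` N \<subseteq> lab ` I"
    proof
      fix C assume "C \<in> (\<lambda>n. eqcl R `` {n}) ` N"
      then obtain n where n: "n \<in> N" "C = eqcl R `` {n}" by blast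
      obtain i where i: "i \<in> I" "(f i, n) \<in> eqcl R" using all[OF n(1)] by blast
      have "lab i = C" unfolding lab_def n(2) eqcl_class_eq by (rule i(2))
      then show "C \<in> lab ` I" using i(1) by blast
    qed
  qed
  finally show ?thesis unfolding num_classes_def .
qed

lemma subtopology_eq_closed:
  assumes "closedin X S" "closedin Y S" "\<And>A. A \<subseteq> S \<Longrightarrow> closedin X A \<longleftrightarrow> closedin Y A"
  shows "subtopology X S = subtopology Y S"
proof -
  have top: "topspace (subtopology X S) = S" "topspace (subtopology Y S) = S"
    using assms(1,2) closedin_subset by auto
  have "closedin (subtopology X S) A \<longleftrightarrow> closedin (subtopology Y S) A" for A
    using assms by (auto simp: closedin_closed_subtopology)
  then have "openin (subtopology X S) A \<longleftrightarrow> openin (subtopology Y S) A" for A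
    unfolding openin_closedin_eq top by simp
  then show ?thesis by (simp add: topology_eq)
qed

lemma connectedin_subtopology_cong:
  "subtopology X S = subtopology Y S \<Longrightarrow> A \<subseteq> S \<Longrightarrow> connectedin X A \<longleftrightarrow> connectedin Y A"
  by (metis connectedin_subtopology)

lemma subtopology_cong_subset:
  "subtopology X S = subtopology Y S \<Longrightarrow> A \<subseteq> S \<Longrightarrow> subtopology X A = subtopology Y A"
  by (metis inf.absorb2 subtopology_subtopology)

section \<open>Consequences of the ribbon graph axioms\<close>

locale ribbon =
  fixes G :: "'a ribbon"
  assumes ribbon_graph: "ribbon_graph G"
begin

abbreviation "X \<equiv> surface G"
abbreviation "V \<equiv> vertices G"
abbreviation "E \<equiv> edges G"
abbreviation "\<Sigma> \<equiv> segments G"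

lemma Hausdorff: "Hausdorff_space X"
  using ribbon_graph by (simp add: ribbon_graph_def surface_with_boundary_def)

lemma ribbonD:
  "topspace X = \<Union>V \<union> \<Union>E" "finite V" "finite E" "\<And>D. D \<in> V \<union> E \<Longrightarrow> disc_in X D"
  "pairwise disjnt V" "pairwise disjnt E" "\<And>e. e \<in> E \<Longrightarrow> card {s \<in> \<Sigma>. s \<subseteq> e} = 2"
  "\<And>s. s \<in> \<Sigma> \<Longrightarrow> line_segment_in X s"
  "\<And>s. s \<in> \<Sigma> \<Longrightarrow> \<exists>v\<in>V. s \<subseteq> surface_boundary (subtopology X v)"
  "\<And>s. s \<in> \<Sigma> \<Longrightarrow> \<exists>e\<in>E. s \<subseteq> surface_boundary (subtopology X e)"
proof -
  note rg = ribbon_graph[unfolded ribbon_graph_def]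
  show "topspace X = \<Union>V \<union> \<Union>E" using rg by (elim conjE)
  show "finite V" using rg by (elim conjE)
  show "finite E" using rg by (elim conjE)
  show "pairwise disjnt V" using rg by (elim conjE)
  show "pairwise disjnt E" using rg by (elim conjE)
  have d: "\<forall>D\<in>V \<union> E. disc_in X D" using rg by (elim conjE)
  have c: "\<forall>e\<in>E. card {s \<in> \<Sigma>. s \<subseteq> e} = 2" using rg by (elim conjE)
  have s: "\<forall>s\<in>\<Sigma>. line_segment_in X s \<and>
        (\<exists>!v. v \<in> V \<and> s \<subseteq> surface_boundary (subtopology X v)) \<and>
        (\<exists>!e. e \<in> E \<and> s \<subseteq> surface_boundary (subtopology X e))"
    using rg by (elim conjE)
  show "disc_in X D" if "D \<in> V \<union> E" for D using d that by (rule bspec)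
  show "card {s \<in> \<Sigma>. s \<subseteq> e} = 2" if "e \<in> E" for e using c that by (rule bspec)
  fix t assume t: "t \<in> \<Sigma>"
  note st = bspec[OF s t]
  show "line_segment_in X t" using st by (rule conjunct1)
  show "\<exists>v\<in>V. t \<subseteq> surface_boundary (subtopology X v)"
    using ex1_implies_ex[OF conjunct1[OF conjunct2[OF st]]] unfolding Bex_def .
  show "\<exists>e\<in>E. t \<subseteq> surface_boundary (subtopology X e)"
    using ex1_implies_ex[OF conjunct2[OF conjunct2[OF st]]] unfolding Bex_def .
qed

lemma segments_pairwise_disjoint: "s \<in> \<Sigma> \<Longrightarrow> t \<in> \<Sigma> \<Longrightarrow> s \<noteq> t \<Longrightarrow> s \<inter> t = {}"
  unfolding segments_def using pairwise_disjoint_connected_components_of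
  by (metis disjnt_def pairwiseD)

lemma Union_segments: "\<Union>V \<inter> \<Union>E = \<Union>\<Sigma>"
proof -
  have "\<Union>\<Sigma> = topspace X \<inter> (\<Union>V \<inter> \<Union>E)"
    unfolding segments_def Union_connected_components_of by simp
  then show ?thesis using ribbonD(1) by blast
qed

lemma finite_segments: "finite \<Sigma>"
proof -
  have "s \<in> (\<Union>e\<in>E. {s \<in> \<Sigma>. s \<subseteq> e})" if s: "s \<in> \<Sigma>" for s
  proof -
    obtain e where "e \<in> E" "s \<subseteq> surface_boundary (subtopology X e)" using ribbonD(10)[OF s] by blast
    then show ?thesis using s by (auto simp: surface_boundary_flat)
  qed
  moreover have "finite (\<Union>e\<in>E. {s \<in> \<Sigma>. s \<subseteq> e})"
    using ribbonD(3,7) by (intro finite_UN_I) (auto intro: card_ge_0_finite)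
  ultimately show ?thesis by (meson finite_subset subsetI)
qed

sublocale disc_system X V E \<Sigma>
proof
  show "D \<in> V \<union> E \<Longrightarrow> closedin X D" for D
    using compactin_imp_closedin[OF Hausdorff disc_compactin[OF ribbonD(4)]] .
  show "s \<in> \<Sigma> \<Longrightarrow> closedin X s" for s
    using compactin_imp_closedin[OF Hausdorff line_segment_compactin_connectedin(1)[OF ribbonD(8)]] .
  show "v \<in> V \<Longrightarrow> v' \<in> V \<Longrightarrow> v \<noteq> v' \<Longrightarrow> v \<inter> v' = {}" for v v'
    using ribbonD(5) by (metis disjnt_def pairwiseD)
  show "e \<in> E \<Longrightarrow> e' \<in> E \<Longrightarrow> e \<noteq> e' \<Longrightarrow> e \<inter> e' = {}" for e e'
    using ribbonD(6) by (metis disjnt_def pairwiseD)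
qed (fact ribbonD finite_segments segments_pairwise_disjoint Union_segments)+

lemma segment_subset: "s \<in> \<Sigma> \<Longrightarrow> s \<subseteq> \<Union>V" "s \<in> \<Sigma> \<Longrightarrow> s \<subseteq> \<Union>E"
  using Union_segments by blast+

lemma edge_meets_V: "e \<in> E \<Longrightarrow> e \<inter> \<Union>V = \<Union>{s \<in> \<Sigma>. s \<subseteq> e}"
proof
  assume e: "e \<in> E"
  show "e \<inter> \<Union>V \<subseteq> \<Union>{s \<in> \<Sigma>. s \<subseteq> e}"
  proof
    fix x assume "x \<in> e \<inter> \<Union>V"
    then obtain v where v: "v \<in> V" "x \<in> v" "x \<in> e" by blast
    from meet_segment[OF v(1) e v(2,3)] obtain s where "s \<in> \<Sigma>" "x \<in> s" "s \<subseteq> bd v" "s \<subseteq> bd e" .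
    then show "x \<in> \<Union>{s \<in> \<Sigma>. s \<subseteq> e}" using bd_subset[of e] by blast
  qed
  show "\<Union>{s \<in> \<Sigma>. s \<subseteq> e} \<subseteq> e \<inter> \<Union>V" using segment_subset(1) by blast
qed

text \<open>Distinct vertices are disjoint, as are distinct edges, so a disc that meets the segment
  is the one on whose boundary the segment lies.\<close>

lemma segment_in_bd: 
  assumes "D \<in> V \<union> E" "s \<in> \<Sigma>" "s \<inter> D \<noteq> {}"
  shows "s \<subseteq> bd D"
proof -
  obtain v where v: "v \<in> V" "s \<subseteq> bd v" using segment_V[OF assms(2)] by blast
  obtain e where e: "e \<in> E" "s \<subseteq> bd e" using segment_E[OF assms(2)] by blast
  have "s \<subseteq> v" "s \<subseteq> e" using v e bd_subset by blast+
  then have "D \<in> V \<Longrightarrow> D = v" "D \<in> E \<Longrightarrow> D = e" using disjoint_V[of D v] disjoint_E[of D e] v e assms(3) by blast+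
  then show ?thesis using v e assms(1) by blast
qed

lemma segment_nonempty: "s \<in> \<Sigma> \<Longrightarrow> s \<noteq> {}"
  using line_segment_interior_nonempty[OF segment[of s]] by auto

lemma segment_subset_bd: "D \<in> V \<union> E \<Longrightarrow> s \<in> \<Sigma> \<Longrightarrow> s \<subseteq> D \<Longrightarrow> s \<subseteq> bd D"
  using segment_in_bd[of D s] segment_nonempty[of s] by (simp add: inf.absorb1)

end

section \<open>Regluing edges by maps that preserve segments\<close>

lemma UN_Union_Collect: "(\<Union>e\<in>A. \<Union>{s \<in> S. P s e}) = \<Union>{s \<in> S. \<exists>e\<in>A. P s e}"
  by blast

text \<open>The gluing maps are arbitrary homeomorphisms on each segment, half-twists being a
  special case. With \<open>E'\<close> deletion is treated at the same time: \<open>X1\<close> is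
  the reglued surface, and \<open>X2\<close> is what the kept edges leave of it.\<close>

locale reglued_ribbon = ribbon +
  fixes h :: "'a set \<Rightarrow> 'a \<Rightarrow> 'a" and E' :: "'a set set"
  assumes twist: "e \<in> E \<Longrightarrow> s \<in> \<Sigma> \<Longrightarrow> s \<subseteq> e \<Longrightarrow> homeomorphic_map (subtopology X s) (subtopology X s) (h e)"
    and fixed: "e \<in> E \<Longrightarrow> x \<notin> \<Union>{s \<in> \<Sigma>. s \<subseteq> e} \<Longrightarrow> h e x = x"
    and kept: "E' \<subseteq> E"
begin

abbreviation "X1 \<equiv> surface (reglue G h)"
abbreviation "X2 \<equiv> subtopology X1 (\<Union>V \<union> \<Union>E')"
abbreviation "\<Sigma>' \<equiv> {s \<in> \<Sigma>. \<exists>e\<in>E'. s \<subseteq> e}"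

lemma VX: "\<Union>V \<subseteq> topspace X" and EX: "\<Union>E \<subseteq> topspace X"
  using cover by blast+

lemma segment_topspace: "s \<in> \<Sigma> \<Longrightarrow> topspace (subtopology X s) = s"
  using closed_\<Sigma>[of s] closedin_subset[of X s] by auto

lemma h_segment:
  assumes "e \<in> E" "s \<in> \<Sigma>" "s \<subseteq> e"
  shows "h e ` s = s" "inj_on (h e) s"
  using homeomorphic_imp_surjective_map[OF twist[OF assms]] homeomorphic_imp_injective_map[OF twist[OF assms]]
    segment_topspace[OF assms(2)] by simp_all

lemma h_in_segment:
  assumes e: "e \<in> E" "s \<in> \<Sigma>" "s \<subseteq> e"
  shows "h e x \<in> s \<longleftrightarrow> x \<in> s"
proof (cases "x \<in> \<Union>{s \<in> \<Sigma>. s \<subseteq> e}")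
  case True
  then obtain t where t: "t \<in> \<Sigma>" "t \<subseteq> e" "x \<in> t" by blast
  have "h e x \<in> t" using h_segment(1)[OF e(1) t(1,2)] t(3) by blast
  then show ?thesis using segments_pairwise_disjoint[OF t(1) e(2)] t(3) by (cases "t = s") auto
next
  case False
  then show ?thesis using fixed[OF e(1) False] by simp
qed

lemma h_inj: assumes e: "e \<in> E" shows "inj (h e)"
proof (rule injI)
  fix x y assume eq: "h e x = h e y"
  show "x = y"
  proof (cases "\<exists>s. s \<in> \<Sigma> \<and> s \<subseteq> e \<and> x \<in> s")
    case True
    then obtain s where s: "s \<in> \<Sigma>" "s \<subseteq> e" "x \<in> s" by blast
    then have "y \<in> s" using h_in_segment[OF e s(1,2), of x] h_in_segment[OF e s(1,2), of y] eq by simp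
    then show ?thesis using h_segment(2)[OF e s(1,2)] eq s(3) by (simp add: inj_on_def)
  next
    case False
    then have "y \<notin> s" if "s \<in> \<Sigma>" "s \<subseteq> e" for s
      using h_in_segment[OF e that, of x] h_in_segment[OF e that, of y] eq that by auto
    then have "h e y = y" by (intro fixed[OF e]) blast
    moreover have "h e x = x" by (rule fixed[OF e]) (use False in blast)
    ultimately show ?thesis using eq by simp
  qed
qed

text \<open>\<open>h e\<close> moves points only within segments of \<open>e\<close>, so it
  preserves every set that contains each such segment wholly or misses it.\<close>

lemma h_invariant:
  assumes e: "e \<in> E" and A: "\<And>s. s \<in> \<Sigma> \<Longrightarrow> s \<subseteq> e \<Longrightarrow> s \<subseteq> A \<or> s \<inter> A = {}"
  shows "h e ` A = A"
proof
  show "h e ` A \<subseteq> A"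
  proof
    fix y assume "y \<in> h e ` A"
    then obtain x where x: "x \<in> A" "y = h e x" by blast
    show "y \<in> A"
    proof (cases "\<exists>s. s \<in> \<Sigma> \<and> s \<subseteq> e \<and> x \<in> s")
      case True
      then obtain s where s: "s \<in> \<Sigma>" "s \<subseteq> e" "x \<in> s" by blast
      then have "y \<in> s" using h_in_segment[OF e s(1,2)] x(2) by simp
      then show ?thesis using A[OF s(1,2)] s(3) x(1) by blast
    next
      case False
      then show ?thesis using fixed[OF e, of x] x by auto
    qed
  qed
  show "A \<subseteq> h e ` A"
  proof
    fix x assume x: "x \<in> A"
    show "x \<in> h e ` A"
    proof (cases "\<exists>s. s \<in> \<Sigma> \<and> s \<subseteq> e \<and> x \<in> s")
      case True
      then obtain s where s: "s \<in> \<Sigma>" "s \<subseteq> e" "x \<in> s" by blast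
      then have "s \<subseteq> A" using A x by blast
      then have "h e ` s \<subseteq> h e ` A" by (rule image_mono)
      then show ?thesis unfolding h_segment(1)[OF e s(1,2)] using s(3) by blast
    next
      case False
      then have "h e x = x" by (intro fixed[OF e]) blast
      then show ?thesis using x by (metis imageI)
    qed
  qed
qed

lemma h_edge: "e \<in> E \<Longrightarrow> h e ` e = e"
  by (rule h_invariant) auto

lemma h_in_edge: "e \<in> E \<Longrightarrow> h e x \<in> e \<longleftrightarrow> x \<in> e"
  using h_edge[of e] h_inj[of e] by (metis inj_image_mem_iff)

lemma topspace_X1: "topspace X1 = topspace X"
proof
  have "reglued_open G h (topspace X)"
    unfolding reglued_open_def
  proof (intro conjI ballI)
    show "openin (subtopology X (\<Union>V)) (topspace X \<inter> \<Union>V)" by (metis inf_commute openin_subtopology_Int openin_topspace)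
    fix e assume e: "e \<in> E"
    have "{x \<in> e. h e x \<in> topspace X} = topspace (subtopology X e)"
      using h_in_edge[OF e] e EX by auto
    then show "openin (subtopology X e) {x \<in> e. h e x \<in> topspace X}" by (metis openin_topspace)
  qed simp
  then have "openin X1 (topspace X)" by (simp add: openin_reglue)
  then show "topspace X \<subseteq> topspace X1" by (rule openin_subset)
  have "reglued_open G h (topspace X1)" using openin_topspace[of X1] by (simp only: openin_reglue)
  then show "topspace X1 \<subseteq> topspace X" by (simp add: reglued_open_def)
qed

lemma closed_UnV: "closedin X (\<Union>V)"
  using finite_V closed by (intro closedin_Union) auto

text \<open>Closed sets are tracked instead of open ones because the discs and segments are closed,
  so that being closed in one of them is the same as being closed in the surface.\<close>

lemma closedin_X1:
  "closedin X1 C \<longleftrightarrow> C \<subseteq> topspace X \<and> closedin X (C \<inter> \<Union>V) \<and> (\<forall>e\<in>E. closedin X {x \<in> e. h e x \<in> C})"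
proof (cases "C \<subseteq> topspace X")
  case True
  have tV: "topspace (subtopology X (\<Union>V)) = \<Union>V" using VX by auto
  have "openin (subtopology X (\<Union>V)) ((topspace X - C) \<inter> \<Union>V) \<longleftrightarrow> closedin X (C \<inter> \<Union>V)"
  proof -
    have "(topspace X - C) \<inter> \<Union>V = topspace (subtopology X (\<Union>V)) - C \<inter> \<Union>V" using tV VX by auto
    then have "openin (subtopology X (\<Union>V)) ((topspace X - C) \<inter> \<Union>V) \<longleftrightarrow> closedin (subtopology X (\<Union>V)) (C \<inter> \<Union>V)"
      unfolding closedin_def tV by simp
    then show ?thesis using closedin_closed_subtopology[OF closed_UnV] by simp
  qed
  moreover have "openin (subtopology X e) {x \<in> e. h e x \<in> topspace X - C} \<longleftrightarrow> closedin X {x \<in> e. h e x \<in> C}"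
    if e: "e \<in> E" for e
  proof -
    have te: "topspace (subtopology X e) = e" using EX e by auto
    have "{x \<in> e. h e x \<in> topspace X - C} = e - {x \<in> e. h e x \<in> C}"
      using h_in_edge[OF e] EX e by auto
    then have "openin (subtopology X e) {x \<in> e. h e x \<in> topspace X - C} \<longleftrightarrow> closedin (subtopology X e) {x \<in> e. h e x \<in> C}"
      unfolding closedin_def te by auto
    moreover have "closedin X e" using closed e by blast
    ultimately show ?thesis using closedin_closed_subtopology by auto
  qed
  ultimately show ?thesis
    using True unfolding closedin_def[of X1] topspace_X1 openin_reglue reglued_open_def by simp
next
  case False
  then show ?thesis using closedin_subset[of X1 C] topspace_X1 by auto
qed

lemma closedin_segment_preimage:
  assumes e: "e \<in> E" "s \<in> \<Sigma>" "s \<subseteq> e"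
  shows "closedin X {x \<in> s. h e x \<in> C} \<longleftrightarrow> closedin X (C \<inter> s)"
proof -
  have im: "h e ` {x \<in> s. h e x \<in> C} = C \<inter> s" using h_segment(1)[OF e] by auto
  have "closedin (subtopology X s) {x \<in> s. h e x \<in> C} \<longleftrightarrow> closedin (subtopology X s) (C \<inter> s)"
    using homeomorphic_map_closedness[OF twist[OF e], of "{x \<in> s. h e x \<in> C}"] segment_topspace[OF e(2)]
    unfolding im by auto
  then show ?thesis using closedin_closed_subtopology[OF closed_\<Sigma>[OF e(2)]] by simp
qed

lemma finite_segments_of: "finite {s \<in> \<Sigma>. s \<subseteq> e}"
  using finite_segments by simp

text \<open>An edge is glued into the vertices along its segments, on which \<open>h e\<close> is a
  homeomorphism; so gluing does not alter the topology on the vertex side.\<close>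

lemma closedin_X1_V:
  assumes C: "C \<subseteq> \<Union>V"
  shows "closedin X1 C \<longleftrightarrow> closedin X C"
proof
  have CV: "C \<inter> \<Union>V = C" using C by blast
  show "closedin X1 C \<Longrightarrow> closedin X C" unfolding closedin_X1 CV by blast
  assume cl: "closedin X C"
  have "closedin X {x \<in> e. h e x \<in> C}" if e: "e \<in> E" for e
  proof -
    have "{x \<in> e. h e x \<in> C} = (\<Union>s\<in>{s \<in> \<Sigma>. s \<subseteq> e}. {x \<in> s. h e x \<in> C})"
    proof (intro set_eqI iffI)
      fix x assume "x \<in> {x \<in> e. h e x \<in> C}"
      then have x: "x \<in> e" "h e x \<in> C" by auto
      then have "h e x \<in> \<Union>{s \<in> \<Sigma>. s \<subseteq> e}" using C h_in_edge[OF e] edge_meets_V[OF e] by blast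
      then obtain s where s: "s \<in> \<Sigma>" "s \<subseteq> e" "h e x \<in> s" by blast
      then have "x \<in> s" using h_in_segment[OF e s(1,2)] by simp
      then show "x \<in> (\<Union>s\<in>{s \<in> \<Sigma>. s \<subseteq> e}. {x \<in> s. h e x \<in> C})" using s x(2) by blast
    qed blast
    moreover have "closedin X (\<Union>s\<in>{s \<in> \<Sigma>. s \<subseteq> e}. {x \<in> s. h e x \<in> C})"
    proof (rule closedin_Union)
      show "finite ((\<lambda>s. {x \<in> s. h e x \<in> C}) ` {s \<in> \<Sigma>. s \<subseteq> e})" using finite_segments_of by simp
      fix A assume "A \<in> (\<lambda>s. {x \<in> s. h e x \<in> C}) ` {s \<in> \<Sigma>. s \<subseteq> e}"
      then obtain s where s: "s \<in> \<Sigma>" "s \<subseteq> e" "A = {x \<in> s. h e x \<in> C}" by blast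
      show "closedin X A" unfolding s(3) closedin_segment_preimage[OF e s(1,2)]
        using cl closed_\<Sigma>[OF s(1)] by (rule closedin_Int)
    qed
    ultimately show ?thesis by simp
  qed
  then show "closedin X1 C" unfolding closedin_X1 CV using cl closedin_subset[OF cl] by blast
qed

lemma closedin_X1_edge:
  assumes e: "e \<in> E" and C: "C \<subseteq> e"
  shows "closedin X1 C \<longleftrightarrow> closedin X {x \<in> e. h e x \<in> C}"
proof
  show "closedin X1 C \<Longrightarrow> closedin X {x \<in> e. h e x \<in> C}" unfolding closedin_X1 using e by blast
  assume cl: "closedin X {x \<in> e. h e x \<in> C}"
  have "C \<inter> \<Union>V = (\<Union>s\<in>{s \<in> \<Sigma>. s \<subseteq> e}. C \<inter> s)" using edge_meets_V[OF e] C by blast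
  moreover have "closedin X (\<Union>s\<in>{s \<in> \<Sigma>. s \<subseteq> e}. C \<inter> s)"
  proof (rule closedin_Union)
    show "finite ((\<lambda>s. C \<inter> s) ` {s \<in> \<Sigma>. s \<subseteq> e})" using finite_segments_of by simp
    fix A assume "A \<in> (\<lambda>s. C \<inter> s) ` {s \<in> \<Sigma>. s \<subseteq> e}"
    then obtain s where s: "s \<in> \<Sigma>" "s \<subseteq> e" "A = C \<inter> s" by blast
    have "{x \<in> s. h e x \<in> C} = {x \<in> e. h e x \<in> C} \<inter> s" using s(2) by blast
    then have "closedin X {x \<in> s. h e x \<in> C}" using closedin_Int[OF cl closed_\<Sigma>[OF s(1)]] by simp
    then show "closedin X A" unfolding s(3) closedin_segment_preimage[OF e s(1,2)] .
  qed
  ultimately have "closedin X (C \<inter> \<Union>V)" by simp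
  moreover have "closedin X {x \<in> e'. h e' x \<in> C}" if e': "e' \<in> E" for e'
  proof (cases "e' = e")
    case False
    then have "{x \<in> e'. h e' x \<in> C} = {}" using h_in_edge[OF e'] C disjoint_E[OF e' e] by blast
    then show ?thesis by (simp only: closedin_empty)
  qed (use cl in simp)
  ultimately show "closedin X1 C" unfolding closedin_X1 using C e EX by blast
qed

lemma subtopology_X1_V: "subtopology X1 (\<Union>V) = subtopology X (\<Union>V)"
proof (rule subtopology_eq_closed)
  show "closedin X1 (\<Union>V)" using closedin_X1_V[OF subset_refl] closed_UnV by simp
  show "closedin X (\<Union>V)" by (rule closed_UnV)
  show "closedin X1 A \<longleftrightarrow> closedin X A" if "A \<subseteq> \<Union>V" for A using that by (rule closedin_X1_V)
qed

lemma closedin_X1_self: "e \<in> E \<Longrightarrow> closedin X1 e"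
proof -
  assume e: "e \<in> E"
  have "{x \<in> e. h e x \<in> e} = e" using h_in_edge[OF e] by blast
  then show ?thesis using closedin_X1_edge[OF e subset_refl] closed[of e] e by simp
qed

text \<open>The point \<open>x\<close> of the detached disc is named \<open>h e x\<close> in the
  glued surface, so \<open>h e\<close> is the inclusion of that disc. It is the topology of
  \<open>X1\<close> that makes it continuous: as a map from \<open>e\<close> to itself in
  \<open>X\<close> it may jump along the segments.\<close>

lemma homeomorphic_map_h:
  assumes e: "e \<in> E"
  shows "homeomorphic_map (subtopology X e) (subtopology X1 e) (h e)"
proof (rule bijective_closed_imp_homeomorphic_map)
  have ce: "closedin X e" using closed e by blast
  have te: "topspace (subtopology X e) = e" "topspace (subtopology X1 e) = e"
    using EX e topspace_X1 by auto
  show "h e ` topspace (subtopology X e) = topspace (subtopology X1 e)" unfolding te by (rule h_edge[OF e])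
  show "inj_on (h e) (topspace (subtopology X e))" using h_inj[OF e] by (rule inj_on_subset) simp
  show "continuous_map (subtopology X e) (subtopology X1 e) (h e)"
    unfolding continuous_map_closedin te
  proof (intro conjI allI impI)
    show "h e \<in> e \<rightarrow> e" using h_in_edge[OF e] by simp
    fix C assume "closedin (subtopology X1 e) C"
    then have C: "closedin X1 C" "C \<subseteq> e" using closedin_closed_subtopology[OF closedin_X1_self[OF e]] by auto
    then show "closedin (subtopology X e) {x \<in> e. h e x \<in> C}"
      using closedin_X1_edge[OF e C(2)] closedin_closed_subtopology[OF ce] by auto
  qed
  show "closed_map (subtopology X e) (subtopology X1 e) (h e)"
    unfolding closed_map_def
  proof (intro allI impI)
    fix C assume "closedin (subtopology X e) C"
    then have C: "closedin X C" "C \<subseteq> e" using closedin_closed_subtopology[OF ce] by auto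
    have "{x \<in> e. h e x \<in> h e ` C} = C" using C(2) h_inj[OF e] by (auto simp: inj_image_mem_iff)
    moreover have sub: "h e ` C \<subseteq> e" using C(2) h_in_edge[OF e] by blast
    ultimately have "closedin X1 (h e ` C)" using closedin_X1_edge[OF e sub] C(1) by simp
    then show "closedin (subtopology X1 e) (h e ` C)"
      using closedin_closed_subtopology[OF closedin_X1_self[OF e]] sub by simp
  qed
qed

section \<open>The surface after regluing and deletion\<close>

lemma topspace_X2: "topspace X2 = \<Union>V \<union> \<Union>E'"
  using topspace_X1 cover kept by auto

lemma subtopology_X2: "A \<subseteq> \<Union>V \<union> \<Union>E' \<Longrightarrow> subtopology X2 A = subtopology X1 A"
  by (simp add: subtopology_subtopology inf.absorb2)

lemma subtopology_X2_V: "A \<subseteq> \<Union>V \<Longrightarrow> subtopology X2 A = subtopology X A"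
proof -
  assume A: "A \<subseteq> \<Union>V"
  then have "A \<subseteq> \<Union>V \<union> \<Union>E'" by blast
  then show ?thesis using subtopology_X2[of A] subtopology_cong_subset[OF subtopology_X1_V A] by simp
qed

lemma subtopology_X2_E: "e \<in> E' \<Longrightarrow> subtopology X2 e = subtopology X1 e"
  by (rule subtopology_X2) blast

lemma bd_X2_V: "v \<in> V \<Longrightarrow> surface_boundary (subtopology X2 v) = bd v"
  using subtopology_X2_V[of v] by (simp add: Union_upper)

lemma h_bd: "e \<in> E \<Longrightarrow> h e ` bd e = bd e"
  by (rule h_invariant) (simp_all add: segment_subset_bd)

lemma bd_X2_E: "e \<in> E' \<Longrightarrow> surface_boundary (subtopology X2 e) = bd e"
proof -
  assume e: "e \<in> E'"
  then have eE: "e \<in> E" using kept by blast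
  show ?thesis
    using surface_boundary_homeomorphic_map[OF homeomorphic_map_h[OF eE]] h_bd[OF eE] subtopology_X2_E[OF e] by simp
qed

lemma ends_X2:
  assumes s: "s \<in> \<Sigma>" shows "ends X2 s = ends X s"
proof -
  have "s - {p} \<subseteq> \<Union>V" for p using segment_subset(1)[OF s] by blast
  then have "connectedin X2 (s - {p}) \<longleftrightarrow> connectedin X (s - {p})" for p
    using connectedin_subtopology_cong[OF subtopology_X2_V[OF subset_refl]] by metis
  then show ?thesis by (simp add: ends_def)
qed

lemma disc_system_X2: "disc_system X2 V E' \<Sigma>'"
proof
  show "finite V" "finite E'" "finite \<Sigma>'"
    using finite_V finite_E finite_segments kept finite_subset by auto
  show "topspace X2 = \<Union>V \<union> \<Union>E'" by (rule topspace_X2)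
  show "disc_in X2 D" if D: "D \<in> V \<union> E'" for D
  proof -
    have DX: "D \<subseteq> topspace X2" unfolding topspace_X2 using D by blast
    have "subtopology X2 D homeomorphic_space subtopology X D"
    proof (cases "D \<in> V")
      case True
      then have "subtopology X2 D = subtopology X D" by (intro subtopology_X2_V) blast
      then show ?thesis by (simp add: homeomorphic_space_refl)
    next
      case False
      then have DE: "D \<in> E'" "D \<in> E" using D kept by auto
      have "subtopology X D homeomorphic_space subtopology X1 D"
        by (rule homeomorphic_map_imp_homeomorphic_space[OF homeomorphic_map_h[OF DE(2)]])
      then show ?thesis unfolding subtopology_X2_E[OF DE(1)] by (subst homeomorphic_space_sym)
    qed
    moreover have "D \<in> V \<union> E" using D kept by blast
    then have "disc_in X D" by (rule disc)
    then have "subtopology X D homeomorphic_space top_of_set (cball (0 :: complex) 1)"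
      unfolding disc_in_def by (rule conjunct2)
    ultimately have "subtopology X2 D homeomorphic_space top_of_set (cball (0 :: complex) 1)"
      by (rule homeomorphic_space_trans)
    with DX show ?thesis unfolding disc_in_def by (rule conjI)
  qed
  show "closedin X2 D" if D: "D \<in> V \<union> E'" for D
  proof (rule closedin_subset_topspace)
    show "D \<subseteq> \<Union>V \<union> \<Union>E'" using D by blast
    show "closedin X1 D"
    proof (cases "D \<in> V")
      case True
      then show ?thesis using closedin_X1_V[of D] closed[of D] by blast
    next
      case False
      then show ?thesis using closedin_X1_self[of D] D kept by blast
    qed
  qed
  show "v \<in> V \<Longrightarrow> v' \<in> V \<Longrightarrow> v \<noteq> v' \<Longrightarrow> v \<inter> v' = {}" for v v' by (rule disjoint_V)
  show "e \<in> E' \<Longrightarrow> e' \<in> E' \<Longrightarrow> e \<noteq> e' \<Longrightarrow> e \<inter> e' = {}" for e e' using disjoint_E[of e e'] kept by blast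
  show "s \<in> \<Sigma>' \<Longrightarrow> t \<in> \<Sigma>' \<Longrightarrow> s \<noteq> t \<Longrightarrow> s \<inter> t = {}" for s t using segments_pairwise_disjoint[of s t] by simp
  show "closedin X2 s" if s: "s \<in> \<Sigma>'" for s
  proof (rule closedin_subset_topspace)
    show "s \<subseteq> \<Union>V \<union> \<Union>E'" using s by blast
    show "closedin X1 s" using closedin_X1_V[OF segment_subset(1)[of s]] closed_\<Sigma>[of s] s by simp
  qed
  show "line_segment_in X2 s" if s: "s \<in> \<Sigma>'" for s
  proof -
    have "subtopology X2 s = subtopology X s" using subtopology_X2_V[OF segment_subset(1)[of s]] s by simp
    moreover have "s \<subseteq> topspace X2" unfolding topspace_X2 using s by blast
    ultimately show ?thesis using segment[of s] s unfolding line_segment_in_def by simp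
  qed
  show "\<exists>v\<in>V. s \<subseteq> surface_boundary (subtopology X2 v)" if s: "s \<in> \<Sigma>'" for s
    using segment_V[of s] s bd_X2_V by auto
  show "\<exists>e\<in>E'. s \<subseteq> surface_boundary (subtopology X2 e)" if s: "s \<in> \<Sigma>'" for s
  proof -
    obtain e where e: "e \<in> E'" "s \<subseteq> e" using s by blast
    then have "s \<subseteq> bd e" using segment_subset_bd[of e s] s kept by blast
    then show ?thesis using bd_X2_E[OF e(1)] e(1) by blast
  qed
  have "\<Union>V \<inter> \<Union>E' = (\<Union>e\<in>E'. e \<inter> \<Union>V)" by blast
  also have "\<dots> = (\<Union>e\<in>E'. \<Union>{s \<in> \<Sigma>. s \<subseteq> e})" 
    by (rule SUP_cong[OF refl], rule edge_meets_V) (use kept in blast)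
  also have "\<dots> = \<Union>\<Sigma>'" by (rule UN_Union_Collect)
  finally show "\<Union>V \<inter> \<Union>E' = \<Union>\<Sigma>'" .
qed

text \<open>The right-hand side does not mention \<open>h\<close>: regluing leaves the set of
  boundary points unchanged and alters only how the sides are attached at the corners.\<close>

theorem surface_boundary_X2:
  "surface_boundary X2 = (\<Union>D\<in>V \<union> E'. bd D) - (\<Union>s\<in>\<Sigma>'. s - ends X s)"
proof -
  have "(\<Union>D\<in>V \<union> E'. surface_boundary (subtopology X2 D)) = (\<Union>D\<in>V \<union> E'. bd D)"
    by (rule SUP_cong) (use bd_X2_V bd_X2_E in auto)
  moreover have "(\<Union>s\<in>\<Sigma>'. s - ends X2 s) = (\<Union>s\<in>\<Sigma>'. s - ends X s)"
    by (rule SUP_cong) (use ends_X2 in auto)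
  ultimately show ?thesis using disc_system.surface_boundary_eq[OF disc_system_X2] by simp
qed

end

section \<open>Corners and arcs of a ribbon graph\<close>

context ribbon
begin

definition segs :: "'a set \<Rightarrow> 'a set set" where
  "segs D = {s \<in> \<Sigma>. s \<subseteq> D}"

definition free :: "'a set \<Rightarrow> 'a set" where
  "free D = free_part X (bd D) (segs D)"

text \<open>For a vertex these are the nodes of the corner graph, for an edge its two sides.\<close>

definition arcs :: "'a set \<Rightarrow> 'a set set" where
  "arcs D = connected_components_of (subtopology X (free D))"

definition corners :: "'a set \<Rightarrow> 'a set" where
  "corners D = (\<Union>s\<in>segs D. ends X s)"

lemma free_subset: "free D \<subseteq> bd D"
  by (auto simp: free_def free_part_def)

lemma disc_subset_topspace: "D \<in> V \<union> E \<Longrightarrow> D \<subseteq> topspace X"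
  using cover by blast

lemma free_topspace: "D \<in> V \<union> E \<Longrightarrow> topspace (subtopology X (free D)) = free D"
  using disc_subset_topspace[of D] free_subset[of D] bd_subset[of D] by auto

lemma finite_segs: "finite (segs D)"
  using finite_segments by (simp add: segs_def)

lemma segs_bd: "D \<in> V \<union> E \<Longrightarrow> s \<in> segs D \<Longrightarrow> s \<subseteq> bd D"
  using segment_subset_bd by (simp add: segs_def)

lemma Union_arcs: "D \<in> V \<union> E \<Longrightarrow> \<Union>(arcs D) = free D"
  unfolding arcs_def Union_connected_components_of by (rule free_topspace)

lemma arc_connected: "K \<in> arcs D \<Longrightarrow> connectedin X K"
  using connectedin_connected_components_of[of K "subtopology X (free D)"] by (simp add: arcs_def connectedin_subtopology)

lemma arc_subset: "K \<in> arcs D \<Longrightarrow> K \<subseteq> free D"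
  using connectedin_connected_components_of[of K "subtopology X (free D)"] by (simp add: arcs_def connectedin_subtopology)

lemma arc_nonempty: "K \<in> arcs D \<Longrightarrow> K \<noteq> {}"
  unfolding arcs_def by (rule nonempty_connected_components_of)

lemma arcs_disjoint: "K \<in> arcs D \<Longrightarrow> L \<in> arcs D \<Longrightarrow> K \<noteq> L \<Longrightarrow> K \<inter> L = {}"
  unfolding arcs_def using pairwise_disjoint_connected_components_of by (metis disjnt_def pairwiseD)

lemma free_no_segs: "segs D = {} \<Longrightarrow> free D = bd D"
  by (simp add: free_def free_part_def)

text \<open>A vertex without edges still contributes a boundary circle; it becomes a node without
  corners.\<close>

lemma arcs_no_segs:
  assumes D: "D \<in> V \<union> E" and no: "segs D = {}"
  shows "arcs D = {bd D}"
proof -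
  have t: "topspace (subtopology X (bd D)) = bd D" using free_topspace[OF D] free_no_segs[OF no] by simp
  have "connected_space (subtopology X (bd D))"
    using disc_boundary_connectedin[OF disc[OF D]] by (simp add: connectedin_def)
  moreover have "bd D \<noteq> {}" by (rule disc_boundary_nonempty[OF disc[OF D]])
  then have "subtopology X (bd D) \<noteq> trivial_topology" using t by (metis null_topspace_iff_trivial)
  ultimately show ?thesis
    unfolding arcs_def free_no_segs[OF no] connected_components_of_eq_singleton t by simp
qed

lemma arc_facts:
  assumes D: "D \<in> V \<union> E" and s0: "s0 \<in> segs D" and K: "K \<in> arcs D"
  shows "compactin X K" "card (K \<inter> corners D) = 2" "segs D \<noteq> {s0} \<Longrightarrow> \<not> ends X s0 \<subseteq> K"
proof -
  have 1: "bd D \<subseteq> topspace X" using bd_subset[of D] disc_subset_topspace[OF D] by blast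
  have 2: "\<exists>\<rho>. homeomorphic_map (subtopology X (bd D - {c})) euclideanreal \<rho>" if "c \<in> bd D" for c
    using disc_boundary_chart[OF disc[OF D] that] by blast
  have 3: "line_segment_in X s \<and> s \<subseteq> bd D" if "s \<in> segs D" for s
    using segs_bd[OF D that] segment[of s] that by (simp add: segs_def)
  have 4: "s \<inter> t = {}" if "s \<in> segs D" "t \<in> segs D" "s \<noteq> t" for s t
    using segments_pairwise_disjoint[of s t] that by (simp add: segs_def)
  note * = free_part_component[OF Hausdorff 1 2 finite_segs[of D] 3 4 s0 K[unfolded arcs_def free_def]]
  show "compactin X K" using *(1) by simp
  show "card (K \<inter> corners D) = 2" unfolding corners_def using *(2) by simp
  show "segs D \<noteq> {s0} \<Longrightarrow> \<not> ends X s0 \<subseteq> K" using *(3) by simp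
qed

lemma arc_closed: "D \<in> V \<union> E \<Longrightarrow> K \<in> arcs D \<Longrightarrow> closedin X K"
proof (cases "segs D = {}")
  case True
  assume "D \<in> V \<union> E" "K \<in> arcs D"
  then show ?thesis
    using arcs_no_segs[OF _ True] compactin_imp_closedin[OF Hausdorff disc_boundary_compactin[OF disc]] by simp
next
  case False
  assume "D \<in> V \<union> E" "K \<in> arcs D"
  then show ?thesis using arc_facts(1) False compactin_imp_closedin[OF Hausdorff] by blast
qed

lemma arc_card_corners:
  assumes "D \<in> V \<union> E" "K \<in> arcs D"
  shows "card (K \<inter> corners D) \<in> {0, 2}"
proof (cases "segs D = {}")
  case True
  then show ?thesis by (simp add: corners_def)
next
  case False
  then show ?thesis using arc_facts(2) assms by blast
qed

lemma finite_corners: "finite (corners D)"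
proof -
  have "finite (ends X s)" if "s \<in> segs D" for s
    using line_segment_card_ends[OF segment[of s]] that by (simp add: segs_def card_ge_0_finite)
  then show ?thesis unfolding corners_def using finite_segs by blast
qed

text \<open>On a disc with segments, arcs are disjoint and each has two corners, so an arc is
  determined by its corners and there are finitely many of these.\<close>

lemma finite_arcs:
  assumes D: "D \<in> V \<union> E" shows "finite (arcs D)"
proof (cases "segs D = {}")
  case True
  then show ?thesis using arcs_no_segs[OF D] by simp
next
  case False
  then obtain s0 where s0: "s0 \<in> segs D" by blast
  have "inj_on (\<lambda>K. K \<inter> corners D) (arcs D)"
  proof (rule inj_onI, rule ccontr)
    fix K L assume K: "K \<in> arcs D" and L: "L \<in> arcs D" and eq: "K \<inter> corners D = L \<inter> corners D" and "K \<noteq> L"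
    then have "K \<inter> L = {}" using arcs_disjoint by simp
    then have "K \<inter> corners D = {}" using eq by blast
    then show False using arc_facts(2)[OF D s0 K] by simp
  qed
  moreover have "finite ((\<lambda>K. K \<inter> corners D) ` arcs D)"
    by (rule finite_subset[of _ "Pow (corners D)"]) (use finite_corners in auto)
  ultimately show ?thesis using finite_imageD by blast
qed

lemma end_in_free:
  assumes D: "D \<in> V \<union> E" and s: "s \<in> segs D" and p: "p \<in> ends X s"
  shows "p \<in> free D"
proof -
  have ps: "p \<in> s" by (rule subsetD[OF ends_subset p])
  have "p \<notin> t - ends X t" if t: "t \<in> segs D" for t
  proof (cases "t = s")
    case False
    then have "t \<inter> s = {}" using segments_pairwise_disjoint[of t s] s t by (simp add: segs_def)
    then show ?thesis using ps by blast
  qed (use p in simp)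
  moreover have "p \<in> bd D" using segs_bd[OF D s] ps by blast
  ultimately show ?thesis unfolding free_def free_part_def by simp
qed

text \<open>
  The corners \<open>c 0, c 2\<close> are the ends of one segment of \<open>e\<close>, the corners \<open>c 1, c 3\<close> those of the other,
  and the sides \<open>A\<close>, \<open>B\<close> of \<open>e\<close> run from \<open>c 0\<close> to \<open>c 1\<close> and from \<open>c 2\<close> to \<open>c 3\<close>.
\<close>

definition edge_frame :: "'a set \<Rightarrow> (nat \<Rightarrow> 'a) \<Rightarrow> 'a set \<Rightarrow> 'a set \<Rightarrow> 'a set \<Rightarrow> 'a set \<Rightarrow> bool" where
  "edge_frame e c s t A B \<longleftrightarrow>
     segs e = {s, t} \<and> s \<noteq> t \<and> ends X s = {c 0, c 2} \<and> ends X t = {c 1, c 3} \<and> inj_on c {..<4} \<and>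
     arcs e = {A, B} \<and> A \<noteq> B \<and> A \<inter> corners e = {c 0, c 1} \<and> B \<inter> corners e = {c 2, c 3}"

text \<open>Each arc has two corners, and no arc contains both ends of \<open>s\<close> as there is
  a second segment. So the arcs that start at the two ends of \<open>s\<close> lead to the two ends
  of \<open>t\<close>, which are numbered accordingly.\<close>

lemma edge_frame_exists:
  assumes e: "e \<in> E"
  shows "\<exists>c s t A B. edge_frame e c s t A B"
proof -
  have D: "e \<in> V \<union> E" using e by blast
  have "card (segs e) = 2" using ribbonD(7)[OF e] by (simp add: segs_def)
  then obtain s t where st: "segs e = {s, t}" "s \<noteq> t" by (auto simp: card_2_iff)
  have sS: "s \<in> segs e" "t \<in> segs e" "s \<in> \<Sigma>" "t \<in> \<Sigma>" using st by (auto simp: segs_def)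
  have disj: "s \<inter> t = {}" by (rule segments_pairwise_disjoint[OF sS(3,4) st(2)])
  obtain p1 q1 where pq: "ends X s = {p1, q1}" "p1 \<noteq> q1"
    using line_segment_card_ends[OF segment[OF sS(3)]] by (auto simp: card_2_iff)
  obtain x y where xy: "ends X t = {x, y}" "x \<noteq> y"
    using line_segment_card_ends[OF segment[OF sS(4)]] by (auto simp: card_2_iff)
  have dis: "{p1, q1} \<inter> {x, y} = {}" using ends_subset[of X s] ends_subset[of X t] pq xy disj by auto
  have "corners e = ends X s \<union> ends X t" unfolding corners_def st(1) by simp
  then have cor: "corners e = {p1, q1, x, y}" unfolding pq(1) xy(1) by auto
  have "p1 \<in> free e" "q1 \<in> free e" using end_in_free[OF D sS(1)] pq by auto
  then obtain A B where AB: "A \<in> arcs e" "p1 \<in> A" "B \<in> arcs e" "q1 \<in> B"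
    unfolding Union_arcs[OF D, symmetric] by blast
  have "\<not> ends X s \<subseteq> A" using arc_facts(3)[OF D sS(1) AB(1)] st by auto
  then have "A \<noteq> B" using AB pq by auto
  then have ABd: "A \<inter> B = {}" using arcs_disjoint AB by blast
  have cA: "card (A \<inter> corners e) = 2" and cB: "card (B \<inter> corners e) = 2"
    using arc_facts(2)[OF D sS(1)] AB by auto
  obtain a where a: "A \<inter> corners e = {p1, a}" "a \<noteq> p1"
  proof -
    have "p1 \<in> A \<inter> corners e" using AB cor by simp
    moreover obtain u w where "A \<inter> corners e = {u, w}" "u \<noteq> w" using cA by (auto simp: card_2_iff)
    ultimately show thesis using that[of u] that[of w] by auto
  qed
  obtain b where b: "B \<inter> corners e = {q1, b}" "b \<noteq> q1"
  proof -
    have "q1 \<in> B \<inter> corners e" using AB cor by simp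
    moreover obtain u w where "B \<inter> corners e = {u, w}" "u \<noteq> w" using cB by (auto simp: card_2_iff)
    ultimately show thesis using that[of u] that[of w] by auto
  qed
  have mem: "a \<in> A" "a \<in> corners e" "b \<in> B" "b \<in> corners e" using a(1) b(1) by blast+
  have "a \<noteq> q1" "b \<noteq> p1" "a \<noteq> b" using mem AB ABd by blast+
  then have axy: "a \<in> {x, y}" "b \<in> {x, y}" using mem(2,4) a(2) b(2) unfolding cor by auto
  then have xy': "{x, y} = {a, b}" using \<open>a \<noteq> b\<close> xy(2) by auto
  have arcs2: "arcs e = {A, B}"
  proof
    show "arcs e \<subseteq> {A, B}"
    proof
      fix K assume K: "K \<in> arcs e"
      have "card (K \<inter> corners e) = 2" by (rule arc_facts(2)[OF D sS(1) K])
      then have "K \<inter> corners e \<noteq> {}" by auto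
      then obtain z where z: "z \<in> K" "z \<in> corners e" by blast
      then have "z \<in> {p1, q1, a, b}" unfolding cor using xy' by blast
      then have "z \<in> A \<or> z \<in> B" using AB mem by blast
      then show "K \<in> {A, B}" using arcs_disjoint[OF K AB(1)] arcs_disjoint[OF K AB(3)] z(1) by blast
    qed
  qed (use AB in blast)
  \<comment> \<open>Even numbers go to \<open>s\<close>, odd ones to \<open>t\<close>, and each side
    joins an even number to its successor.\<close>
  define c :: "nat \<Rightarrow> 'a" where "c = (\<lambda>i. if i = 0 then p1 else if i = 1 then a else if i = 2 then q1 else b)"
  have c: "c 0 = p1" "c 1 = a" "c 2 = q1" "c 3 = b" by (simp_all add: c_def)
  have "inj_on c {..<4}"
  proof -
    have "{..<4::nat} = {0, 1, 2, 3}" by auto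
    moreover have "inj_on c {0, 1, 2, 3}"
      using c pq(2) a(2) b(2) \<open>a \<noteq> q1\<close> \<open>b \<noteq> p1\<close> \<open>a \<noteq> b\<close> unfolding inj_on_def by (simp; metis)
    ultimately show ?thesis by simp
  qed
  then have "edge_frame e c s t A B"
    unfolding edge_frame_def c using st pq(1) xy(1) xy' arcs2 \<open>A \<noteq> B\<close> a(1) b(1) by simp
  then show ?thesis by blast
qed

section \<open>The corner graph of a ribbon graph\<close>

definition cor :: "'a set \<Rightarrow> nat \<Rightarrow> 'a" where
  "cor e = (SOME c. \<exists>s t A B. edge_frame e c s t A B)"

lemma edge_frame_cor: "e \<in> E \<Longrightarrow> \<exists>s t A B. edge_frame e (cor e) s t A B"
  unfolding cor_def by (rule someI_ex[OF edge_frame_exists])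

definition nodes :: "'a set set" where
  "nodes = (\<Union>v\<in>V. arcs v)"

definition node :: "'a \<Rightarrow> 'a set" where
  "node p = (SOME n. n \<in> nodes \<and> p \<in> n)"

definition nd :: "'a set \<Rightarrow> nat \<Rightarrow> 'a set" where
  "nd e i = node (cor e i)"

lemma node_in_V: "v \<in> V \<Longrightarrow> K \<in> arcs v \<Longrightarrow> K \<subseteq> v"
  using arc_subset[of K v] free_subset[of v] bd_subset[of v] by blast

lemma nodes_disjoint: "m \<in> nodes \<Longrightarrow> n \<in> nodes \<Longrightarrow> m \<noteq> n \<Longrightarrow> m \<inter> n = {}"
proof -
  assume m: "m \<in> nodes" and n: "n \<in> nodes" and mn: "m \<noteq> n"
  obtain v where v: "v \<in> V" "m \<in> arcs v" using m by (auto simp: nodes_def)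
  obtain w where w: "w \<in> V" "n \<in> arcs w" using n by (auto simp: nodes_def)
  show ?thesis
  proof (cases "v = w")
    case True
    then show ?thesis using arcs_disjoint v w mn by blast
  next
    case False
    then show ?thesis using disjoint_V[OF v(1) w(1)] node_in_V[OF v] node_in_V[OF w] by blast
  qed
qed

lemma finite_nodes: "finite nodes"
  unfolding nodes_def using finite_V finite_arcs by blast

lemma node_eqI: "n \<in> nodes \<Longrightarrow> p \<in> n \<Longrightarrow> node p = n"
proof -
  assume n: "n \<in> nodes" "p \<in> n"
  have "node p \<in> nodes \<and> p \<in> node p" unfolding node_def by (rule someI[of _ n]) (use n in simp)
  then show ?thesis using nodes_disjoint[of "node p" n] n by blast
qed

lemma cor_in_ends:
  assumes e: "e \<in> E" and i: "i < 4"
  obtains s where "s \<in> \<Sigma>" "s \<subseteq> e" "cor e i \<in> ends X s"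
proof -
  obtain s t A B where f: "edge_frame e (cor e) s t A B" using edge_frame_cor[OF e] by blast
  have "s \<in> segs e" "t \<in> segs e" using f by (auto simp: edge_frame_def)
  then have st: "s \<in> \<Sigma>" "s \<subseteq> e" "t \<in> \<Sigma>" "t \<subseteq> e" by (auto simp: segs_def)
  have "i = 0 \<or> i = 1 \<or> i = 2 \<or> i = 3" using i by auto
  then have "cor e i \<in> ends X s \<or> cor e i \<in> ends X t" using f unfolding edge_frame_def by auto
  then show thesis using that st by blast
qed

lemma cor_node:
  assumes e: "e \<in> E" and i: "i < 4"
  shows "nd e i \<in> nodes" "cor e i \<in> nd e i"
proof -
  obtain s where s: "s \<in> \<Sigma>" "s \<subseteq> e" "cor e i \<in> ends X s" using cor_in_ends[OF e i] .
  obtain v where v: "v \<in> V" "s \<subseteq> bd v" using segment_V[OF s(1)] by blast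
  then have "s \<in> segs v" using s(1) bd_subset[of v] by (auto simp: segs_def)
  then have "cor e i \<in> free v" using end_in_free[of v s] v(1) s(3) by blast
  then obtain n where n: "n \<in> arcs v" "cor e i \<in> n" using Union_arcs[of v] v(1) by blast
  then have nn: "n \<in> nodes" using v(1) by (auto simp: nodes_def)
  show "nd e i \<in> nodes" "cor e i \<in> nd e i" unfolding nd_def node_eqI[OF nn n(2)] using nn n by auto
qed

lemma nd_eq_iff: "e \<in> E \<Longrightarrow> i < 4 \<Longrightarrow> n \<in> nodes \<Longrightarrow> nd e i = n \<longleftrightarrow> cor e i \<in> n"
  using cor_node[of e i] node_eqI[of n "cor e i"] by (auto simp: nd_def)

lemma cor_image:
  assumes e: "e \<in> E"
  shows "cor e ` {..<4} = corners e"
proof -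
  obtain s t A B where f: "edge_frame e (cor e) s t A B" using edge_frame_cor[OF e] by blast
  have "corners e = {cor e 0, cor e 2} \<union> {cor e 1, cor e 3}"
    using f unfolding corners_def edge_frame_def by auto
  moreover have "{..<4::nat} = {0, 1, 2, 3}" by auto
  ultimately show ?thesis by auto
qed

lemma corners_subset: "corners D \<subseteq> D"
  unfolding corners_def segs_def using ends_subset[of X] by blast

lemma cor_inj: "inj_on (\<lambda>(e, i). cor e i) (E \<times> {..<4})"
proof (rule inj_onI, clarsimp)
  fix e i e' i' assume e: "e \<in> E" "e' \<in> E" and i: "i < 4" "i' < (4::nat)" and eq: "cor e i = cor e' i'"
  have "cor e i \<in> e" "cor e' i' \<in> e'" using cor_image e i corners_subset by blast+
  then have "e = e'" using disjoint_E[OF e] eq by auto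
  moreover obtain s t A B where "edge_frame e (cor e) s t A B" using edge_frame_cor[OF e(1)] by blast
  then have "inj_on (cor e) {..<4}" by (simp add: edge_frame_def)
  ultimately show "e = e' \<and> i = i'" using eq i by (simp add: inj_on_def)
qed

lemma all_corners: "(\<lambda>(e, i). cor e i) ` (E \<times> {..<4}) = (\<Union>s\<in>\<Sigma>. ends X s)"
proof -
  have "(\<lambda>(e, i). cor e i) ` (E \<times> {..<4}) = (\<Union>e\<in>E. cor e ` {..<4})" by auto
  also have "\<dots> = (\<Union>e\<in>E. corners e)" using cor_image by simp
  also have "\<dots> = (\<Union>s\<in>\<Sigma>. ends X s)"
  proof
    show "(\<Union>e\<in>E. corners e) \<subseteq> (\<Union>s\<in>\<Sigma>. ends X s)" by (auto simp: corners_def segs_def)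
    show "(\<Union>s\<in>\<Sigma>. ends X s) \<subseteq> (\<Union>e\<in>E. corners e)"
    proof
      fix p assume "p \<in> (\<Union>s\<in>\<Sigma>. ends X s)"
      then obtain s where s: "s \<in> \<Sigma>" "p \<in> ends X s" by blast
      obtain e where e: "e \<in> E" "s \<subseteq> bd e" using segment_E[OF s(1)] by blast
      then have "s \<in> segs e" using s(1) bd_subset[of e] by (auto simp: segs_def)
      then show "p \<in> (\<Union>e\<in>E. corners e)" using s(2) e(1) by (auto simp: corners_def)
    qed
  qed
  finally show ?thesis .
qed

text \<open>Different edges and indices have different corners as points, so the sum counts the
  points of \<open>n\<close> that are ends of segments. These are the corners of the vertex on this
  arc, and there are zero or two of them.\<close>

lemma node_hits:
  assumes n: "n \<in> nodes"
  shows "(\<Sum>e\<in>E. \<Sum>i<4. of_bool (nd e i = n)) \<in> {0, 2::nat}"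
proof -
  obtain v where v: "v \<in> V" "n \<in> arcs v" using n by (auto simp: nodes_def)
  let ?P = "{p \<in> E \<times> {..<4::nat}. (\<lambda>(e, i). cor e i) p \<in> n}"
  have "(\<Sum>e\<in>E. \<Sum>i<4. of_bool (nd e i = n)) = (\<Sum>e\<in>E. \<Sum>i<4. (of_bool (cor e i \<in> n) :: nat))"
    by (intro sum.cong refl) (use nd_eq_iff n in auto)
  also have "\<dots> = (\<Sum>p\<in>E \<times> {..<4}. of_bool ((\<lambda>(e, i). cor e i) p \<in> n))"
    unfolding sum.cartesian_product by (intro sum.cong refl) auto
  also have "\<dots> = card ?P"
    using finite_E by (simp add: Int_def)
  also have "\<dots> = card ((\<lambda>(e, i). cor e i) ` ?P)"
    by (rule card_image[symmetric], rule inj_on_subset[OF cor_inj]) auto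
  also have "(\<lambda>(e, i). cor e i) ` ?P = n \<inter> (\<lambda>(e, i). cor e i) ` (E \<times> {..<4})" by auto
  also have "\<dots> = n \<inter> corners v"
  proof -
    have "p \<in> corners v" if p: "p \<in> n" "p \<in> ends X s" "s \<in> \<Sigma>" for p s
    proof -
      have "p \<in> s \<inter> v" using p ends_subset[of X s] node_in_V[OF v] by blast
      then have "s \<subseteq> bd v" using segment_in_bd[of v s] v(1) p(3) by blast
      then show ?thesis using p bd_subset[of v] by (auto simp: corners_def segs_def)
    qed
    moreover have "corners v \<subseteq> (\<Union>s\<in>\<Sigma>. ends X s)" by (auto simp: corners_def segs_def)
    ultimately show ?thesis unfolding all_corners by blast
  qed
  finally show ?thesis using arc_card_corners[of v n] v by simp
qed

sublocale corner_graph nodes E nd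
  by unfold_locales (use finite_nodes finite_E cor_node node_hits in auto)

end

section \<open>Counting components\<close>

context ribbon
begin

lemma rel_empty_related:
  assumes "e \<in> E" "i < 4" "j < 4"
  shows "(nd e i, nd e j) \<in> eqcl (rel {})"
proof -
  have 0: "(nd e 0, nd e k) \<in> eqcl (rel {})" if k: "k < 4" for k
  proof (cases "k = 0")
    case False
    then have "(nd e 0, nd e k) \<in> star e" using k by (auto simp: star_def less_4_cases)
    then have "(nd e 0, nd e k) \<in> rel {}" using assms(1) unfolding rel_def by blast
    then show ?thesis by (rule eqcl_base)
  qed simp
  show ?thesis using eqcl_trans[OF eqcl_sym[OF 0[OF assms(2)]] 0[OF assms(3)]] .
qed

lemma end_is_corner:
  assumes e: "e \<in> E" and s: "s \<in> segs e" and p: "p \<in> ends X s"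
  obtains i where "i < 4" "p = cor e i"
proof -
  have "p \<in> corners e" using s p by (auto simp: corners_def)
  then have "p \<in> cor e ` {..<4}" using cor_image[OF e] by simp
  then show thesis using that by auto
qed

lemma segs_edge:
  assumes "s \<in> \<Sigma>" obtains e where "e \<in> E" "s \<in> segs e"
proof -
  obtain e where "e \<in> E" "s \<subseteq> bd e" using segment_E[OF assms] by blast
  then show thesis using that[of e] assms bd_subset[of e] by (auto simp: segs_def)
qed

text \<open>The circle of \<open>v\<close> is connected and covered by its arcs and segments.
  Crossing a segment leads from one of its ends to the other, and both are corners of one edge,
  hence related in the undecided state; so all arcs carry the same label.\<close>

lemma vertex_arcs_related:
  assumes v: "v \<in> V" and KL: "M \<in> arcs v" "L \<in> arcs v"
  shows "(M, L) \<in> eqcl (rel {})"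
proof -
  have D: "v \<in> V \<union> E" using v by blast
  let ?Y = "subtopology X (bd v)"
  have tY: "topspace ?Y = bd v" using bd_subset[of v] disc_subset_topspace[OF D] by auto
  let ?R = "rel {}"
  \<comment> \<open>A segment gets the class of the node at one of its ends, and
    \<open>lab_seg\<close> shows that either end gives this class. The cases do not overlap, since
    no segment is an arc.\<close>
  define lab where "lab P = (if P \<in> arcs v then eqcl ?R `` {P} else eqcl ?R `` {node (SOME p. p \<in> ends X P)})" for P
  have seg_not_arc: "s \<notin> arcs v" if s: "s \<in> segs v" for s
  proof
    assume "s \<in> arcs v"
    then have "s \<subseteq> free v" by (rule arc_subset)
    moreover have "s - ends X s \<noteq> {}"
      using line_segment_interior_nonempty[OF segment[of s]] s by (simp add: segs_def)
    ultimately show False using s unfolding free_def free_part_def by blast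
  qed
  have lab_seg: "lab s = eqcl ?R `` {node p}" if s: "s \<in> segs v" and p: "p \<in> ends X s" for s p
  proof -
    have sS: "s \<in> \<Sigma>" using s by (simp add: segs_def)
    obtain e where e: "e \<in> E" "s \<in> segs e" using segs_edge[OF sS] .
    let ?q = "SOME p. p \<in> ends X s"
    have q: "?q \<in> ends X s" by (rule someI[of _ p]) (rule p)
    obtain i where i: "i < 4" "p = cor e i" using end_is_corner[OF e p] .
    obtain j where j: "j < 4" "?q = cor e j" using end_is_corner[OF e q] .
    have "(node ?q, node p) \<in> eqcl ?R"
      using rel_empty_related[OF e(1) j(1) i(1)] unfolding nd_def i(2)[symmetric] j(2)[symmetric] .
    then show ?thesis unfolding lab_def using seg_not_arc[OF s] by (simp add: eqcl_class_eq)
  qed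
  have mixed: "lab A = lab s" if A: "A \<in> arcs v" and s: "s \<in> segs v" and x: "x \<in> A" "x \<in> s" for A s x
  proof -
    have "x \<in> free v" using arc_subset[OF A] x by blast
    then have "x \<in> ends X s" using s x(2) unfolding free_def free_part_def by blast
    moreover have "node x = A" by (rule node_eqI) (use A v x in \<open>auto simp: nodes_def\<close>)
    ultimately show ?thesis using lab_seg[OF s] A by (simp add: lab_def)
  qed
  have "lab M = lab L"
  proof (rule connected_label_constant[of ?Y "arcs v \<union> segs v"])
    show "connected_space ?Y" using disc_boundary_connectedin[OF disc[OF D]] by (simp add: connectedin_def)
    show "finite (arcs v \<union> segs v)" using finite_arcs[OF D] finite_segs by simp
    show "closedin ?Y A" if A: "A \<in> arcs v \<union> segs v" for A
    proof (rule closedin_subset_topspace)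
      show "closedin X A" using A arc_closed[OF D, of A] closed_\<Sigma>[of A] by (auto simp: segs_def)
      show "A \<subseteq> bd v" using A arc_subset[of A v] free_subset[of v] segs_bd[OF D, of A] by blast
    qed
    have "\<Union>(arcs v \<union> segs v) = free v \<union> \<Union>(segs v)" using Union_arcs[OF D] by simp
    also have "\<dots> = bd v"
    proof
      show "free v \<union> \<Union>(segs v) \<subseteq> bd v" using free_subset segs_bd[OF D] by blast
      show "bd v \<subseteq> free v \<union> \<Union>(segs v)" unfolding free_def free_part_def by blast
    qed
    finally show "\<Union>(arcs v \<union> segs v) = topspace ?Y" unfolding tY .
    show "A \<noteq> {}" if "A \<in> arcs v \<union> segs v" for A
      using that arc_nonempty[of A v] segment_nonempty[of A] by (auto simp: segs_def)
    show "M \<in> arcs v \<union> segs v" "L \<in> arcs v \<union> segs v" using KL by auto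
    fix A B assume A: "A \<in> arcs v \<union> segs v" and B: "B \<in> arcs v \<union> segs v" and "A \<inter> B \<noteq> {}"
    then obtain x where x: "x \<in> A" "x \<in> B" by blast
    consider "A \<in> arcs v" "B \<in> arcs v" | "A \<in> arcs v" "B \<in> segs v" | "A \<in> segs v" "B \<in> arcs v"
      | "A \<in> segs v" "B \<in> segs v" using A B by auto
    then show "lab A = lab B"
    proof cases
      case 1
      then show ?thesis using arcs_disjoint[OF 1] x by blast
    next
      case 2
      then show ?thesis using mixed x by simp
    next
      case 3
      then show ?thesis using mixed[OF 3(2,1) x(2,1)] by simp
    next
      case 4
      then have "A = B" using segments_pairwise_disjoint[of A B] x by (auto simp: segs_def)
      then show ?thesis by simp
    qed
  qed
  then show ?thesis using KL by (simp add: lab_def eqcl_class_eq)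
qed

lemma arc_at_corner:
  assumes v: "v \<in> V" and e: "e \<in> E" "i < 4" and p: "cor e i \<in> v"
  shows "nd e i \<in> arcs v"
proof -
  obtain w where w: "w \<in> V" "nd e i \<in> arcs w" using cor_node(1)[OF e] by (auto simp: nodes_def)
  have "cor e i \<in> w" using node_in_V[OF w] cor_node(2)[OF e] by blast
  then have "w = v" using disjoint_V[OF w(1) v] p by blast
  then show ?thesis using w by simp
qed

lemma arcs_exist: "v \<in> V \<Longrightarrow> arcs v \<noteq> {}"
proof -
  assume v: "v \<in> V"
  then have D: "v \<in> V \<union> E" by blast
  have "free v \<noteq> {}"
  proof (cases "segs v = {}")
    case True
    then show ?thesis using free_no_segs[OF True] disc_boundary_nonempty[OF disc[OF D]] by simp
  next
    case False
    then obtain s where s: "s \<in> segs v" by blast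
    then have "card (ends X s) = 2" using line_segment_card_ends[OF segment[of s]] by (simp add: segs_def)
    then obtain p where "p \<in> ends X s" by fastforce
    then show ?thesis using end_in_free[OF D s] by blast
  qed
  then show ?thesis using Union_arcs[OF D] by auto
qed

text \<open>The pieces are the discs themselves. A vertex is represented by any of its arcs, all of
  which are related, and an edge by the node at its corner 0; a vertex and an edge that meet share a
  segment, whose ends are corners of that edge.\<close>

theorem num_components_eq: "num_components G = K {}"
  unfolding num_components_def K_def
proof (rule card_connected_components_of_graph)
  define f :: "'a set + 'a set \<Rightarrow> 'a set" where
    "f = case_sum (\<lambda>v. SOME n. n \<in> arcs v) (\<lambda>e. nd e 0)"
  let ?A = "case_sum (\<lambda>v. v) (\<lambda>e. e) :: 'a set + 'a set \<Rightarrow> 'a set"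
  let ?I = "Inl ` V \<union> Inr ` E"
  have fV: "f (Inl v) \<in> arcs v" if v: "v \<in> V" for v
    unfolding f_def using some_in_eq[of "arcs v"] arcs_exist[OF v] by simp
  have fE: "f (Inr e) = nd e 0" for e by (simp add: f_def)
  show "finite ?I" using finite_V finite_E by simp
  show "closedin X (?A i)" if "i \<in> ?I" for i using that closed by auto
  show "connectedin X (?A i)" if "i \<in> ?I" for i using that disc_connectedin[OF disc] by auto
  show "(\<Union>i\<in>?I. ?A i) = topspace X" unfolding cover by auto
  show "rel {} \<subseteq> nodes \<times> nodes" by (rule rel_subset[OF partial_empty])
  show "f i \<in> nodes" if "i \<in> ?I" for i
    using that fV fE cor_node(1) by (auto simp: nodes_def)
  have ve: "(f (Inl v), f (Inr e)) \<in> eqcl (rel {})" if ve: "v \<in> V" "e \<in> E" and x: "x \<in> v" "x \<in> e" for v e x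
  proof -
    obtain s where s: "s \<in> \<Sigma>" "x \<in> s" "s \<subseteq> bd v" "s \<subseteq> bd e" using meet_segment[OF ve x] .
    have "card (ends X s) = 2" by (rule line_segment_card_ends[OF segment[OF s(1)]])
    then obtain p where p: "p \<in> ends X s" by fastforce
    have se: "s \<in> segs e" using s bd_subset[of e] by (auto simp: segs_def)
    obtain i where i: "i < 4" "p = cor e i" using end_is_corner[OF ve(2) se p] .
    have "p \<in> v" using p ends_subset[of X s] s(3) bd_subset[of v] by blast
    then have "nd e i \<in> arcs v" using arc_at_corner[OF ve i(1)] i(2) by simp
    then have "(f (Inl v), nd e i) \<in> eqcl (rel {})" using vertex_arcs_related[OF ve(1) fV[OF ve(1)]] by simp
    moreover have "(nd e i, f (Inr e)) \<in> eqcl (rel {})" unfolding fE using rel_empty_related[OF ve(2) i(1)] by simp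
    ultimately show ?thesis by (rule eqcl_trans)
  qed
  show "(f i, f j) \<in> eqcl (rel {})" if i: "i \<in> ?I" and j: "j \<in> ?I" and ij: "?A i \<inter> ?A j \<noteq> {}" for i j
  proof -
    obtain x where x: "x \<in> ?A i" "x \<in> ?A j" using ij by blast
    consider v w where "i = Inl v" "j = Inl w" "v \<in> V" "w \<in> V" | v e where "i = Inl v" "j = Inr e" "v \<in> V" "e \<in> E"
      | e v where "i = Inr e" "j = Inl v" "v \<in> V" "e \<in> E" | e d where "i = Inr e" "j = Inr d" "e \<in> E" "d \<in> E"
      using i j by blast
    then show ?thesis
    proof cases
      case (1 v w)
      then have "v = w" using disjoint_V[of v w] x by auto
      then show ?thesis using 1 by simp
    next
      case (2 v e)
      then show ?thesis using ve[of v e x] x by simp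
    next
      case (3 e v)
      then show ?thesis using eqcl_sym[OF ve[of v e x]] x by simp
    next
      case (4 e d)
      then have "e = d" using disjoint_E[of e d] x by auto
      then show ?thesis using 4 by simp
    qed
  qed
  show "n \<noteq> {} \<and> connectedin X n" if "n \<in> nodes" for n
    using that arc_nonempty arc_connected by (auto simp: nodes_def)
  show "?A i \<inter> f i \<noteq> {}" if "i \<in> ?I" for i
  proof (cases i)
    case (Inl v)
    then have v: "v \<in> V" using that by auto
    then show ?thesis using node_in_V[OF v fV[OF v]] arc_nonempty[OF fV[OF v]] Inl by auto
  next
    case (Inr e)
    then have e: "e \<in> E" using that by auto
    have "cor e 0 \<in> corners e" using cor_image[OF e] by auto
    then have "cor e 0 \<in> e" using corners_subset by blast
    moreover have "cor e 0 \<in> nd e 0" using cor_node(2)[OF e] by simp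
    ultimately show ?thesis using Inr fE by auto
  qed
  show "\<exists>a\<in>n. \<exists>b\<in>n'. connected_component_of X a b" if nn: "(n, n') \<in> rel {}" for n n'
  proof -
    obtain e where e: "e \<in> E" "(n, n') \<in> star e" using nn by (auto simp: rel_def)
    then have "n = nd e 0" "n' \<in> nd e ` {1, 2, 3}" by (auto simp: star_def)
    then obtain j where "n = nd e 0" "j \<in> {1, 2, 3}" "n' = nd e j" by blast
    moreover define i :: nat where "i = 0"
    ultimately have ij: "i < 4" "j < 4" "n = nd e i" "n' = nd e j" by auto
    have c: "cor e i \<in> e" "cor e j \<in> e" using cor_image[OF e(1)] corners_subset[of e] ij by blast+
    have "connectedin X e" using disc_connectedin[OF disc] e(1) by simp
    then have "connected_component_of X (cor e i) (cor e j)" using c by (auto simp: connected_component_of_def)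
    then show ?thesis using cor_node(2)[OF e(1)] ij by blast
  qed
  show "\<exists>i\<in>?I. (f i, n) \<in> eqcl (rel {})" if n: "n \<in> nodes" for n
  proof -
    obtain v where v: "v \<in> V" "n \<in> arcs v" using n by (auto simp: nodes_def)
    then have "(f (Inl v), n) \<in> eqcl (rel {})" using vertex_arcs_related[OF v(1) fV[OF v(1)] v(2)] by simp
    then show ?thesis using v(1) by blast
  qed
qed

section \<open>Half-twists and the corners they exchange\<close>

lemma half_twist_exists: assumes e: "e \<in> E" shows "\<exists>h. half_twist G e h"
proof -
  obtain s where s: "s \<in> \<Sigma>" "s \<subseteq> e"
  proof -
    have "{s \<in> \<Sigma>. s \<subseteq> e} \<noteq> {}" using ribbonD(7)[OF e] by force
    then show thesis using that by blast
  qed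
  obtain \<gamma> where g: "homeomorphic_map (top_of_set {0..1 :: real}) (subtopology X s) \<gamma>" "\<gamma> ` {0..1} = s" "inj_on \<gamma> {0..1}"
    using line_segment_param[OF segment[OF s(1)]] by metis
  define h where "h x = (if x \<in> s then \<gamma> (1 - inv_into {0..1} \<gamma> x) else x)" for x
  have "h (\<gamma> t) = \<gamma> (1 - t)" if t: "t \<in> {0..1}" for t
    using g(2) imageI[OF t, of \<gamma>] inv_into_f_f[OF g(3) t] by (simp add: h_def)
  moreover have "\<forall>x. x \<notin> s \<longrightarrow> h x = x" by (simp add: h_def)
  ultimately have "half_twist G e h" unfolding half_twist_def using s g(1) by blast
  then show ?thesis by (intro exI[of _ h])
qed

text \<open>On the twisted segment the map is \<open>u \<mapsto> 1 - u\<close> in the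
  parametrisation, a continuous involution and so its own inverse; the other segments are fixed
  pointwise.\<close>

lemma half_twist_homeomorphic:
  assumes e: "e \<in> E" and h: "half_twist G e h" and t: "t \<in> \<Sigma>" "t \<subseteq> e"
  shows "homeomorphic_map (subtopology X t) (subtopology X t) h"
proof -
  obtain s \<gamma> where s: "s \<in> \<Sigma>" "s \<subseteq> e"
    and g: "homeomorphic_map (top_of_set {0..1 :: real}) (subtopology X s) \<gamma>"
    and hg: "\<forall>t\<in>{0..1}. h (\<gamma> t) = \<gamma> (1 - t)" and hid: "\<forall>x. x \<notin> s \<longrightarrow> h x = x"
    using h unfolding half_twist_def by blast
  show ?thesis
  proof (cases "t = s")
    case True
    have ts: "topspace (subtopology X s) = s" using closedin_subset[OF closed_\<Sigma>[OF s(1)]] by auto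
    obtain k where k: "homeomorphic_maps (top_of_set {0..1 :: real}) (subtopology X s) \<gamma> k"
      using g homeomorphic_map_maps by blast
    have k1: "continuous_map (top_of_set {0..1 :: real}) (subtopology X s) \<gamma>"
      "continuous_map (subtopology X s) (top_of_set {0..1 :: real}) k"
      "\<And>x. x \<in> s \<Longrightarrow> \<gamma> (k x) = x"
      using k unfolding homeomorphic_maps_def ts by auto
    have k2: "k x \<in> {0..1}" if "x \<in> s" for x
      using continuous_map_image_subset_topspace[OF k1(2)] that ts by auto
    have hk: "h x = \<gamma> (1 - k x)" if "x \<in> s" for x
      using bspec[OF hg k2[OF that]] k1(3)[OF that] by simp
    have g01: "\<gamma> u \<in> s" if "u \<in> {0..1}" for u
      using continuous_map_image_subset_topspace[OF k1(1)] that ts by auto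
    have "continuous_map (top_of_set {0..1}) (top_of_set {0..1}) (\<lambda>u. 1 - u :: real)"
      by (auto simp: continuous_map_in_subtopology intro!: continuous_intros)
    then have "continuous_map (subtopology X s) (subtopology X s) (\<gamma> \<circ> (\<lambda>u. 1 - u) \<circ> k)"
      using k1(1,2) by (intro continuous_map_compose)
    then have cont: "continuous_map (subtopology X s) (subtopology X s) h"
      by (rule continuous_map_eq) (use hk ts in auto)
    have inv: "h (h x) = x" if x: "x \<in> s" for x
    proof -
      have "1 - k x \<in> {0..1}" using k2[OF x] by auto
      then have "h (\<gamma> (1 - k x)) = \<gamma> (1 - (1 - k x))" using hg by blast
      then show ?thesis using hk[OF x] k1(3)[OF x] by simp
    qed
    have "homeomorphic_maps (subtopology X s) (subtopology X s) h h"
      unfolding homeomorphic_maps_def using cont inv ts by auto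
    then show ?thesis unfolding True using homeomorphic_map_maps by blast
  next
    case False
    then have "t \<inter> s = {}" using segments_pairwise_disjoint[OF t(1) s(1)] by simp
    then have "\<And>x. x \<in> topspace (subtopology X t) \<Longrightarrow> id x = h x" using hid by auto
    moreover have "homeomorphic_map (subtopology X t) (subtopology X t) id" by simp
    ultimately show ?thesis using homeomorphic_map_eq by blast
  qed
qed

lemma half_twist_fixed:
  assumes "half_twist G e h" "x \<notin> \<Union>{s \<in> \<Sigma>. s \<subseteq> e}"
  shows "h x = x"
  using assms unfolding half_twist_def by blast

text \<open>Exchanging 0 with 2, or 1 with 3, turns the sides 0-1 and 2-3 into 0-3 and 1-2, only in
  a different order. So the pairing is the same whichever end is twisted.\<close>

lemma half_twist_corners:
  assumes e: "e \<in> E" and h: "half_twist G e h" and f: "edge_frame e c s t A B"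
  shows "h ` {c 0, c 1} = {c 0, c 3} \<and> h ` {c 2, c 3} = {c 1, c 2} \<or>
         h ` {c 0, c 1} = {c 1, c 2} \<and> h ` {c 2, c 3} = {c 0, c 3}"
proof -
  obtain u \<gamma> where u: "u \<in> \<Sigma>" "u \<subseteq> e"
    and g: "homeomorphic_map (top_of_set {0..1 :: real}) (subtopology X u) \<gamma>"
    and hg: "\<forall>t\<in>{0..1}. h (\<gamma> t) = \<gamma> (1 - t)" and hid: "\<forall>x. x \<notin> u \<longrightarrow> h x = x"
    using h unfolding half_twist_def by blast
  have st: "segs e = {s, t}" "s \<noteq> t" "ends X s = {c 0, c 2}" "ends X t = {c 1, c 3}"
    using f by (simp_all add: edge_frame_def)
  then have "s \<in> segs e" "t \<in> segs e" by auto
  then have stS: "s \<in> \<Sigma>" "t \<in> \<Sigma>" by (simp_all add: segs_def)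
  have disj: "s \<inter> t = {}" by (rule segments_pairwise_disjoint[OF stS st(2)])
  have uX: "u \<subseteq> topspace X" by (rule closedin_subset[OF closed_\<Sigma>[OF u(1)]])
  have eu: "ends X u = {\<gamma> 0, \<gamma> 1}"
    using ends_homeomorphic_map[OF g _ uX] by (simp add: ends_interval)
  have h01: "h (\<gamma> 0) = \<gamma> 1" "h (\<gamma> 1) = \<gamma> 0" using bspec[OF hg, of 0] bspec[OF hg, of 1] by simp_all
  have swap: "h a = b \<and> h b = a" if "ends X u = {a, b}" for a b
    using eu h01 that by (metis doubleton_eq_iff)
  have "u \<in> segs e" using u by (simp add: segs_def)
  then have "u = s \<or> u = t" using st by auto
  then show ?thesis
  proof
    assume us: "u = s"
    have "c 1 \<notin> u" "c 3 \<notin> u" using st(4) ends_subset[of X t] disj us by auto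
    then have "h (c 1) = c 1" "h (c 3) = c 3" using hid by auto
    moreover have "h (c 0) = c 2" "h (c 2) = c 0" using swap[of "c 0" "c 2"] st(3) us by auto
    ultimately show ?thesis by auto
  next
    assume ut: "u = t"
    have "c 0 \<notin> u" "c 2 \<notin> u" using st(3) ends_subset[of X s] disj ut by auto
    then have "h (c 0) = c 0" "h (c 2) = c 2" using hid by auto
    moreover have "h (c 1) = c 3" "h (c 3) = c 1" using swap[of "c 1" "c 3"] st(4) ut by auto
    ultimately show ?thesis by auto
  qed
qed

end

text \<open>The two pairs of a matching as index pairs, told apart by a Boolean, so that each can be
  assigned its own piece of the boundary.\<close>

fun strand :: "'e decorated \<Rightarrow> bool \<Rightarrow> nat \<times> nat" where
  "strand (Dot e) j = (if j then (0, 1) else (2, 3))"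
| "strand (Bar e) j = (if j then (0, 2) else (1, 3))"
| "strand (Hat e) j = (if j then (0, 3) else (1, 2))"

lemma strand_less: "fst (strand x j) < 4" "snd (strand x j) < 4"
  by (cases x; simp)+

lemma (in corner_graph) matching_strand:
  "matching x = (\<lambda>j. (nd (base_edge x) (fst (strand x j)), nd (base_edge x) (snd (strand x j)))) ` UNIV"
  by (cases x) (auto simp: UNIV_bool)

lemma (in corner_graph) rel_transversal:
  "base_edge ` T = E \<Longrightarrow> rel T = (\<Union>x\<in>T. matching x)"
  by (simp add: rel_def)

context reglued_ribbon
begin

section \<open>Boundary pieces of the reglued surface\<close>

lemma closedin_X2_V: "A \<subseteq> \<Union>V \<Longrightarrow> closedin X A \<Longrightarrow> closedin X2 A"
  by (rule closedin_subset_topspace) (simp_all add: closedin_X1_V le_supI1)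

lemma connectedin_X2_V: "A \<subseteq> \<Union>V \<Longrightarrow> connectedin X A \<Longrightarrow> connectedin X2 A"
  using connectedin_subtopology_cong[OF subtopology_X2_V[OF subset_refl]] by blast

lemma closedin_X2_h:
  assumes e: "e \<in> E'" and A: "A \<subseteq> e" "closedin X A"
  shows "closedin X2 (h e ` A)"
proof (rule closedin_subset_topspace)
  have eE: "e \<in> E" using e kept by blast
  have "closedin (subtopology X e) A" using A by (rule closedin_subset_topspace[rotated])
  then have "closedin (subtopology X1 e) (h e ` A)"
    using homeomorphic_map_closedness_eq[OF homeomorphic_map_h[OF eE]] by blast
  then show "closedin X1 (h e ` A)"
    using closedin_closed_subtopology[OF closedin_X1_self[OF eE]] by simp
  show "h e ` A \<subseteq> \<Union>V \<union> \<Union>E'" using A(1) h_edge[OF eE] e by blast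
qed

lemma connectedin_X2_h:
  assumes e: "e \<in> E'" and A: "A \<subseteq> e" "connectedin X A"
  shows "connectedin X2 (h e ` A)"
proof -
  have eE: "e \<in> E" using e kept by blast
  have "connectedin (subtopology X e) A" using A by (simp add: connectedin_subtopology)
  then have "connectedin (subtopology X1 e) (h e ` A)"
    using homeomorphic_map_connectedness_eq[OF homeomorphic_map_h[OF eE]] by blast
  then have "connectedin X1 (h e ` A)" by (simp add: connectedin_subtopology)
  moreover have "h e ` A \<subseteq> \<Union>V \<union> \<Union>E'" using A(1) h_edge[OF eE] e by blast
  ultimately show ?thesis by (simp add: connectedin_subtopology)
qed

lemma h_ends:
  assumes "e \<in> E" "s \<in> segs e" shows "h e ` ends X s = ends X s"
proof -
  have s: "s \<in> \<Sigma>" "s \<subseteq> e" using assms(2) by (auto simp: segs_def)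
  have "s \<subseteq> topspace X" by (rule closedin_subset[OF closed_\<Sigma>[OF s(1)]])
  then show ?thesis using ends_homeomorphic_map[OF twist[OF assms(1) s]] by simp
qed

lemma h_corners: "e \<in> E \<Longrightarrow> h e ` corners e = corners e"
  unfolding corners_def image_UN using h_ends by simp

lemma h_free:
  assumes e: "e \<in> E" shows "h e ` free e = free e"
proof -
  have "h e ` (\<Union>s\<in>segs e. s - ends X s) = (\<Union>s\<in>segs e. h e ` s - h e ` ends X s)"
    using h_inj[OF e] by (simp add: image_UN image_set_diff)
  also have "\<dots> = (\<Union>s\<in>segs e. s - ends X s)"
    by (rule SUP_cong) (use h_ends[OF e] h_segment(1)[OF e] in \<open>auto simp: segs_def\<close>)
  finally show ?thesis
    unfolding free_def free_part_def image_set_diff[OF h_inj[OF e]] h_bd[OF e] by simp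
qed

end

locale transversal_ribbon = reglued_ribbon +
  fixes T :: "'a set decorated set"
  assumes partial_T: "partial T" and full_T: "base_edge ` T = E"
    and kept_eq: "E' = {e \<in> E. Bar e \<notin> T}"
    and untwisted: "Dot e \<in> T \<Longrightarrow> h e = id"
    and twisted: "Hat e \<in> T \<Longrightarrow> half_twist G e (h e)"
begin

text \<open>The part of the boundary contributed by one edge: a deleted edge exposes its two
  segments on the vertex circles, a kept one brings its two sides.\<close>

definition strands_of :: "'a set decorated \<Rightarrow> 'a set" where
  "strands_of x = (case x of Bar e \<Rightarrow> \<Union>(segs e) | _ \<Rightarrow> free (base_edge x))"

lemma T_unique: "x \<in> T \<Longrightarrow> y \<in> T \<Longrightarrow> base_edge x = base_edge y \<Longrightarrow> x = y"
  using partial_T unfolding partial_def by (meson inj_onD)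

lemma T_edge: "x \<in> T \<Longrightarrow> base_edge x \<in> E"
  unfolding full_T[symmetric] by (rule imageI)

lemma kept_iff: "x \<in> T \<Longrightarrow> base_edge x \<in> E' \<longleftrightarrow> x \<noteq> Bar (base_edge x)"
  using T_unique[of x "Bar (base_edge x)"] T_edge[of x] unfolding kept_eq by auto

lemma segs_V: "s \<in> segs e \<Longrightarrow> s \<subseteq> \<Union>V"
  using segment_subset(1)[of s] by (simp add: segs_def)

text \<open>For a deleted edge the pieces are its segments. Otherwise they are the images of the two
  sides under \<open>h e\<close>, which embeds the detached disc; their corners are the images of
  the old corners, and a half-twist permutes these into the pairing of \<open>Hat\<close>.\<close>

lemma pieces_exist:
  assumes x: "x \<in> T"
  shows "\<exists>P :: bool \<Rightarrow> 'a set. (\<forall>j. closedin X2 (P j) \<and> connectedin X2 (P j) \<and>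
      P j \<inter> corners (base_edge x) = {cor (base_edge x) (fst (strand x j)), cor (base_edge x) (snd (strand x j))}) \<and>
      P True \<inter> P False = {} \<and> P True \<union> P False = strands_of x"
proof -
  define e where "e = base_edge x"
  have e: "e \<in> E" using T_edge[OF x] by (simp add: e_def)
  have D: "e \<in> V \<union> E" using e by blast
  obtain s t A B where f: "edge_frame e (cor e) s t A B" using edge_frame_cor[OF e] by blast
  let ?c = "cor e"
  have st: "segs e = {s, t}" "s \<noteq> t" "ends X s = {?c 0, ?c 2}" "ends X t = {?c 1, ?c 3}"
    and AB: "arcs e = {A, B}" "A \<noteq> B" "A \<inter> corners e = {?c 0, ?c 1}" "B \<inter> corners e = {?c 2, ?c 3}"
    using f by (simp_all add: edge_frame_def)
  have stg: "s \<in> segs e" "t \<in> segs e" using st by auto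
  then have stS: "s \<in> \<Sigma>" "t \<in> \<Sigma>" by (simp_all add: segs_def)
  have disj: "s \<inter> t = {}" by (rule segments_pairwise_disjoint[OF stS st(2)])
  have "corners e = ends X s \<union> ends X t" unfolding corners_def st(1) by simp
  show ?thesis
  proof (cases "x = Bar e")
    case True
    define P where "P j = (if j then s else t)" for j
    have "s \<inter> corners e = ends X s" "t \<inter> corners e = ends X t"
      unfolding \<open>corners e = ends X s \<union> ends X t\<close> using ends_subset[of X s] ends_subset[of X t] disj by auto
    then have "P j \<inter> corners e = {?c (fst (strand x j)), ?c (snd (strand x j))}" for j
      unfolding True P_def using st by simp
    moreover have "closedin X2 (P j) \<and> connectedin X2 (P j)" for j
    proof -
      have "P j \<in> segs e" using stg by (simp add: P_def)
      then have "P j \<in> \<Sigma>" "P j \<subseteq> \<Union>V" using segs_V by (auto simp: segs_def)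
      then show ?thesis
        using closedin_X2_V closed_\<Sigma> connectedin_X2_V line_segment_compactin_connectedin(2)[OF segment] by simp
    qed
    moreover have "P True \<inter> P False = {}" "P True \<union> P False = strands_of x"
      unfolding P_def True strands_of_def using disj st(1) by auto
    ultimately show ?thesis unfolding e_def[symmetric] by blast
  next
    case False
    have eE': "e \<in> E'" using kept_iff[OF x] False by (simp add: e_def)
    have free: "strands_of x = free e" unfolding strands_of_def e_def using False by (cases x) (auto simp: e_def)
    have sub: "A \<subseteq> e" "B \<subseteq> e" using AB(1) arc_subset[of _ e] free_subset[of e] bd_subset[of e] by blast+
    have hA: "closedin X2 (h e ` A)" "connectedin X2 (h e ` A)" "closedin X2 (h e ` B)" "connectedin X2 (h e ` B)"
      using closedin_X2_h[OF eE'] connectedin_X2_h[OF eE'] sub arc_closed[OF D] arc_connected[of _ e] AB(1) by simp_all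
    have hd: "h e ` A \<inter> h e ` B = {}"
      using arcs_disjoint[of A e B] AB(1,2) image_Int[OF h_inj[OF e], of A B] by simp
    have hu: "h e ` A \<union> h e ` B = free e"
      using Union_arcs[OF D] AB(1) h_free[OF e] by (simp add: image_Un[symmetric])
    have hc: "h e ` A \<inter> corners e = h e ` {?c 0, ?c 1}" "h e ` B \<inter> corners e = h e ` {?c 2, ?c 3}"
      using image_Int[OF h_inj[OF e], of A "corners e"] image_Int[OF h_inj[OF e], of B "corners e"]
        h_corners[OF e] AB(3,4) by simp_all
    \<comment> \<open>For a half-twist it depends on the twisted end which side carries which pair,
      so only the unordered pair of sides is fixed.\<close>
    have "\<exists>Q R. {Q, R} = {h e ` A, h e ` B} \<and> Q \<inter> corners e = {?c (fst (strand x True)), ?c (snd (strand x True))} \<and>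
        R \<inter> corners e = {?c (fst (strand x False)), ?c (snd (strand x False))}"
    proof (cases "x = Dot e")
      case True
      then have "h e = id" using untwisted x by blast
      then have "h e ` A \<inter> corners e = {?c 0, ?c 1}" "h e ` B \<inter> corners e = {?c 2, ?c 3}" using hc by simp_all
      then show ?thesis unfolding True by (intro exI[of _ "h e ` A"] exI[of _ "h e ` B"]) simp
    next
      case not_Dot: False
      have xH: "x = Hat e" using False not_Dot by (cases x) (auto simp: e_def)
      then have "half_twist G e (h e)" using twisted x by blast
      from half_twist_corners[OF e this f] show ?thesis
      proof
        assume *: "h e ` {?c 0, ?c 1} = {?c 0, ?c 3} \<and> h e ` {?c 2, ?c 3} = {?c 1, ?c 2}"
        show ?thesis unfolding xH using hc * by (intro exI[of _ "h e ` A"] exI[of _ "h e ` B"]) simp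
      next
        assume *: "h e ` {?c 0, ?c 1} = {?c 1, ?c 2} \<and> h e ` {?c 2, ?c 3} = {?c 0, ?c 3}"
        show ?thesis unfolding xH using hc * by (intro exI[of _ "h e ` B"] exI[of _ "h e ` A"]) (simp add: insert_commute)
      qed
    qed
    then obtain Q R where QR: "{Q, R} = {h e ` A, h e ` B}"
      "Q \<inter> corners e = {?c (fst (strand x True)), ?c (snd (strand x True))}"
      "R \<inter> corners e = {?c (fst (strand x False)), ?c (snd (strand x False))}" by blast
    have QR': "Q = h e ` A \<and> R = h e ` B \<or> Q = h e ` B \<and> R = h e ` A" using QR(1) by (simp add: doubleton_eq_iff)
    define P where "P j = (if j then Q else R)" for j
    have "closedin X2 (P j) \<and> connectedin X2 (P j)" for j using QR' hA by (auto simp: P_def)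
    moreover have "P j \<inter> corners e = {?c (fst (strand x j)), ?c (snd (strand x j))}" for j
      using QR(2,3) by (cases j) (simp_all add: P_def)
    moreover have "P True \<inter> P False = {}" using QR' hd by (auto simp: P_def)
    moreover have "P True \<union> P False = strands_of x" unfolding free using QR' hu by (auto simp: P_def)
    ultimately show ?thesis unfolding e_def[symmetric] by blast
  qed
qed

lemma strands_subset: "x \<in> T \<Longrightarrow> strands_of x \<subseteq> base_edge x"
  using free_subset[of "base_edge x"] bd_subset[of "base_edge x"]
  by (cases x) (auto simp: strands_of_def segs_def)

text \<open>An inner point of a segment lies on the boundary exactly if its edge is deleted; the
  rest of the boundary consists of the arcs of the vertices and of the kept edges.\<close>

lemma boundary_decomposition:
  "surface_boundary X2 = \<Union>nodes \<union> (\<Union>x\<in>T. strands_of x)"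
proof (intro set_eqI iffI)
  fix p assume "p \<in> surface_boundary X2"
  then have p1: "p \<in> (\<Union>D\<in>V \<union> E'. bd D)" and p2: "\<And>s. s \<in> \<Sigma>' \<Longrightarrow> p \<notin> s - ends X s"
    unfolding surface_boundary_X2 by blast+
  obtain D where D: "D \<in> V \<union> E'" "p \<in> bd D" using p1 by blast
  show "p \<in> \<Union>nodes \<union> (\<Union>x\<in>T. strands_of x)"
  proof (cases "D \<in> V")
    case True
    show ?thesis
    proof (cases "\<exists>s\<in>segs D. p \<in> s - ends X s")
      case True
      then obtain s where s: "s \<in> segs D" "p \<in> s - ends X s" by blast
      then have sS: "s \<in> \<Sigma>" by (simp add: segs_def)
      \<comment> \<open>\<open>p\<close> is inside a segment and yet on the boundary, so the edge at
        that segment has been deleted.\<close>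
      obtain e where e: "e \<in> E" "s \<in> segs e" using segs_edge[OF sS] .
      have "s \<notin> \<Sigma>'" using p2 s(2) by blast
      then have "e \<notin> E'" using e(2) sS by (auto simp: segs_def)
      then have "Bar e \<in> T" using e(1) unfolding kept_eq by blast
      moreover have "p \<in> strands_of (Bar e)" using e(2) s(2) by (auto simp: strands_of_def)
      ultimately show ?thesis by blast
    next
      case False
      then have "p \<in> free D" using D(2) unfolding free_def free_part_def by blast
      then have "p \<in> \<Union>(arcs D)" using Union_arcs[of D] True by blast
      then show ?thesis using True by (auto simp: nodes_def)
    qed
  next
    case False
    then have DE: "D \<in> E'" "D \<in> E" using D(1) kept by blast+
    have "D \<in> base_edge ` T" unfolding full_T by (rule DE(2))
    then obtain x where x: "x \<in> T" "base_edge x = D" by auto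
    have "x \<noteq> Bar D" using x DE(1) unfolding kept_eq by blast
    then have "strands_of x = free D" using x(2) by (cases x) (auto simp: strands_of_def)
    moreover have "p \<notin> s - ends X s" if "s \<in> segs D" for s
      by (rule p2) (use that DE(1) in \<open>auto simp: segs_def\<close>)
    then have "p \<in> free D" using D(2) unfolding free_def free_part_def by blast
    ultimately show ?thesis using x(1) by blast
  qed
next
  fix p assume p: "p \<in> \<Union>nodes \<union> (\<Union>x\<in>T. strands_of x)"
  \<comment> \<open>A free point of one disc is inside no segment whatever: a segment through it
    would lie on the boundary of this very disc.\<close>
  have off: "p \<notin> s - ends X s" if D: "D \<in> V \<union> E" and pf: "p \<in> free D" and s: "s \<in> \<Sigma>" for D s
  proof
    assume ps: "p \<in> s - ends X s"
    have "p \<in> D" using pf free_subset[of D] bd_subset[of D] by blast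
    then have "s \<subseteq> bd D" using segment_in_bd[OF D s] ps by blast
    then have "s \<in> segs D" using s bd_subset[of D] by (auto simp: segs_def)
    then show False using pf ps unfolding free_def free_part_def by blast
  qed
  have "\<exists>D\<in>V \<union> E'. p \<in> bd D \<and> (\<forall>s\<in>\<Sigma>'. p \<notin> s - ends X s)"
  proof (cases "p \<in> \<Union>nodes")
    case True
    then obtain v where v: "v \<in> V" "p \<in> free v" using arc_subset by (auto simp: nodes_def)
    then show ?thesis using off[of v] free_subset[of v] by blast
  next
    case False
    then obtain x where x: "x \<in> T" "p \<in> strands_of x" using p by blast
    let ?e = "base_edge x"
    have e: "?e \<in> E" by (rule T_edge[OF x(1)])
    show ?thesis
    proof (cases "x = Bar ?e")
      case True
      then obtain s where s: "s \<in> segs ?e" "p \<in> s" using x(2) by (cases x) (auto simp: strands_of_def)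
      then have sS: "s \<in> \<Sigma>" by (simp add: segs_def)
      obtain v where v: "v \<in> V" "s \<subseteq> bd v" using segment_V[OF sS] by blast
      have "p \<notin> t" if t: "t \<in> \<Sigma>'" for t
      proof
        assume "p \<in> t"
        then have "t = s" using segments_pairwise_disjoint[of t s] t sS s(2) by blast
        moreover obtain e' where e': "e' \<in> E'" "t \<subseteq> e'" using t by blast
        moreover have "?e \<noteq> e'" using e'(1) kept_iff[OF x(1)] True by auto
        ultimately have "p \<in> ?e \<inter> e'" "?e \<inter> e' = {}"
          using s disjoint_E[OF e, of e'] kept by (auto simp: segs_def)
        then show False by blast
      qed
      then show ?thesis using v s(2) by blast
    next
      case False
      then have "?e \<in> E'" using kept_iff[OF x(1)] by simp
      moreover have "p \<in> free ?e" using x(2) False by (cases x) (auto simp: strands_of_def)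
      ultimately show ?thesis using off[of ?e] e free_subset[of ?e] by blast
    qed
  qed
  then show "p \<in> surface_boundary X2" unfolding surface_boundary_X2 by blast
qed

text \<open>The pieces are the nodes and two strands for every edge. Distinct strands are disjoint,
  as are distinct nodes, and a node meets a strand only in corners of that strand; so pieces hang
  together exactly as the pairs of \<open>rel T\<close> prescribe.\<close>

theorem num_boundary_components_eq:
  "card (connected_components_of (subtopology X2 (surface_boundary X2))) = K T"
proof -
  obtain P :: "'a set decorated \<Rightarrow> bool \<Rightarrow> 'a set" where
    P: "\<And>x. x \<in> T \<Longrightarrow> (\<forall>j. closedin X2 (P x j) \<and> connectedin X2 (P x j) \<and>
      P x j \<inter> corners (base_edge x) = {cor (base_edge x) (fst (strand x j)), cor (base_edge x) (snd (strand x j))}) \<and>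
      P x True \<inter> P x False = {} \<and> P x True \<union> P x False = strands_of x"
    using pieces_exist by metis
  let ?Y = "subtopology X2 (surface_boundary X2)"
  let ?a = "\<lambda>x j. cor (base_edge x) (fst (strand x j))" and ?b = "\<lambda>x j. cor (base_edge x) (snd (strand x j))"
  let ?na = "\<lambda>x j. nd (base_edge x) (fst (strand x j))" and ?nb = "\<lambda>x j. nd (base_edge x) (snd (strand x j))"
  have Pcor: "P x j \<inter> corners (base_edge x) = {?a x j, ?b x j}" if "x \<in> T" for x j using P[OF that] by blast
  have Pcl: "closedin X2 (P x j)" "connectedin X2 (P x j)" if "x \<in> T" for x j using P[OF that] by blast+
  have Psub: "P x j \<subseteq> strands_of x" if "x \<in> T" for x j using P[OF that] by (cases j) auto
  have R: "rel T = (\<Union>x\<in>T. matching x)" by (rule rel_transversal[OF full_T])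
  have pair: "(?na x j, ?nb x j) \<in> rel T" if "x \<in> T" for x j
    unfolding R matching_strand using that by blast
  have bsub: "\<Union>nodes \<subseteq> surface_boundary X2" "x \<in> T \<Longrightarrow> P x j \<subseteq> surface_boundary X2" for x j
    unfolding boundary_decomposition using Psub by blast+
  have bX2: "surface_boundary X2 \<subseteq> topspace X2" by (auto simp: surface_boundary_flat)
  have nV: "n \<subseteq> \<Union>V" if n: "n \<in> nodes" for n
  proof -
    obtain v where v: "v \<in> V" "n \<in> arcs v" using n by (auto simp: nodes_def)
    then show ?thesis using node_in_V[OF v] by blast
  qed
  have ncl: "closedin X n" if "n \<in> nodes" for n
    using that arc_closed by (auto simp: nodes_def)
  have Yconn: "connectedin ?Y A" if "connectedin X2 A" "A \<subseteq> surface_boundary X2" for A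
    using that by (simp add: connectedin_subtopology)
  have node_conn: "connectedin ?Y n" if n: "n \<in> nodes" for n
  proof (rule Yconn)
    have "connectedin X n" using n arc_connected by (auto simp: nodes_def)
    then show "connectedin X2 n" by (rule connectedin_X2_V[OF nV[OF n]])
    show "n \<subseteq> surface_boundary X2" using bsub(1) n by blast
  qed
  \<comment> \<open>Vertices and edges meet only in segments, and an arc of a vertex contains no
    points of a segment but its ends.\<close>
  have at_corner: "z \<in> {?a x j, ?b x j}" if n: "n \<in> nodes" "z \<in> n" and x: "x \<in> T" "z \<in> P x j" for n z x j
  proof -
    obtain v where v: "v \<in> V" "n \<in> arcs v" using n(1) by (auto simp: nodes_def)
    have zf: "z \<in> free v" using arc_subset[OF v(2)] n(2) by blast
    have zv: "z \<in> v" using node_in_V[OF v] n(2) by blast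
    have ze: "z \<in> base_edge x" using x(2) Psub[OF x(1)] strands_subset[OF x(1)] by blast
    obtain s where s: "s \<in> \<Sigma>" "z \<in> s" "s \<subseteq> bd v" "s \<subseteq> bd (base_edge x)"
      using meet_segment[OF v(1) T_edge[OF x(1)] zv ze] .
    have "s \<in> segs v" using s bd_subset[of v] by (auto simp: segs_def)
    then have "z \<in> ends X s" using zf s(2) unfolding free_def free_part_def by blast
    moreover have "s \<in> segs (base_edge x)" using s bd_subset[of "base_edge x"] by (auto simp: segs_def)
    ultimately have "z \<in> corners (base_edge x)" by (auto simp: corners_def)
    then show ?thesis using Pcor[OF x(1)] x(2) by blast
  qed
  define A :: "'a set + 'a set decorated \<times> bool \<Rightarrow> 'a set" where "A = case_sum (\<lambda>n. n) (\<lambda>(x, j). P x j)"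
  define f :: "'a set + 'a set decorated \<times> bool \<Rightarrow> 'a set" where "f = case_sum (\<lambda>n. n) (\<lambda>(x, j). ?na x j)"
  have A: "A (Inl n) = n" "A (Inr (x, j)) = P x j" and f: "f (Inl n) = n" "f (Inr (x, j)) = ?na x j" for n x j
    by (simp_all add: A_def f_def)
  let ?I = "Inl ` nodes \<union> Inr ` (T \<times> (UNIV :: bool set))"
  have I_cases: "(\<exists>n\<in>nodes. i = Inl n) \<or> (\<exists>x\<in>T. \<exists>j. i = Inr (x, j))" if "i \<in> ?I" for i
    using that by auto
  have mixed: "(n, ?na x j) \<in> eqcl (rel T)" if n: "n \<in> nodes" and x: "x \<in> T" and ne: "n \<inter> P x j \<noteq> {}" for n x j
  proof -
    obtain z where z: "z \<in> n" "z \<in> P x j" using ne by blast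
    \<comment> \<open>A strand is represented by the node at its first corner; if \<open>n\<close>
      is at the second one, the pair of the strand itself relates the two nodes.\<close>
    have "?a x j \<in> n \<or> ?b x j \<in> n" using at_corner[OF n z(1) x z(2)] z(1) by blast
    then have "?na x j = n \<or> ?nb x j = n"
      using nd_eq_iff[OF T_edge[OF x] strand_less(1) n] nd_eq_iff[OF T_edge[OF x] strand_less(2) n] by blast
    then show ?thesis using eqcl_sym[OF eqcl_base[OF pair[OF x]]] by auto
  qed
  show ?thesis
    unfolding K_def
  proof (rule card_connected_components_of_graph)
    show "finite ?I" using finite_nodes finite_partial[OF partial_T] by simp
    show "closedin ?Y (A i)" if i: "i \<in> ?I" for i
    proof -
      have "closedin X2 (A i) \<and> A i \<subseteq> surface_boundary X2"
        using I_cases[OF i]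
      proof
        assume "\<exists>n\<in>nodes. i = Inl n"
        then obtain n where n: "n \<in> nodes" "i = Inl n" by blast
        then show ?thesis using closedin_X2_V[OF nV ncl] bsub(1) A(1) by auto
      next
        assume "\<exists>x\<in>T. \<exists>j. i = Inr (x, j)"
        then obtain x j where x: "x \<in> T" "i = Inr (x, j)" by blast
        then show ?thesis using Pcl(1) bsub(2) A(2) by simp
      qed
      then show ?thesis using closedin_subset_topspace by blast
    qed
    show "connectedin ?Y (A i)" if i: "i \<in> ?I" for i
      using I_cases[OF i]
    proof
      assume "\<exists>n\<in>nodes. i = Inl n"
      then obtain n where n: "n \<in> nodes" "i = Inl n" by blast
      then show ?thesis using node_conn A(1) by simp
    next
      assume "\<exists>x\<in>T. \<exists>j. i = Inr (x, j)"
      then obtain x j where x: "x \<in> T" "i = Inr (x, j)" by blast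
      then show ?thesis using Yconn[OF Pcl(2) bsub(2)] A(2) by simp
    qed
    have "(\<Union>i\<in>?I. A i) = \<Union>nodes \<union> (\<Union>x\<in>T. P x True \<union> P x False)"
    proof -
      have "(\<Union>i\<in>Inr ` (T \<times> UNIV). A i) = (\<Union>x\<in>T. P x True \<union> P x False)"
      proof (intro set_eqI iffI)
        fix z assume "z \<in> (\<Union>i\<in>Inr ` (T \<times> UNIV). A i)"
        then obtain i where "i \<in> T \<times> (UNIV :: bool set)" "z \<in> A (Inr i)" by auto
        then obtain x j where x: "x \<in> T" "z \<in> P x j" using A(2) by (cases i) simp
        then show "z \<in> (\<Union>x\<in>T. P x True \<union> P x False)" by (cases j) auto
      next
        fix z assume "z \<in> (\<Union>x\<in>T. P x True \<union> P x False)"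
        then obtain x where x: "x \<in> T" "z \<in> P x True \<or> z \<in> P x False" by blast
        then obtain j where "z \<in> P x j" by blast
        then have "z \<in> A (Inr (x, j))" by (simp add: A(2))
        moreover have "Inr (x, j) \<in> Inr ` (T \<times> UNIV)" using x(1) by simp
        ultimately show "z \<in> (\<Union>i\<in>Inr ` (T \<times> UNIV). A i)" by (rule UN_I[rotated])
      qed
      moreover have "(\<Union>i\<in>Inl ` nodes. A i) = \<Union>nodes" by (simp add: A)
      ultimately show ?thesis by (simp only: UN_Un)
    qed
    also have "\<dots> = surface_boundary X2"
      unfolding boundary_decomposition using P by simp
    finally show "(\<Union>i\<in>?I. A i) = topspace ?Y" using bX2 by (simp add: inf.absorb2)
    show "rel T \<subseteq> nodes \<times> nodes" by (rule rel_subset[OF partial_T])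
    show "f i \<in> nodes" if i: "i \<in> ?I" for i
      using I_cases[OF i] f cor_node(1)[OF T_edge strand_less(1)] by auto
    show "(f i, f k) \<in> eqcl (rel T)" if i: "i \<in> ?I" and k: "k \<in> ?I" and ne: "A i \<inter> A k \<noteq> {}" for i k
      using I_cases[OF i] I_cases[OF k]
    proof (elim disjE)
      assume "\<exists>n\<in>nodes. i = Inl n" "\<exists>n\<in>nodes. k = Inl n"
      then obtain m n where mn: "m \<in> nodes" "i = Inl m" "n \<in> nodes" "k = Inl n" by blast
      then have "m = n" using nodes_disjoint[of m n] ne A(1) by auto
      then show ?thesis using mn by simp
    next
      assume "\<exists>n\<in>nodes. i = Inl n" "\<exists>x\<in>T. \<exists>j. k = Inr (x, j)"
      then obtain n x j where *: "n \<in> nodes" "i = Inl n" "x \<in> T" "k = Inr (x, j)" by blast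
      then show ?thesis using mixed[of n x j] ne A f by simp
    next
      assume "\<exists>x\<in>T. \<exists>j. i = Inr (x, j)" "\<exists>n\<in>nodes. k = Inl n"
      then obtain n x j where *: "n \<in> nodes" "k = Inl n" "x \<in> T" "i = Inr (x, j)" by blast
      then show ?thesis using eqcl_sym[OF mixed[of n x j]] ne A f by (simp add: Int_commute)
    next
      assume "\<exists>x\<in>T. \<exists>j. i = Inr (x, j)" "\<exists>x\<in>T. \<exists>j. k = Inr (x, j)"
      then obtain x j y l where *: "x \<in> T" "i = Inr (x, j)" "y \<in> T" "k = Inr (y, l)" by blast
      then obtain z where z: "z \<in> P x j" "z \<in> P y l" using ne A(2) by auto
      have "z \<in> base_edge x" "z \<in> base_edge y"
        using z Psub[OF *(1)] Psub[OF *(3)] strands_subset[OF *(1)] strands_subset[OF *(3)] by blast+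
      then have "base_edge x = base_edge y" using disjoint_E[OF T_edge[OF *(1)] T_edge[OF *(3)]] by blast
      then have xy: "x = y" by (rule T_unique[OF *(1,3)])
      have "P x True \<inter> P x False = {}" using P[OF *(1)] by blast
      then have "j = l" using z xy by (cases j; cases l) auto
      then show ?thesis using xy * by simp
    qed
    show "n \<noteq> {} \<and> connectedin ?Y n" if n: "n \<in> nodes" for n
      using node_conn[OF n] n arc_nonempty by (auto simp: nodes_def)
    have corner_in: "?a x j \<in> P x j" "?b x j \<in> P x j" if "x \<in> T" for x j using Pcor[OF that] by blast+
    have corner_node: "?a x j \<in> ?na x j" "?b x j \<in> ?nb x j" if "x \<in> T" for x j
      using cor_node(2)[OF T_edge[OF that] strand_less(1)] cor_node(2)[OF T_edge[OF that] strand_less(2)] by blast+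
    show "A i \<inter> f i \<noteq> {}" if i: "i \<in> ?I" for i
      using I_cases[OF i]
    proof
      assume "\<exists>n\<in>nodes. i = Inl n"
      then obtain n where n: "n \<in> nodes" "i = Inl n" by blast
      then obtain v where "n \<in> arcs v" by (auto simp: nodes_def)
      then have "n \<noteq> {}" by (rule arc_nonempty)
      then show ?thesis using n(2) A(1) f(1) by simp
    next
      assume "\<exists>x\<in>T. \<exists>j. i = Inr (x, j)"
      then obtain x j where x: "x \<in> T" "i = Inr (x, j)" by blast
      then show ?thesis using corner_in(1)[OF x(1), of j] corner_node(1)[OF x(1), of j] A f by auto
    qed
    show "\<exists>a\<in>n. \<exists>b\<in>n'. connected_component_of ?Y a b" if nn: "(n, n') \<in> rel T" for n n'
    proof -
      obtain x j where x: "x \<in> T" "n = ?na x j" "n' = ?nb x j" using nn unfolding R matching_strand by blast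
      have "connectedin ?Y (P x j)" by (rule Yconn[OF Pcl(2)[OF x(1)] bsub(2)[OF x(1)]])
      then have "connected_component_of ?Y (?a x j) (?b x j)"
        unfolding connected_component_of_def using corner_in[OF x(1), of j] by blast
      then show ?thesis using corner_node[OF x(1), of j] x by blast
    qed
    show "\<exists>i\<in>?I. (f i, n) \<in> eqcl (rel T)" if n: "n \<in> nodes" for n
      by (rule bexI[of _ "Inl n"]) (use n f(1) in auto)
  qed
qed

end

context ribbon
begin

section \<open>Decorated transversals and ordered tripartitions\<close>

lemma triple_transversal_mem:
  "Dot e \<in> triple_transversal (A, B, C) \<longleftrightarrow> e \<in> A"
  "Bar e \<in> triple_transversal (A, B, C) \<longleftrightarrow> e \<in> B"
  "Hat e \<in> triple_transversal (A, B, C) \<longleftrightarrow> e \<in> C"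
  by (auto simp: triple_transversal_def)

lemma triple_transversal_partial:
  assumes "(A, B, C) \<in> ordered_tripartitions E"
  shows "partial (triple_transversal (A, B, C))" "base_edge ` triple_transversal (A, B, C) = E"
proof -
  have im: "base_edge ` triple_transversal (A, B, C) = A \<union> B \<union> C"
    by (auto simp: triple_transversal_def image_Un image_image)
  then show full: "base_edge ` triple_transversal (A, B, C) = E"
    using assms by (simp add: ordered_tripartitions_def)
  have "inj_on base_edge (triple_transversal (A, B, C))"
    using assms by (auto simp: triple_transversal_def ordered_tripartitions_def inj_on_def)
  then show "partial (triple_transversal (A, B, C))" using full by (simp add: partial_def)
qed

lemma triple_transversal_surj:
  assumes T: "partial T" "base_edge ` T = E"
  defines "A \<equiv> {e. Dot e \<in> T}" and "B \<equiv> {e. Bar e \<in> T}" and "C \<equiv> {e. Hat e \<in> T}"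
  shows "(A, B, C) \<in> ordered_tripartitions E" "triple_transversal (A, B, C) = T"
proof -
  show 1: "triple_transversal (A, B, C) = T"
  proof (rule set_eqI)
    fix x show "x \<in> triple_transversal (A, B, C) \<longleftrightarrow> x \<in> T"
      by (cases x) (simp_all add: triple_transversal_mem A_def B_def C_def)
  qed
  have uniq: "x = y" if "x \<in> T" "y \<in> T" "base_edge x = base_edge y" for x y
    using T(1) that unfolding partial_def by (meson inj_onD)
  have "A \<union> B \<union> C = base_edge ` triple_transversal (A, B, C)"
    by (auto simp: triple_transversal_def image_Un image_image)
  then have "A \<union> B \<union> C = E" unfolding 1 T(2) .
  moreover have "A \<inter> B = {}" "A \<inter> C = {}" "B \<inter> C = {}"
    using uniq unfolding A_def B_def C_def by fastforce+
  ultimately show "(A, B, C) \<in> ordered_tripartitions E" by (simp add: ordered_tripartitions_def)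
qed

text \<open>The chosen maps enter only through being half-twists, which
  \<open>half_twist_exists\<close> guarantees for every edge of \<open>C\<close>. All other edges
  are glued back by the identity, and deletion keeps the edges in \<open>E - B\<close>, so the
  general count applies.\<close>

lemma num_boundary_components_triple:
  assumes P: "(A, B, C) \<in> ordered_tripartitions E"
  shows "num_boundary_components (delete_edges (partial_petrial G C) B) = K (triple_transversal (A, B, C))"
proof -
  define h where "h = (\<lambda>e. if e \<in> C then (SOME h. half_twist G e h) else id)"
  let ?T = "triple_transversal (A, B, C)"
  have ht: "half_twist G e (h e)" if "e \<in> E" "e \<in> C" for e
    using someI_ex[OF half_twist_exists[OF that(1)]] that(2) by (simp add: h_def)
  have hi: "h e = id" if "e \<notin> C" for e using that by (simp add: h_def)
  interpret transversal_ribbon G h "E - B" ?T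
  proof unfold_locales
    show "homeomorphic_map (subtopology X s) (subtopology X s) (h e)"
      if "e \<in> E" "s \<in> \<Sigma>" "s \<subseteq> e" for e s
      using half_twist_homeomorphic[OF that(1) ht that(2,3)] that(1) hi[of e] by (cases "e \<in> C") simp_all
    show "h e x = x" if "e \<in> E" "x \<notin> \<Union>{s \<in> \<Sigma>. s \<subseteq> e}" for e x
      using half_twist_fixed[OF ht that(2)] that(1) hi[of e] by (cases "e \<in> C") simp_all
    show "E - B \<subseteq> E" by blast
    show "partial ?T" "base_edge ` ?T = E" using triple_transversal_partial[OF P] by simp_all
    show "E - B = {e \<in> E. Bar e \<notin> ?T}" by (auto simp: triple_transversal_mem)
    show "h e = id" if "Dot e \<in> ?T" for e
      using that hi[of e] P by (auto simp: triple_transversal_mem ordered_tripartitions_def)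
    show "half_twist G e (h e)" if "Hat e \<in> ?T" for e
      using that ht[of e] P by (auto simp: triple_transversal_mem ordered_tripartitions_def)
  qed
  have "surface (delete_edges (partial_petrial G C) B) = X2"
    by (simp add: delete_edges_def partial_petrial_def reglue_def h_def)
  then show ?thesis unfolding num_boundary_components_def using num_boundary_components_eq by simp
qed

lemma carrier_ground: "carrier_set G = ground"
  by (simp add: carrier_set_def ground_def)

theorem bases_eq: "multimatroid_bases (carrier_set G) (skew_classes G) rank = ribbon_bases G"
  unfolding carrier_ground skew_classes_def bases_rank
proof (intro set_eqI iffI)
  fix T assume "T \<in> {T. partial T \<and> base_edge ` T = E \<and> K T = K {}}"
  then have T: "partial T" "base_edge ` T = E" "K T = K {}" by auto
  define A B C where "A = {e. Dot e \<in> T}" and "B = {e. Bar e \<in> T}" and "C = {e. Hat e \<in> T}"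
  note tri = triple_transversal_surj[OF T(1,2), folded A_def B_def C_def]
  have "num_boundary_components (delete_edges (partial_petrial G C) B) = num_components G"
    using num_boundary_components_triple[OF tri(1)] tri(2) T(3) num_components_eq by simp
  then have "(A, B, C) \<in> quasi_tree_triples G" using tri(1) by (simp add: quasi_tree_triples_def)
  then show "T \<in> ribbon_bases G" unfolding ribbon_bases_def using tri(2) by blast
next
  fix T assume "T \<in> ribbon_bases G"
  then obtain A B C where ABC: "T = triple_transversal (A, B, C)" "(A, B, C) \<in> quasi_tree_triples G"
    unfolding ribbon_bases_def by blast
  then have P: "(A, B, C) \<in> ordered_tripartitions E"
    and b: "num_boundary_components (delete_edges (partial_petrial G C) B) = num_components G"
    by (simp_all add: quasi_tree_triples_def)
  have "K T = K {}" using num_boundary_components_triple[OF P] b num_components_eq ABC(1) by simp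
  then show "T \<in> {T. partial T \<and> base_edge ` T = E \<and> K T = K {}}"
    using triple_transversal_partial[OF P] ABC(1) by simp
qed

end

theorem theorem6p3:
  fixes G :: "'a ribbon"
  assumes "ribbon_graph G"
  shows "\<exists>r. tight_multimatroid (carrier_set G) (skew_classes G) r \<and>
             q_matroid 3 (carrier_set G) (skew_classes G) r \<and>
             multimatroid_bases (carrier_set G) (skew_classes G) r = ribbon_bases G"
proof -
  interpret ribbon G by unfold_locales (rule assms)
  have "tight_multimatroid (carrier_set G) (skew_classes G) rank"
    unfolding carrier_ground skew_classes_def by (rule tight_rank)
  moreover have "q_matroid 3 (carrier_set G) (skew_classes G) rank"
    unfolding q_matroid_def carrier_ground skew_classes_def using multimatroid_rank by (simp add: card_skew_class)
  ultimately show ?thesis using bases_eq by blast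
qed

end
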